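(* Let $(R,\mathfrak m)$ be a seminormal complete reduced local ring of dimension one. Then $\mathrm{Ref}(R)$ is of finite type.
   Context: All rings are commutative Noetherian with unity and modules are finitely generated. A reduced ring $R$ is seminormal if whenever $b,c\in R$ satisfy $b^3=c^2$, there is an $a\in R$ with $a^2=b$ and $a^3=c$. $\mathrm{Ref}(R)$ is the category of reflexive $R$-modules, i.e. those $M$ for which the natural map $M\to M^{**}$ is an isomorphism, with $M^*=\mathrm{Hom}_R(M,R)$. A category is of finite type if it has only finitely many indecomposable objects up to isomorphism. *)

theory Defs
  imports "HOL-Algebra.Algebra" "HOL-Library.Extended_Nat"
begin

section \<open>Rings\<close>

definition reduced_ring :: "('a, 'r) ring_scheme \<Rightarrow> bool" where
  "reduced_ring R \<longleftrightarrow>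
     (\<forall>a \<in> carrier R. \<forall>n::nat. a [^]\<^bsub>R\<^esub> n = \<zero>\<^bsub>R\<^esub> \<longrightarrow> a = \<zero>\<^bsub>R\<^esub>)"

definition seminormal_ring :: "('a, 'r) ring_scheme \<Rightarrow> bool" where
  "seminormal_ring R \<longleftrightarrow> reduced_ring R \<and>
     (\<forall>b \<in> carrier R. \<forall>c \<in> carrier R. b [^]\<^bsub>R\<^esub> (3::nat) = c [^]\<^bsub>R\<^esub> (2::nat) \<longrightarrow>
        (\<exists>a \<in> carrier R. a [^]\<^bsub>R\<^esub> (2::nat) = b \<and> a [^]\<^bsub>R\<^esub> (3::nat) = c))"

definition local_ring_with :: "('a, 'r) ring_scheme \<Rightarrow> 'a set \<Rightarrow> bool" where
  "local_ring_with R m \<longleftrightarrow>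
     cring R \<and> maximalideal m R \<and> (\<forall>n. maximalideal n R \<longrightarrow> n = m)"

text \<open>The supremum of the lengths of strict chains \<open>P 0 \<subset> \<dots> \<subset> P n\<close> of prime ideals.
  For the zero ring, which has no primes, this yields \<open>0\<close> rather than \<open>-\<infinity>\<close>.\<close>

definition krull_dim :: "('a, 'r) ring_scheme \<Rightarrow> enat" where
  "krull_dim R = Sup {enat n | n. \<exists>P :: nat \<Rightarrow> 'a set.
     (\<forall>i \<le> n. primeideal (P i) R) \<and> (\<forall>i < n. P i \<subset> P (Suc i))}"

text \<open>In the monoid of ideals \<open>I ^ 0\<close> is the unit ideal.\<close>

abbreviation ideal_pow :: "('a, 'r) ring_scheme \<Rightarrow> 'a set \<Rightarrow> nat \<Rightarrow> 'a set" where
  "ideal_pow R I n \<equiv> I [^]\<^bsub>ideals_set R\<^esub> n"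

text \<open>The underlying set of the inverse limit of the rings \<open>R / I ^ n\<close>.  The transition map
  sends a coset of \<open>I ^ Suc n\<close> to the unique coset of \<open>I ^ n\<close> containing it, so that
  compatibility of a family of cosets is inclusion.\<close>

definition adic_limit :: "('a, 'r) ring_scheme \<Rightarrow> 'a set \<Rightarrow> (nat \<Rightarrow> 'a set) set" where
  "adic_limit R I = {c. (\<forall>n. c n \<in> carrier (R Quot (ideal_pow R I n))) \<and>
                        (\<forall>n. c (Suc n) \<subseteq> c n)}"

text \<open>The canonical map from \<open>R\<close> to its \<open>I\<close>-adic completion is an isomorphism.\<close>

definition adically_complete :: "('a, 'r) ring_scheme \<Rightarrow> 'a set \<Rightarrow> bool" where
  "adically_complete R I \<longleftrightarrow>
     bij_betw (\<lambda>a n. ideal_pow R I n +>\<^bsub>R\<^esub> a) (carrier R) (adic_limit R I)"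


section \<open>Modules\<close>

text \<open>The module record of the library extends the ring record; the fields \<open>mult\<close> and \<open>one\<close>
  have no meaning for a module, and no definition below looks at them.\<close>

text \<open>Homomorphisms are taken to be extensional, so that equality in \<open>mod_hom\<close> is
  equality of maps on the carrier.\<close>

definition mod_hom ::
  "('a, 'r) ring_scheme \<Rightarrow> ('a, 'b) module \<Rightarrow> ('a, 'c) module \<Rightarrow> ('b \<Rightarrow> 'c) set" where
  "mod_hom R M N = {f \<in> carrier M \<rightarrow>\<^sub>E carrier N.
     (\<forall>x \<in> carrier M. \<forall>y \<in> carrier M. f (x \<oplus>\<^bsub>M\<^esub> y) = f x \<oplus>\<^bsub>N\<^esub> f y) \<and>
     (\<forall>a \<in> carrier R. \<forall>x \<in> carrier M. f (a \<odot>\<^bsub>M\<^esub> x) = a \<odot>\<^bsub>N\<^esub> f x)}"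

definition mod_iso ::
  "('a, 'r) ring_scheme \<Rightarrow> ('a, 'b) module \<Rightarrow> ('a, 'c) module \<Rightarrow> ('b \<Rightarrow> 'c) set" where
  "mod_iso R M N = {f \<in> mod_hom R M N. bij_betw f (carrier M) (carrier N)}"

definition Hom_module ::
  "('a, 'r) ring_scheme \<Rightarrow> ('a, 'b) module \<Rightarrow> ('a, 'c) module \<Rightarrow> ('a, 'b \<Rightarrow> 'c) module" where
  "Hom_module R M N =
     \<lparr>carrier = mod_hom R M N, monoid.mult = undefined, one = undefined,
      ring.zero = (\<lambda>x \<in> carrier M. \<zero>\<^bsub>N\<^esub>),
      ring.add = (\<lambda>f g. \<lambda>x \<in> carrier M. f x \<oplus>\<^bsub>N\<^esub> g x),
      smult = (\<lambda>a f. \<lambda>x \<in> carrier M. a \<odot>\<^bsub>N\<^esub> f x)\<rparr>"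

definition regular_module :: "('a, 'r) ring_scheme \<Rightarrow> ('a, 'a) module" where
  "regular_module R =
     \<lparr>carrier = carrier R, monoid.mult = monoid.mult R, one = one R,
      ring.zero = ring.zero R, ring.add = ring.add R, smult = monoid.mult R\<rparr>"

definition dual_module :: "('a, 'r) ring_scheme \<Rightarrow> ('a, 'b) module \<Rightarrow> ('a, 'b \<Rightarrow> 'a) module" where
  "dual_module R M = Hom_module R M (regular_module R)"

definition bidual_map ::
  "('a, 'r) ring_scheme \<Rightarrow> ('a, 'b) module \<Rightarrow> 'b \<Rightarrow> ('b \<Rightarrow> 'a) \<Rightarrow> 'a" where
  "bidual_map R M = (\<lambda>x \<in> carrier M. \<lambda>f \<in> carrier (dual_module R M). f x)"

definition reflexive_module :: "('a, 'r) ring_scheme \<Rightarrow> ('a, 'b) module \<Rightarrow> bool" where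
  "reflexive_module R M \<longleftrightarrow>
     bidual_map R M \<in> mod_iso R M (dual_module R (dual_module R M))"

definition fin_gen_module :: "('a, 'r) ring_scheme \<Rightarrow> ('a, 'b) module \<Rightarrow> bool" where
  "fin_gen_module R M \<longleftrightarrow> (\<exists>A \<subseteq> carrier M. finite A \<and>
     (\<forall>H. submodule H R M \<and> A \<subseteq> H \<longrightarrow> H = carrier M))"

text \<open>The objects of the category \<open>Ref(R)\<close>.\<close>

definition Ref_obj :: "('a, 'r) ring_scheme \<Rightarrow> ('a, 'b) module \<Rightarrow> bool" where
  "Ref_obj R M \<longleftrightarrow> module R M \<and> fin_gen_module R M \<and> reflexive_module R M"

text \<open>A nonzero object is indecomposable if it is not the (internal) direct sum of two
  nonzero objects of \<open>Ref(R)\<close>.\<close>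

definition Ref_indecomposable :: "('a, 'r) ring_scheme \<Rightarrow> ('a, 'b) module \<Rightarrow> bool" where
  "Ref_indecomposable R M \<longleftrightarrow> Ref_obj R M \<and> carrier M \<noteq> {\<zero>\<^bsub>M\<^esub>} \<and>
     (\<forall>H K. submodule H R M \<and> submodule K R M \<and>
            Ref_obj R (M\<lparr>carrier := H\<rparr>) \<and> Ref_obj R (M\<lparr>carrier := K\<rparr>) \<and>
            H \<inter> K = {\<zero>\<^bsub>M\<^esub>} \<and> H <+>\<^bsub>M\<^esub> K = carrier M
        \<longrightarrow> H = {\<zero>\<^bsub>M\<^esub>} \<or> K = {\<zero>\<^bsub>M\<^esub>})"

text \<open>Some finite set of indecomposable objects represents all isomorphism classes of
  indecomposable objects.  HOL cannot quantify over the types that carry modules inside a formula,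
  so the type \<open>'b\<close> of the modules to be classified is a parameter, to be left arbitrary.
  The representatives live in a type that depends on \<open>'a\<close> only and in which every finitely
  generated \<open>R\<close>-module has an isomorphic copy, namely a quotient of some \<open>R ^ k\<close>, whose
  elements are cosets of tuples \<open>{..<k} \<rightarrow>\<^sub>E carrier R\<close>.\<close>

definition Ref_finite_type :: "'b itself \<Rightarrow> ('a, 'r) ring_scheme \<Rightarrow> bool" where
  "Ref_finite_type _ R \<longleftrightarrow> (\<exists>S :: ('a, (nat \<Rightarrow> 'a) set) module set.
     finite S \<and> (\<forall>N \<in> S. Ref_indecomposable R N) \<and>
     (\<forall>M :: ('a, 'b) module. Ref_indecomposable R M \<longrightarrow> (\<exists>N \<in> S. mod_iso R M N \<noteq> {})))"

end

theory Submission
  imports Defs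
begin

text \<open>
  Let \<open>x \<in> \<mm>\<close> be a nonzerodivisor and \<open>E = End(\<mm>) = \<mm> : \<mm>\<close>.  Seminormality says that \<open>\<mm>\<close> is a
  radical ideal of \<open>E\<close>, so \<open>E/\<mm>\<close>, being finite over the field \<open>R/\<mm>\<close>, is von Neumann regular.
  Let \<open>M\<close> be an indecomposable reflexive module.  If some functional on \<open>M\<close> takes a unit value
  then \<open>M \<cong> R\<close>.  Otherwise the dual of \<open>M\<close> is \<open>Hom(M, \<mm>)\<close>, an \<open>E\<close>-module, and so is its dual \<open>M\<close>.
  Every \<open>h\<close> in the dual of \<open>M\<close> maps \<open>M : \<mm>\<close> to \<open>E\<close>.  Pick \<open>h\<close> and \<open>c \<in> M : \<mm>\<close> such that
  \<open>e = h(c)\<close> is idempotent modulo \<open>\<mm>\<close> and generates the largest possible ideal modulo \<open>\<mm>\<close>.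
  Maximality forces \<open>1 - e\<close> to map \<open>M : \<mm>\<close> into \<open>M\<close>, whence \<open>M = eM\<close> by Nakayama's lemma and
  \<open>M = \<mm>c \<oplus> ker h\<close>, so that \<open>M \<cong> e\<mm>\<close>.  The isomorphism class of \<open>e\<mm>\<close> is determined by the
  annihilator of \<open>e(x)\<close>, and a reduced Noetherian ring has only finitely many annihilators of
  elements.
\<close>

section \<open>Ideals in Noetherian rings\<close>

text \<open>No total ring of fractions is built. A fixed nonzerodivisor \<open>x\<close> of
  \<open>\<mm>\<close> replaces it: an element \<open>s\<close> of \<open>\<mm> : \<mm>\<close> is a
  map on \<open>\<mm>\<close> determined by \<open>s(x)\<close>, \<open>M : \<mm>\<close> is
  represented by its multiple by \<open>x\<close>, and equations are tested after multiplication by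
  \<open>x\<close>. Evaluation at \<open>x\<close> also embeds the \<open>R\<close>-submodules of
  \<open>E\<close> in the ideals of \<open>R\<close>, so finiteness statements about
  \<open>E\<close> reduce to ascending chains of ideals of \<open>R\<close>.

  The obstacle is that \<open>e\<close> is idempotent only modulo \<open>\<mm>\<close>, so
  \<open>e\<close> and \<open>1 - e\<close> do not split \<open>M\<close> directly. Maximality can
  be exploited because, for values \<open>e = h(c)\<close> and \<open>b = h'(c')\<close>, the
  element \<open>e + (1 - e) b\<close> is again a value modulo \<open>\<mm>\<close>: when
  \<open>e h + (1 - e) h'\<close> is applied to \<open>e c + (1 - e) c'\<close>, the mixed terms
  carry the factor \<open>e (1 - e)\<close>, which lies in \<open>\<mm>\<close>. Nakayama's lemma
  absorbs the remaining error, since dimension one puts a power of \<open>\<mm>\<close> inside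
  \<open>xR\<close>. The splitting of \<open>M\<close> then comes from \<open>h\<close> being
  injective on \<open>\<mm> c\<close>, not from an idempotent.\<close>

lemma (in noetherian_ring) maximal_in_ideal_family:
  assumes "A \<noteq> {}" and "\<And>I. I \<in> A \<Longrightarrow> ideal I R"
  obtains I where "I \<in> A" and "\<And>J. J \<in> A \<Longrightarrow> I \<subseteq> J \<Longrightarrow> J = I"
proof -
  have "\<exists>M\<in>A. \<forall>J\<in>A. M \<subseteq> J \<longrightarrow> J = M"
  proof (rule subset_Zorn)
    fix C assume C: "subset.chain A C"
    show "\<exists>U\<in>A. \<forall>J\<in>C. J \<subseteq> U"
    proof (cases "C = {}")
      case True
      with assms(1) show ?thesis by blast
    next
      case False
      have "subset.chain {I. ideal I R} C"
        using C assms(2) by (auto simp: pred_on.chain_def)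
      with False have "\<Union>C \<in> C" by (rule ideal_chain_is_trivial)
      with C show ?thesis by (auto simp: pred_on.chain_def)
    qed
  qed
  then show thesis using that by blast
qed

text \<open>One repetition, rather than eventual constancy, is all that the chains
  \<open>colon_chain\<close> and \<open>L\<close> below require.\<close>

lemma (in noetherian_ring) ascending_ideals_stabilise:
  fixes L :: "nat \<Rightarrow> 'a set"
  assumes "\<And>n. ideal (L n) R" and "\<And>n. L n \<subseteq> L (Suc n)"
  obtains n where "L (Suc n) = L n"
proof -
  obtain I where I: "I \<in> range L" "\<And>J. J \<in> range L \<Longrightarrow> I \<subseteq> J \<Longrightarrow> J = I"
    by (rule maximal_in_ideal_family[of "range L"]) (use assms(1) in auto)
  then show thesis using that assms(2) by (metis rangeE rangeI)
qed

lemma (in cring) ideal_cringI: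
  assumes "I \<subseteq> carrier R" and "\<zero> \<in> I"
    and "\<And>a b. a \<in> I \<Longrightarrow> b \<in> I \<Longrightarrow> a \<oplus> b \<in> I"
    and "\<And>a r. a \<in> I \<Longrightarrow> r \<in> carrier R \<Longrightarrow> r \<otimes> a \<in> I"
  shows "ideal I R"
proof (rule idealI[OF ring_axioms])
  have minus: "\<ominus> a \<in> I" if "a \<in> I" for a
    using assms(4)[OF that, of "\<ominus> \<one>"] that assms(1) by (simp add: l_minus subset_iff)
  show "subgroup I (add_monoid R)"
    by (rule add.subgroupI) (use assms minus in \<open>auto simp flip: a_inv_def\<close>)
  show "r \<otimes> a \<in> I" "a \<otimes> r \<in> I" if "a \<in> I" "r \<in> carrier R" for a r
    using assms(4)[OF that] m_comm[of a r] that assms(1) by auto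
qed

definition (in ring) adjoin :: "'a set \<Rightarrow> 'a \<Rightarrow> 'a set"
  where "adjoin I a = {i \<oplus> r \<otimes> a |i r. i \<in> I \<and> r \<in> carrier R}"

lemma (in ring) adjoinE:
  assumes "u \<in> adjoin I a"
  obtains i r where "u = i \<oplus> r \<otimes> a" "i \<in> I" "r \<in> carrier R"
  using assms by (auto simp: adjoin_def)

lemma (in ring) adjoinI: "i \<in> I \<Longrightarrow> r \<in> carrier R \<Longrightarrow> i \<oplus> r \<otimes> a \<in> adjoin I a"
  by (auto simp: adjoin_def)

lemma (in cring)
  assumes "ideal I R" and "a \<in> carrier R"
  shows adjoin_ideal: "ideal (adjoin I a) R"
    and subset_adjoin: "I \<subseteq> adjoin I a"
    and mem_adjoin: "a \<in> adjoin I a"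
proof -
  interpret I: ideal I R by fact
  note IC = I.Icarr
  note mem = adjoinI[of _ I _ a]
  show "ideal (adjoin I a) R"
  proof (rule ideal_cringI)
    show "adjoin I a \<subseteq> carrier R" using IC assms(2) by (auto elim!: adjoinE)
    show "\<zero> \<in> (adjoin I a)" using mem[of \<zero> \<zero>] assms(2) by simp
    fix u assume "u \<in> (adjoin I a)"
    then obtain i r where u: "u = i \<oplus> r \<otimes> a" and ir: "i \<in> I" "r \<in> carrier R" by (auto elim!: adjoinE)
    show "s \<otimes> u \<in> (adjoin I a)" if "s \<in> carrier R" for s
    proof -
      have "s \<otimes> u = (s \<otimes> i) \<oplus> (s \<otimes> r) \<otimes> a"
        unfolding u using ir that IC[OF ir(1)] assms(2) by (simp add: r_distr m_assoc)
      then show ?thesis using mem[of "s \<otimes> i" "s \<otimes> r"] ir that I.I_l_closed by simp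
    qed
    fix v assume "v \<in> (adjoin I a)"
    then obtain j s where v: "v = j \<oplus> s \<otimes> a" and js: "j \<in> I" "s \<in> carrier R" by (auto elim!: adjoinE)
    have "u \<oplus> v = (i \<oplus> j) \<oplus> (r \<oplus> s) \<otimes> a"
      unfolding u v using ir js IC[OF ir(1)] IC[OF js(1)] assms(2) by (simp add: l_distr a_ac)
    then show "u \<oplus> v \<in> (adjoin I a)" using mem[of "i \<oplus> j" "r \<oplus> s"] ir js by simp
  qed
  show "I \<subseteq> (adjoin I a)"
  proof
    fix i assume "i \<in> I"
    then show "i \<in> (adjoin I a)" using mem[of i \<zero>] IC assms(2) by simp
  qed
  show "a \<in> (adjoin I a)" using mem[of \<zero> \<one>] assms(2) by simp
qed

text \<open>This is \<open>(I + aR)(I + bR) \<subseteq> I\<close>, the computation shared by the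
  avoidance of a multiplicative set and the Noetherian induction for radicals.\<close>

lemma (in ideal) mult_mem:
  assumes "cring R" and "i \<in> I" "j \<in> I" and "a \<otimes> b \<in> I"
    and "r \<in> carrier R" "s \<in> carrier R" "a \<in> carrier R" "b \<in> carrier R"
  shows "(i \<oplus> r \<otimes> a) \<otimes> (j \<oplus> s \<otimes> b) \<in> I"
proof -
  interpret cring R by fact
  have "(i \<oplus> r \<otimes> a) \<otimes> (j \<oplus> s \<otimes> b)
      = i \<otimes> (j \<oplus> s \<otimes> b) \<oplus> ((r \<otimes> a) \<otimes> j \<oplus> (r \<otimes> s) \<otimes> (a \<otimes> b))"
    using assms Icarr[of i] Icarr[of j] by (simp add: l_distr r_distr m_ac a_ac)
  moreover have "i \<otimes> (j \<oplus> s \<otimes> b) \<in> I" using assms Icarr by (intro I_r_closed) auto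
  moreover have "(r \<otimes> a) \<otimes> j \<in> I" using assms by (intro I_l_closed) auto
  moreover have "(r \<otimes> s) \<otimes> (a \<otimes> b) \<in> I" using I_l_closed[OF assms(4)] assms by simp
  ultimately show ?thesis by simp
qed

text \<open>The colon ideal \<open>J : A\<close>. Taking a set \<open>A\<close> covers both
  \<open>J : r\<close>, needed for associated primes, and \<open>J : \<mm>\<close>, needed for the
  chain of colons.\<close>

lemma (in cring) colon_ideal:
  assumes "ideal J R" and "A \<subseteq> carrier R"
  shows "ideal {a \<in> carrier R. \<forall>p\<in>A. p \<otimes> a \<in> J} R"
proof -
  interpret J: ideal J R by fact
  show ?thesis
  proof (rule ideal_cringI)
    fix a r assume a: "a \<in> {a \<in> carrier R. \<forall>p\<in>A. p \<otimes> a \<in> J}" and r: "r \<in> carrier R"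
    have "p \<otimes> (r \<otimes> a) \<in> J" if "p \<in> A" for p
    proof -
      have "p \<otimes> (r \<otimes> a) = r \<otimes> (p \<otimes> a)"
        using that assms(2) a r by (intro m_lcomm) auto
      then show ?thesis using a r that J.I_l_closed by auto
    qed
    then show "r \<otimes> a \<in> {a \<in> carrier R. \<forall>p\<in>A. p \<otimes> a \<in> J}" using a r by simp
  qed (use assms(2) in \<open>auto simp: subset_iff r_distr J.a_closed\<close>)
qed

lemma (in cring) principal_multiples_ideal:
  assumes "a \<in> carrier R"
  shows "ideal ((\<lambda>r. a \<otimes> r) ` carrier R) R"
proof (rule ideal_cringI)
  show "\<zero> \<in> (\<otimes>) a ` carrier R" using assms r_null[OF assms] by (metis image_eqI zero_closed)
  show "u \<oplus> v \<in> (\<otimes>) a ` carrier R"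
    if "u \<in> (\<otimes>) a ` carrier R" "v \<in> (\<otimes>) a ` carrier R" for u v
    using that assms by (auto simp flip: r_distr)
  show "r \<otimes> u \<in> (\<otimes>) a ` carrier R" if "u \<in> (\<otimes>) a ` carrier R" "r \<in> carrier R" for u r
    using that assms by (auto simp: m_lcomm)
qed (use assms in auto)

section \<open>Primes and annihilators in commutative Noetherian rings\<close>

locale noetherian_cring = noetherian_ring R + cring R for R (structure)
begin

text \<open>An associated prime of \<open>R/J\<close>. Among the ideals \<open>J : r\<close> with
  \<open>r\<close> outside \<open>J\<close> a maximal one is prime: if \<open>ab\<close> lies in
  \<open>J : r\<close> and \<open>b\<close> does not, then \<open>J : rb\<close> contains
  \<open>J : r\<close>, so the two agree, and \<open>a\<close> belongs to
  \<open>J : rb\<close>.\<close>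

lemma prime_colon_ideal:
  assumes J: "ideal J R" and "J \<noteq> carrier R"
  obtains r where "r \<in> carrier R - J" and "primeideal {a \<in> carrier R. r \<otimes> a \<in> J} R"
proof -
  define Q where "Q = (\<lambda>r. {a \<in> carrier R. r \<otimes> a \<in> J})"
  interpret J: ideal J R by fact
  have Qid: "ideal (Q r) R" if "r \<in> carrier R" for r
    using colon_ideal[OF J, of "{r}"] that by (simp add: Q_def)
  obtain I where I: "I \<in> Q ` (carrier R - J)"
    "\<And>K. K \<in> Q ` (carrier R - J) \<Longrightarrow> I \<subseteq> K \<Longrightarrow> K = I"
  proof (rule maximal_in_ideal_family[of "Q ` (carrier R - J)"])
    show "Q ` (carrier R - J) \<noteq> {}" using assms J.a_subset by blast
  qed (use Qid in auto)
  obtain r where r: "r \<in> carrier R - J" "I = Q r" using I by blast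
  have "primeideal (Q r) R"
  proof (rule primeidealI[OF Qid is_cring])
    show "carrier R \<noteq> Q r"
      using r by (metis (no_types, lifting) DiffE Q_def mem_Collect_eq one_closed r_one)
    fix a b assume ab: "a \<in> carrier R" "b \<in> carrier R" "a \<otimes> b \<in> Q r"
    show "a \<in> Q r \<or> b \<in> Q r"
    proof (rule disjCI)
      assume b: "b \<notin> Q r"
      then have rb: "r \<otimes> b \<in> carrier R - J" using ab r by (simp add: Q_def)
      have "Q r \<subseteq> Q (r \<otimes> b)"
      proof
        fix c assume "c \<in> Q r"
        then have c: "c \<in> carrier R" "r \<otimes> c \<in> J" by (auto simp: Q_def)
        have "r \<otimes> b \<otimes> c = b \<otimes> (r \<otimes> c)" using c r ab by (simp add: m_ac)
        then show "c \<in> Q (r \<otimes> b)" using c ab J.I_l_closed by (simp add: Q_def)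
      qed
      then have "Q (r \<otimes> b) = Q r" using I(2) rb r by blast
      moreover have "r \<otimes> b \<otimes> a \<in> J" using ab r by (simp add: Q_def m_ac)
      then have "a \<in> Q (r \<otimes> b)" using ab by (simp add: Q_def)
      ultimately show "a \<in> Q r" by simp
    qed
  qed (use r in auto)
  then show thesis using that r by (simp add: Q_def)
qed

text \<open>Krull's argument: an ideal maximal among those disjoint from \<open>T\<close> is prime,
  because two elements outside it whose product is inside would yield two elements of
  \<open>T\<close> with product in the ideal. It stands in for a prime of the localisation at
  \<open>T\<close>.\<close>

lemma prime_avoiding_multiplicative_set:
  assumes T: "T \<subseteq> carrier R" "\<one> \<in> T" "\<And>a b. a \<in> T \<Longrightarrow> b \<in> T \<Longrightarrow> a \<otimes> b \<in> T"
    and "\<zero> \<notin> T"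
  obtains P where "primeideal P R" and "P \<inter> T = {}"
proof -
  obtain I where I: "I \<in> {I. ideal I R \<and> I \<inter> T = {}}"
    "\<And>K. K \<in> {I. ideal I R \<and> I \<inter> T = {}} \<Longrightarrow> I \<subseteq> K \<Longrightarrow> K = I"
    by (rule maximal_in_ideal_family[of "{I. ideal I R \<and> I \<inter> T = {}}"])
       (use zeroideal assms(4) in auto)
  interpret I: ideal I R using I by blast
  have meets: "\<exists>i r. i \<in> I \<and> r \<in> carrier R \<and> i \<oplus> r \<otimes> a \<in> T"
    if "a \<in> carrier R" "a \<notin> I" for a
  proof (rule ccontr)
    assume "\<not> ?thesis"
    then have "adjoin I a \<inter> T = {}" unfolding adjoin_def by blast
    then show False
      using adjoin_ideal[OF I.is_ideal that(1)] subset_adjoin[OF I.is_ideal that(1)]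
        mem_adjoin[OF I.is_ideal that(1)] that(2) I(2)[of "adjoin I a"] by auto
  qed
  have "primeideal I R"
  proof (rule primeidealI[OF I.is_ideal is_cring])
    show "carrier R \<noteq> I" using I T by auto
    fix a b assume ab: "a \<in> carrier R" "b \<in> carrier R" "a \<otimes> b \<in> I"
    show "a \<in> I \<or> b \<in> I"
    proof (rule ccontr)
      assume "\<not> (a \<in> I \<or> b \<in> I)"
      then obtain i r j s where *: "i \<in> I" "r \<in> carrier R" "i \<oplus> r \<otimes> a \<in> T"
        "j \<in> I" "s \<in> carrier R" "j \<oplus> s \<otimes> b \<in> T"
        using meets ab by meson
      have "(i \<oplus> r \<otimes> a) \<otimes> (j \<oplus> s \<otimes> b) \<in> I"
        using * ab by (intro I.mult_mem is_cring)
      then show False using T(3) * I by blast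
    qed
  qed
  then show thesis using that I by blast
qed

text \<open>Noetherian induction: a maximal ideal without such a decomposition would be prime.\<close>

lemma radical_finite_prime_intersection:
  assumes "ideal I R"
  obtains F where "finite F" and "\<And>P. P \<in> F \<Longrightarrow> primeideal P R \<and> I \<subseteq> P"
    and "\<And>z. z \<in> carrier R \<Longrightarrow> (\<forall>P\<in>F. z \<in> P) \<Longrightarrow> \<exists>n::nat. z [^] n \<in> I"
proof -
  define G where "G = (\<lambda>I. \<exists>F. finite F \<and> (\<forall>P\<in>F. primeideal P R \<and> I \<subseteq> P) \<and>
     (\<forall>z\<in>carrier R. (\<forall>P\<in>F. z \<in> P) \<longrightarrow> (\<exists>n::nat. z [^] n \<in> I)))"
  have "G I"
  proof (rule ccontr)
    assume "\<not> G I"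
    obtain J where J: "J \<in> {J. ideal J R \<and> \<not> G J}"
      "\<And>K. K \<in> {J. ideal J R \<and> \<not> G J} \<Longrightarrow> J \<subseteq> K \<Longrightarrow> K = J"
      by (rule maximal_in_ideal_family[of "{J. ideal J R \<and> \<not> G J}"])
         (use \<open>\<not> G I\<close> assms in auto)
    interpret J: ideal J R using J by blast
    have "\<not> G J" using J by blast
    have bigger: "G (adjoin J a)"
      if "a \<in> carrier R" "a \<notin> J" for a
      using adjoin_ideal[OF J.is_ideal that(1)] subset_adjoin[OF J.is_ideal that(1)]
        mem_adjoin[OF J.is_ideal that(1)] that(2) J(2)[of "adjoin J a"] by auto
    have "J \<noteq> carrier R"
    proof
      assume "J = carrier R"
      then have "G J" unfolding G_def by (intro exI[of _ "{}"]) auto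
      with \<open>\<not> G J\<close> show False ..
    qed
    moreover have "\<not> primeideal J R"
    proof
      assume "primeideal J R"
      then have "G J" unfolding G_def
        by (intro exI[of _ "{J}"]) (auto intro!: exI[of _ "1::nat"])
      with \<open>\<not> G J\<close> show False ..
    qed
    ultimately obtain a b where ab: "a \<in> carrier R" "b \<in> carrier R" "a \<otimes> b \<in> J" "a \<notin> J" "b \<notin> J"
      using primeidealI[OF J.is_ideal is_cring] by blast
    obtain F where F: "finite F"
      "\<forall>P\<in>F. primeideal P R \<and> adjoin J a \<subseteq> P"
      "\<forall>z\<in>carrier R. (\<forall>P\<in>F. z \<in> P) \<longrightarrow>
         (\<exists>n::nat. z [^] n \<in> adjoin J a)"
      using bigger[OF ab(1,4)] unfolding G_def by blast
    obtain F' where F': "finite F'"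
      "\<forall>P\<in>F'. primeideal P R \<and> adjoin J b \<subseteq> P"
      "\<forall>z\<in>carrier R. (\<forall>P\<in>F'. z \<in> P) \<longrightarrow>
         (\<exists>n::nat. z [^] n \<in> adjoin J b)"
      using bigger[OF ab(2,5)] unfolding G_def by blast
    have "G J" unfolding G_def
    proof (intro exI[of _ "F \<union> F'"] conjI ballI impI)
      show "finite (F \<union> F')" using F F' by simp
      show "primeideal P R" if "P \<in> F \<union> F'" for P using that F(2) F'(2) by blast
      show "J \<subseteq> P" if "P \<in> F \<union> F'" for P
        using that F(2) F'(2) subset_adjoin[OF J.is_ideal ab(1)] subset_adjoin[OF J.is_ideal ab(2)]
        by (meson UnE subset_trans)
      fix z assume z: "z \<in> carrier R" "\<forall>P\<in>F \<union> F'. z \<in> P"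
      obtain n :: nat and i r where n: "z [^] n = i \<oplus> r \<otimes> a" "i \<in> J" "r \<in> carrier R"
        using F(3) z by (metis UnI1 adjoinE)
      obtain k :: nat and j s where k: "z [^] k = j \<oplus> s \<otimes> b" "j \<in> J" "s \<in> carrier R"
        using F'(3) z by (metis UnI2 adjoinE)
      have "(i \<oplus> r \<otimes> a) \<otimes> (j \<oplus> s \<otimes> b) \<in> J"
        using n k ab by (intro J.mult_mem is_cring)
      then have "z [^] (n + k) \<in> J"
        using z n(1) k(1) nat_pow_mult[of z n k] by simp
      then show "\<exists>n::nat. z [^] n \<in> J" ..
    qed
    with \<open>\<not> G J\<close> show False ..
  qed
  then obtain F where F: "finite F" "\<forall>P\<in>F. primeideal P R \<and> I \<subseteq> P"
    "\<forall>z\<in>carrier R. (\<forall>P\<in>F. z \<in> P) \<longrightarrow> (\<exists>n::nat. z [^] n \<in> I)"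
    unfolding G_def by (elim exE conjE)
  show thesis by (rule that[OF F(1)]) (use F(2,3) in auto)
qed

definition annihilator :: "'a \<Rightarrow> 'a set"
  where "annihilator a = {r \<in> carrier R. r \<otimes> a = \<zero>}"

lemma reduced_square:
  assumes "reduced_ring R" "a \<in> carrier R" "a \<otimes> a = \<zero>"
  shows "a = \<zero>"
proof -
  have "a [^] (2::nat) = \<zero>" using assms(2,3) by (simp add: numeral_2_eq_2)
  then show ?thesis using assms(1,2) unfolding reduced_ring_def by blast
qed

text \<open>An annihilator is the intersection of those primes of a finite family with zero
  intersection that do not contain the element.\<close>

lemma finite_annihilators:
  assumes red: "reduced_ring R"
  shows "finite (annihilator ` carrier R)"
proof -
  obtain F where F: "finite F" "\<And>P. P \<in> F \<Longrightarrow> primeideal P R"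
    "\<And>z. z \<in> carrier R \<Longrightarrow> (\<forall>P\<in>F. z \<in> P) \<Longrightarrow> \<exists>n::nat. z [^] n \<in> {\<zero>}"
    by (rule radical_finite_prime_intersection[OF zeroideal]) blast
  have zero: "z = \<zero>" if "z \<in> carrier R" "\<forall>P\<in>F. z \<in> P" for z
    using F(3)[OF that] red that unfolding reduced_ring_def by blast
  have "annihilator a = {r \<in> carrier R. \<forall>P\<in>{P \<in> F. a \<notin> P}. r \<in> P}" if a: "a \<in> carrier R" for a
  proof (intro equalityI subsetI)
    fix r assume "r \<in> annihilator a"
    then have r: "r \<in> carrier R" "r \<otimes> a = \<zero>" by (auto simp: annihilator_def)
    have "r \<in> P" if "P \<in> F" "a \<notin> P" for P
    proof -
      interpret P: primeideal P R using F(2) that by blast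
      show ?thesis using P.I_prime[of r a] r a that P.zero_closed by auto
    qed
    then show "r \<in> {r \<in> carrier R. \<forall>P\<in>{P \<in> F. a \<notin> P}. r \<in> P}" using r by blast
  next
    fix r assume r: "r \<in> {r \<in> carrier R. \<forall>P\<in>{P \<in> F. a \<notin> P}. r \<in> P}"
    have "r \<otimes> a \<in> P" if "P \<in> F" for P
    proof -
      interpret P: primeideal P R using F(2) that by blast
      show ?thesis using r a that P.I_l_closed P.I_r_closed by (cases "a \<in> P") auto
    qed
    then show "r \<in> annihilator a" using zero[of "r \<otimes> a"] r a by (simp add: annihilator_def)
  qed
  then have "annihilator ` carrier R
      \<subseteq> (\<lambda>G. {r \<in> carrier R. \<forall>P\<in>G. r \<in> P}) ` Pow F" by blast
  then show ?thesis using F(1) finite_subset by blast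
qed

end

section \<open>Reduced local rings of dimension one\<close>

locale reduced_local_dim_one = noetherian_cring +
  fixes \<mm>
  assumes local: "local_ring_with R \<mm>"
    and dim: "krull_dim R = 1"
    and reduced: "reduced_ring R"
begin

sublocale max: maximalideal \<mm> R
  using local by (simp add: local_ring_with_def)

lemma m_carrier: "p \<in> \<mm> \<Longrightarrow> p \<in> carrier R"
  by (rule max.Icarr)

lemma proper_ideal_subset:
  assumes "ideal I R" and "I \<noteq> carrier R"
  shows "I \<subseteq> \<mm>"
proof -
  let ?A = "{J. ideal J R \<and> J \<noteq> carrier R \<and> I \<subseteq> J}"
  obtain J where J: "J \<in> ?A" "\<And>K. K \<in> ?A \<Longrightarrow> J \<subseteq> K \<Longrightarrow> K = J"
    by (rule maximal_in_ideal_family[of ?A]) (use assms in auto)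
  have "maximalideal J R"
    by (rule maximalidealI) (use J in blast)+
  then have "J = \<mm>" using local by (simp add: local_ring_with_def)
  then show ?thesis using J by blast
qed

lemma unit_if_notin:
  assumes "a \<in> carrier R" and "a \<notin> \<mm>"
  shows "a \<in> Units R"
proof -
  have "a \<in> (\<lambda>r. a \<otimes> r) ` carrier R" using assms(1) r_one by (metis image_eqI one_closed)
  then have "(\<lambda>r. a \<otimes> r) ` carrier R = carrier R"
    using proper_ideal_subset[OF principal_multiples_ideal[OF assms(1)]] assms(2) by blast
  then obtain b where "b \<in> carrier R" "a \<otimes> b = \<one>" by (metis imageE one_closed)
  then show ?thesis using assms(1) m_comm[of a b] unfolding Units_def by auto
qed

lemma one_notin_m: "\<one> \<notin> \<mm>"
  using max.I_notcarr max.one_imp_carrier by blast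

lemma unit_notin_m: "a \<in> Units R \<Longrightarrow> a \<notin> \<mm>"
  using one_notin_m max.I_l_closed[of a "inv a"] by auto

lemma one_minus_unit:
  assumes "p \<in> \<mm>"
  shows "\<one> \<ominus> p \<in> Units R"
proof (rule unit_if_notin)
  show "\<one> \<ominus> p \<in> carrier R" using assms m_carrier by simp
  show "\<one> \<ominus> p \<notin> \<mm>"
  proof
    assume "\<one> \<ominus> p \<in> \<mm>"
    then have "(\<one> \<ominus> p) \<oplus> p \<in> \<mm>" using assms by simp
    moreover have "(\<one> \<ominus> p) \<oplus> p = \<one>" using m_carrier[OF assms] by algebra
    ultimately show False using one_notin_m by simp
  qed
qed

lemma prime_subset_m: "primeideal P R \<Longrightarrow> P \<subseteq> \<mm>"
  using proper_ideal_subset primeideal.axioms(1) primeideal.I_notcarr by blast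

lemma no_prime_chain:
  assumes "primeideal P0 R" "primeideal P1 R" "primeideal P2 R" "P0 \<subset> P1" "P1 \<subset> P2"
  shows False
proof -
  define P where "P = (\<lambda>i::nat. if i = 0 then P0 else if i = 1 then P1 else P2)"
  have "(\<forall>i\<le>2. primeideal (P i) R) \<and> (\<forall>i<2. P i \<subset> P (Suc i))"
    using assms by (auto simp: P_def less_2_cases_iff)
  then have "enat 2 \<le> krull_dim R"
    unfolding krull_dim_def by (intro Sup_upper) blast
  then show False using dim by (simp add: one_enat_def)
qed

text \<open>If the maximal ideal were zero, every prime would be zero and the dimension would be 0.
  This excludes fields, where \<open>\<mm>\<close> contains no nonzerodivisor.\<close>

lemma m_nonzero: "\<mm> \<noteq> {\<zero>}"
proof
  assume m: "\<mm> = {\<zero>}"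
  have "n = 0" if "\<forall>i\<le>n. primeideal (P i) R" "\<forall>i<n. P i \<subset> P (Suc i)" for n and P :: "nat \<Rightarrow> 'a set"
  proof (rule ccontr)
    assume "n \<noteq> 0"
    then have P: "primeideal (P 0) R" "primeideal (P 1) R" "P 0 \<subset> P 1" using that by auto
    then have "P 1 \<subseteq> {\<zero>}" using prime_subset_m m by blast
    moreover have "\<zero> \<in> P 0"
      using P(1) by (meson additive_subgroup.zero_closed ideal.axioms(1) primeideal.axioms(1))
    ultimately show False using P(3) by blast
  qed
  then have "krull_dim R \<le> 0"
    unfolding krull_dim_def by (intro Sup_least) (auto simp: zero_enat_def)
  then show False using dim by simp
qed

section \<open>Nonzerodivisors and the ideals that contain them\<close>

definition regular :: "'a \<Rightarrow> bool"
  where "regular x \<longleftrightarrow> x \<in> carrier R \<and> (\<forall>r\<in>carrier R. r \<otimes> x = \<zero> \<longrightarrow> r = \<zero>)"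

text \<open>Take \<open>y\<close> in the maximal ideal with minimal annihilator.  If \<open>z\<close> annihilates \<open>y\<close> then
  \<open>y + z\<close> has annihilator \<open>ann y \<inter> ann z\<close>, which does not contain \<open>z\<close> as the ring is reduced.\<close>

lemma ex_regular: obtains x where "x \<in> \<mm>" and "regular x"
proof -
  have "finite (annihilator ` \<mm>)"
    using finite_annihilators[OF reduced] by (rule finite_subset[rotated]) (use m_carrier in blast)
  moreover have "annihilator ` \<mm> \<noteq> {}" using max.zero_closed by blast
  ultimately obtain A where A: "A \<in> annihilator ` \<mm>"
    "\<And>B. B \<in> annihilator ` \<mm> \<Longrightarrow> B \<subseteq> A \<Longrightarrow> A = B"
    using finite_has_minimal[of "annihilator ` \<mm>"] by metis
  then obtain y where y: "y \<in> \<mm>" "A = annihilator y" by blast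
  have min: "annihilator z = annihilator y" if "z \<in> \<mm>" "annihilator z \<subseteq> annihilator y" for z
    using A(2)[of "annihilator z"] y that by simp
  note yc = m_carrier[OF y(1)]
  have "z = \<zero>" if z: "z \<in> carrier R" "z \<otimes> y = \<zero>" for z
  proof -
    have zero: "z = \<zero>" if zm: "z \<in> \<mm>"
    proof -
      have eq: "r \<otimes> y = \<zero> \<and> r \<otimes> z = \<zero>" if r: "r \<in> carrier R" "r \<otimes> (y \<oplus> z) = \<zero>" for r
      proof -
        have e: "r \<otimes> y \<oplus> r \<otimes> z = \<zero>" using r z yc by (simp add: r_distr)
        \<comment> \<open>The added term contains \<open>z y\<close>, which is zero. As
          \<open>r y + r z\<close> is zero too, \<open>r y\<close> has square zero.\<close>
        have "(r \<otimes> y) \<otimes> (r \<otimes> y) = (r \<otimes> y) \<otimes> (r \<otimes> y \<oplus> r \<otimes> z)"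
        proof -
          have "(r \<otimes> y) \<otimes> (r \<otimes> y \<oplus> r \<otimes> z) = (r \<otimes> y) \<otimes> (r \<otimes> y) \<oplus> (r \<otimes> r) \<otimes> (z \<otimes> y)"
            using r(1) z(1) yc by algebra
          then show ?thesis unfolding z(2) using r yc by simp
        qed
        then have "(r \<otimes> y) \<otimes> (r \<otimes> y) = \<zero>" unfolding e using r(1) yc by simp
        then have "r \<otimes> y = \<zero>" using reduced_square[OF reduced, of "r \<otimes> y"] r(1) yc by simp
        with e show ?thesis using r(1) z(1) by simp
      qed
      then have "annihilator (y \<oplus> z) \<subseteq> annihilator y" by (auto simp: annihilator_def)
      then have "annihilator (y \<oplus> z) = annihilator y" using min y zm by simp
      moreover have "z \<in> annihilator y" using z by (simp add: annihilator_def)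
      ultimately have "z \<otimes> z = \<zero>" using eq z by (auto simp: annihilator_def)
      then show ?thesis using reduced_square[OF reduced z(1)] by blast
    qed
    show ?thesis
    proof (cases "z \<in> \<mm>")
      case True
      then show ?thesis by (rule zero)
    next
      case False
      then have u: "z \<in> Units R" using unit_if_notin z by blast
      have "y = inv z \<otimes> (z \<otimes> y)" using u z(1) yc by (simp flip: m_assoc)
      then have y0: "y = \<zero>" unfolding z(2) using u by simp
      \<comment> \<open>A unit \<open>z\<close> forces \<open>y = 0\<close>, whose annihilator is
        the whole ring. By minimality every element of \<open>\<mm>\<close> would then be
        annihilated by \<open>\<one>\<close>, contrary to
        \<open>\<mm> \<noteq> {\<zero>}\<close>.\<close>
      obtain w where w: "w \<in> \<mm>" "w \<noteq> \<zero>" using m_nonzero max.zero_closed by blast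
      have "annihilator w \<subseteq> annihilator y" using y0 by (auto simp: annihilator_def)
      then have "annihilator w = annihilator y" using min w by blast
      then have "\<one> \<in> annihilator w" using y0 by (auto simp: annihilator_def)
      then show ?thesis using w m_carrier by (simp add: annihilator_def)
    qed
  qed
  then have "regular y" unfolding regular_def using yc by blast
  with y(1) show thesis by (rule that)
qed

lemma regular_cancel:
  assumes "regular x" "a \<in> carrier R" "b \<in> carrier R" "x \<otimes> a = x \<otimes> b"
  shows "a = b"
proof -
  have x: "x \<in> carrier R" using assms(1) by (simp add: regular_def)
  have "(a \<ominus> b) \<otimes> x = x \<otimes> a \<ominus> x \<otimes> b" using assms(2,3) x by algebra
  also have "\<dots> = \<zero>" using assms x by (simp add: a_minus_def r_neg)
  finally have "a \<ominus> b = \<zero>" using assms by (simp add: regular_def)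
  then show ?thesis using assms(2,3) by simp
qed

lemma regular_mult:
  assumes "regular x" "regular y"
  shows "regular (x \<otimes> y)"
proof -
  have c: "x \<in> carrier R" "y \<in> carrier R" using assms by (auto simp: regular_def)
  have "r = \<zero>" if "r \<in> carrier R" "r \<otimes> (x \<otimes> y) = \<zero>" for r
  proof -
    have "(r \<otimes> x) \<otimes> y = \<zero>" using that c by (simp add: m_assoc)
    then have "r \<otimes> x = \<zero>" using assms(2) that(1) c by (simp add: regular_def)
    then show ?thesis using assms(1) that(1) by (simp add: regular_def)
  qed
  then show ?thesis using c by (simp add: regular_def)
qed

lemma regular_pow: "regular x \<Longrightarrow> regular (x [^] (n::nat))"
proof (induction n)
  case 0
  then show ?case by (simp add: regular_def)
qed (simp add: regular_mult)

text \<open>A prime containing a nonzerodivisor is not minimal, so dimension one leaves only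
  \<open>\<mm>\<close>. The set \<open>T\<close> of products \<open>x^k u\<close> with
  \<open>u\<close> outside \<open>P\<close> is multiplicative and omits zero. A prime
  \<open>Q\<close> disjoint from \<open>T\<close> lies in \<open>P\<close> (take
  \<open>k = 0\<close>) and misses \<open>x\<close> (take \<open>k = 1\<close>,
  \<open>u = 1\<close>), so \<open>P \<noteq> \<mm>\<close> would produce a chain of three
  primes.\<close>

lemma prime_with_regular_eq_m:
  assumes P: "primeideal P R" and x: "x \<in> P" "regular x"
  shows "P = \<mm>"
proof (rule ccontr)
  assume "P \<noteq> \<mm>"
  interpret P: primeideal P R by fact
  have xc: "x \<in> carrier R" using x by (simp add: regular_def)
  define T where "T = {x [^] (k::nat) \<otimes> u |k u. u \<in> carrier R \<and> u \<notin> P}"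
  obtain Q where Q: "primeideal Q R" "Q \<inter> T = {}"
  proof (rule prime_avoiding_multiplicative_set[of T])
    show "T \<subseteq> carrier R" using xc by (auto simp: T_def)
    have "\<one> \<notin> P" using P.I_notcarr P.one_imp_carrier by blast
    then show "\<one> \<in> T" unfolding T_def by (auto intro!: exI[of _ "0::nat"] exI[of _ \<one>])
    show "a \<otimes> b \<in> T" if ab: "a \<in> T" "b \<in> T" for a b
    proof -
      obtain k u where a: "a = x [^] (k::nat) \<otimes> u" "u \<in> carrier R" "u \<notin> P"
        using ab(1) unfolding T_def by blast
      obtain l v where b: "b = x [^] (l::nat) \<otimes> v" "v \<in> carrier R" "v \<notin> P"
        using ab(2) unfolding T_def by blast
      have "a \<otimes> b = (x [^] k \<otimes> x [^] l) \<otimes> (u \<otimes> v)" using a b xc by (simp add: m_ac)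
      then have "a \<otimes> b = x [^] (k + l) \<otimes> (u \<otimes> v)" using xc by (simp add: nat_pow_mult)
      moreover have "u \<otimes> v \<in> carrier R" "u \<otimes> v \<notin> P" using a b P.I_prime by auto
      ultimately show ?thesis unfolding T_def by blast
    qed
    show "\<zero> \<notin> T"
    proof
      assume "\<zero> \<in> T"
      then obtain k u where u: "\<zero> = x [^] (k::nat) \<otimes> u" "u \<in> carrier R" "u \<notin> P"
        by (auto simp: T_def)
      then have "u \<otimes> x [^] k = \<zero>" using xc m_comm by simp
      then have "u = \<zero>" using regular_pow[OF x(2)] u(2) unfolding regular_def by blast
      then show False using u P.zero_closed by blast
    qed
  qed auto
  have "Q \<subset> P"
  proof
    have "u \<in> P" if "u \<in> Q" for u
    proof (rule ccontr)
      assume "u \<notin> P"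
      moreover have "u \<in> carrier R" using that Q(1) by (meson ideal.Icarr primeideal.axioms(1))
      ultimately have "x [^] (0::nat) \<otimes> u \<in> T" "x [^] (0::nat) \<otimes> u = u"
        unfolding T_def by (blast, simp)
      then show False using Q(2) that by auto
    qed
    then show "Q \<subseteq> P" ..
    have "\<one> \<notin> P" using P.I_notcarr P.one_imp_carrier by blast
    then have "x [^] (1::nat) \<otimes> \<one> \<in> T" unfolding T_def by blast
    then have "x \<notin> Q" using Q(2) xc by auto
    then show "Q \<noteq> P" using x by blast
  qed
  moreover have "P \<subset> \<mm>" using \<open>P \<noteq> \<mm>\<close> prime_subset_m P by blast
  moreover have "primeideal \<mm> R" using maximalideal_prime max.is_maximalideal by blast
  ultimately show False using no_prime_chain Q(1) P by blast
qed

text \<open>The ideals \<open>xR : \<mm>\<^sup>j\<close>.\<close>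

primrec colon_chain :: "'a \<Rightarrow> nat \<Rightarrow> 'a set"
  where "colon_chain x 0 = (\<lambda>r. x \<otimes> r) ` carrier R"
  | "colon_chain x (Suc j) = {a \<in> carrier R. \<forall>p\<in>\<mm>. p \<otimes> a \<in> colon_chain x j}"

text \<open>In other words \<open>\<mm>^n\<close> lies in \<open>xR\<close>. If the ideal
  \<open>L\<close> at which the chain repeats were proper, an associated prime \<open>L : r\<close>
  would contain \<open>x\<close> and hence equal \<open>\<mm>\<close>. Then \<open>r\<close> belongs
  to \<open>L : \<mm>\<close>, which is \<open>L\<close>, a contradiction.\<close>

lemma colon_chain_exhausts:
  assumes "regular x"
  obtains n where "\<one> \<in> colon_chain x n"
proof -
  have x: "x \<in> carrier R" using assms by (simp add: regular_def)
  have id: "ideal (colon_chain x n) R" for n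
  proof (induction n)
    case 0
    show ?case using principal_multiples_ideal[OF x] by simp
  next
    case (Suc n)
    have "\<mm> \<subseteq> carrier R" using m_carrier by blast
    then show ?case using colon_ideal[OF Suc] by simp
  qed
  have asc: "colon_chain x n \<subseteq> colon_chain x (Suc n)" for n
  proof
    fix a assume "a \<in> colon_chain x n"
    then show "a \<in> colon_chain x (Suc n)"
      using ideal.I_l_closed[OF id] ideal.Icarr[OF id] m_carrier by auto
  qed
  obtain n where n: "colon_chain x (Suc n) = colon_chain x n"
    using ascending_ideals_stabilise[where L = "colon_chain x", OF id asc] by blast
  have xn: "x \<in> colon_chain x k" for k
  proof (induction k)
    case 0
    have "x = x \<otimes> \<one>" using x by simp
    then show ?case by auto
  qed (use asc in blast)
  have "colon_chain x n = carrier R"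
  proof (rule ccontr)
    assume "colon_chain x n \<noteq> carrier R"
    then obtain r where r: "r \<in> carrier R - colon_chain x n"
      "primeideal {a \<in> carrier R. r \<otimes> a \<in> colon_chain x n} R"
      using prime_colon_ideal[OF id] by blast
    have "r \<otimes> x \<in> colon_chain x n" using ideal.I_l_closed[OF id xn] r by blast
    then have "{a \<in> carrier R. r \<otimes> a \<in> colon_chain x n} = \<mm>"
      using prime_with_regular_eq_m[OF r(2) _ assms] x by blast
    then have "p \<otimes> r \<in> colon_chain x n" if "p \<in> \<mm>" for p
      using that r m_comm[of p r] by auto
    then have "r \<in> colon_chain x (Suc n)" using r by simp
    then show False using n r by blast
  qed
  then show thesis using that by blast
qed

end

section \<open>Idempotents and monic relations\<close>

text \<open>A maximal principal ideal among those generated by elements of \<open>B\<close> is generated by an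
  idempotent \<open>e\<close>; replacing \<open>e\<close> by \<open>e + (1 - e)b\<close> cannot enlarge it.\<close>

lemma (in noetherian_cring) ex_dominating_idempotent:
  assumes vnr: "\<And>a. a \<in> carrier R \<Longrightarrow> \<exists>q\<in>carrier R. a = a \<otimes> a \<otimes> q"
    and B: "B \<subseteq> carrier R" "B \<noteq> {}"
    and mult: "\<And>s b. s \<in> carrier R \<Longrightarrow> b \<in> B \<Longrightarrow> s \<otimes> b \<in> B"
    and comb: "\<And>e b. e \<in> B \<Longrightarrow> b \<in> B \<Longrightarrow> e \<otimes> e = e \<Longrightarrow> e \<oplus> (\<one> \<ominus> e) \<otimes> b \<in> B"
  obtains e where "e \<in> B" and "\<And>b. b \<in> B \<Longrightarrow> (\<one> \<ominus> e) \<otimes> b = \<zero>"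
proof -
  define J where "J = (\<lambda>a. (\<lambda>r. a \<otimes> r) ` carrier R)"
  obtain I where "I \<in> J ` B" and max: "\<And>K. K \<in> J ` B \<Longrightarrow> I \<subseteq> K \<Longrightarrow> K = I"
    by (rule maximal_in_ideal_family[of "J ` B"])
       (use B principal_multiples_ideal in \<open>auto simp: J_def\<close>)
  then obtain a where a: "a \<in> B" "I = J a" by blast
  then have ac: "a \<in> carrier R" using B by blast
  obtain q where q: "q \<in> carrier R" "a = a \<otimes> a \<otimes> q" using vnr ac by blast
  \<comment> \<open>From \<open>a = a a q\<close> it follows that \<open>q a\<close> is idempotent
    and generates the same ideal as \<open>a\<close>.\<close>
  define e where "e = q \<otimes> a"
  have e: "e \<in> B" "e \<in> carrier R" using mult q a ac by (auto simp: e_def)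
  have ae: "a = e \<otimes> a" using q ac by (simp add: e_def m_ac)
  have idem: "e \<otimes> e = e"
  proof -
    have "e \<otimes> e = q \<otimes> (a \<otimes> a \<otimes> q)" unfolding e_def using q(1) ac by (simp add: m_ac)
    then show ?thesis using q(2) by (simp add: e_def)
  qed
  have "(\<one> \<ominus> e) \<otimes> b = \<zero>" if b: "b \<in> B" for b
  proof -
    have bc: "b \<in> carrier R" using b B by blast
    define c where "c = e \<oplus> (\<one> \<ominus> e) \<otimes> b"
    have cB: "c \<in> B" using comb e b idem by (simp add: c_def)
    then have cc: "c \<in> carrier R" using B by blast
    have "e \<otimes> c = e \<otimes> e \<oplus> (e \<ominus> e \<otimes> e) \<otimes> b" unfolding c_def using e bc by algebra
    then have ec: "e \<otimes> c = e" unfolding idem using e bc by (simp add: a_minus_def r_neg)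
    have "J a \<subseteq> J c"
    proof
      fix u assume "u \<in> J a"
      then obtain r where r: "r \<in> carrier R" "u = a \<otimes> r" by (auto simp: J_def)
      have "a = a \<otimes> (e \<otimes> c)" unfolding ec using ae e ac m_comm by simp
      then have "u = c \<otimes> (a \<otimes> e \<otimes> r)" using r e ac cc by (metis (no_types, lifting) m_assoc m_closed m_comm)
      then show "u \<in> J c" using r e ac by (auto simp: J_def)
    qed
    \<comment> \<open>Now \<open>c\<close> is a multiple of \<open>a\<close>, and \<open>e\<close>
      fixes \<open>a\<close>, so \<open>e c = c\<close>. Since also \<open>e c = e\<close>, the
      correction term \<open>(1 - e) b\<close> must vanish.\<close>
    then have "J c = J a" using max[of "J c"] cB a by simp
    moreover have "c \<in> J c" unfolding J_def using cc r_one by (metis image_eqI one_closed)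
    ultimately obtain r where r: "r \<in> carrier R" "c = a \<otimes> r" by (auto simp: J_def)
    have "e \<otimes> c = (e \<otimes> a) \<otimes> r" using r e ac by (simp add: m_assoc)
    then have "e = c" using ec ae r by simp
    have "(\<one> \<ominus> e) \<otimes> b = c \<ominus> e" unfolding c_def using e(2) bc by algebra
    also have "\<dots> = \<zero>" using cc by (simp add: \<open>e = c\<close> a_minus_def r_neg)
    finally show ?thesis .
  qed
  then show thesis using that e by blast
qed

text \<open>Values at \<open>a\<close> of polynomials of degree less than \<open>k\<close> with
  coefficients in \<open>K\<close>, in Horner form. A monic relation of degree \<open>k\<close> is
  then the membership of \<open>a [^] k\<close> in \<open>polys K a k\<close>.\<close>

primrec (in ring) polys :: "'a set \<Rightarrow> 'a \<Rightarrow> nat \<Rightarrow> 'a set"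
  where "polys K a 0 = {\<zero>}"
  | "polys K a (Suc k) = {r \<oplus> a \<otimes> s |r s. r \<in> K \<and> s \<in> polys K a k}"

context cring
begin

lemma polys_carrier:
  assumes "K \<subseteq> carrier R" "a \<in> carrier R"
  shows "polys K a k \<subseteq> carrier R"
  by (induction k) (use assms in auto)

lemma polys_add:
  assumes "K \<subseteq> carrier R" "a \<in> carrier R"
    and add: "\<And>r s. r \<in> K \<Longrightarrow> s \<in> K \<Longrightarrow> r \<oplus> s \<in> K"
  shows "u \<in> polys K a k \<Longrightarrow> v \<in> polys K a k \<Longrightarrow> u \<oplus> v \<in> polys K a k"
proof (induction k arbitrary: u v)
  case (Suc k)
  obtain r s where u: "u = r \<oplus> a \<otimes> s" "r \<in> K" "s \<in> polys K a k" using Suc.prems by auto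
  obtain r' s' where v: "v = r' \<oplus> a \<otimes> s'" "r' \<in> K" "s' \<in> polys K a k" using Suc.prems by auto
  have c: "r \<in> carrier R" "s \<in> carrier R" "r' \<in> carrier R" "s' \<in> carrier R"
    using u v assms polys_carrier by blast+
  have "u \<oplus> v = (r \<oplus> r') \<oplus> a \<otimes> (s \<oplus> s')"
    unfolding u v using c assms(2) by (simp add: r_distr a_ac)
  then show ?case using Suc.IH[of s s'] u v add by auto
qed simp

lemma polys_scale:
  assumes "K \<subseteq> carrier R" "a \<in> carrier R" "t \<in> K"
    and mult: "\<And>r s. r \<in> K \<Longrightarrow> s \<in> K \<Longrightarrow> r \<otimes> s \<in> K"
  shows "u \<in> polys K a k \<Longrightarrow> t \<otimes> u \<in> polys K a k"
proof (induction k arbitrary: u)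
  case 0
  then show ?case using assms by auto
next
  case (Suc k)
  obtain r s where u: "u = r \<oplus> a \<otimes> s" "r \<in> K" "s \<in> polys K a k" using Suc.prems by auto
  have c: "r \<in> carrier R" "s \<in> carrier R" "t \<in> carrier R"
    using u assms polys_carrier by blast+
  have "t \<otimes> u = t \<otimes> r \<oplus> a \<otimes> (t \<otimes> s)"
    unfolding u using c assms(2) by (simp add: r_distr m_lcomm)
  then show ?case using Suc.IH[of s] u assms(3) mult by auto
qed

lemma polys_mono:
  assumes "a \<in> carrier R" "\<zero> \<in> K"
  shows "polys K a k \<subseteq> polys K a (Suc k)"
proof (induction k)
  case 0
  show ?case using assms by (auto intro!: exI[of _ \<zero>])
next
  case (Suc k)
  then show ?case by auto
qed

lemma pow_in_polys:
  assumes "a \<in> carrier R" "\<zero> \<in> K" "\<one> \<in> K"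
  shows "a [^] k \<in> polys K a (Suc k)"
proof (induction k)
  case 0
  have "a [^] (0::nat) = \<one> \<oplus> a \<otimes> \<zero>" using assms(1) by simp
  then show ?case using assms(3) by auto
next
  case (Suc k)
  have "a [^] Suc k = \<zero> \<oplus> a \<otimes> a [^] k" using assms(1) m_comm by simp
  then show ?case using Suc assms(2) by auto
qed

text \<open>Reduction of a monic relation: divide by its lowest nonzero coefficient.\<close>

lemma monic_relation_quotient:
  assumes K: "K \<subseteq> carrier R" "\<And>r. r \<in> K \<Longrightarrow> r = \<zero> \<or> r \<in> Units R" and a: "a \<in> carrier R"
  shows "s \<in> polys K a k \<Longrightarrow>
    \<exists>(j::nat) q v. q \<in> carrier R \<and> v \<in> carrier R \<and> a [^] j \<otimes> (\<one> \<ominus> a \<otimes> q) = (a [^] k \<ominus> s) \<otimes> v"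
proof (induction k arbitrary: s)
  case 0
  show ?case
    by (rule exI[of _ 0], rule exI[of _ \<zero>], rule exI[of _ \<one>])
       (use 0 a in \<open>simp add: a_minus_def\<close>)
next
  case (Suc k)
  obtain r t where s: "s = r \<oplus> a \<otimes> t" "r \<in> K" "t \<in> polys K a k" using Suc.prems by auto
  have c: "r \<in> carrier R" "t \<in> carrier R" using s K polys_carrier[OF K(1) a] by blast+
  obtain P where P: "P = a [^] k" "P \<in> carrier R" using a by simp
  have suc: "a [^] Suc k = a \<otimes> P" using a P m_comm by simp
  show ?case
  proof (cases "r = \<zero>")
    case True
    obtain j q v where IH: "q \<in> carrier R" "v \<in> carrier R"
      "a [^] (j::nat) \<otimes> (\<one> \<ominus> a \<otimes> q) = (P \<ominus> t) \<otimes> v"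
      using Suc.IH[OF s(3)] P by blast
    obtain A where A: "A = a [^] j" "A \<in> carrier R" using a by simp
    have "a [^] Suc j \<otimes> (\<one> \<ominus> a \<otimes> q) = a \<otimes> (A \<otimes> (\<one> \<ominus> a \<otimes> q))"
      using a IH(1) A(2) by (simp add: m_ac flip: A(1))
    also have "\<dots> = a \<otimes> ((P \<ominus> t) \<otimes> v)" using IH A by simp
    also have "\<dots> = (a \<otimes> P \<ominus> (\<zero> \<oplus> a \<otimes> t)) \<otimes> v" using a P(2) c(2) IH(2) by algebra
    finally show ?thesis using IH True s suc by metis
  next
    case False
    then have u: "r \<in> Units R" using K s by blast
    obtain i where i: "i \<in> carrier R" "i \<otimes> r = \<one>" using u unfolding Units_def by blast
    \<comment> \<open>The constant term of the relation is \<open>- r\<close>; the factor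
      \<open>- i\<close> normalises it to one and leaves a multiple of \<open>a\<close>. No power of
      \<open>a\<close> is split off here, so \<open>j = 0\<close>.\<close>
    have "(a \<otimes> P \<ominus> (r \<oplus> a \<otimes> t)) \<otimes> (\<ominus> i) = i \<otimes> r \<ominus> a \<otimes> (i \<otimes> (P \<ominus> t))"
      using a P(2) c i(1) by algebra
    then have "a [^] (0::nat) \<otimes> (\<one> \<ominus> a \<otimes> (i \<otimes> (P \<ominus> t))) = (a [^] Suc k \<ominus> s) \<otimes> (\<ominus> i)"
      unfolding i suc s using a P(2) c i(1) by simp
    then show ?thesis using i(1) P(2) c by (metis a_inv_closed m_closed minus_closed)
  qed
qed

text \<open>The relation makes the right side of the quotient identity vanish, so
  \<open>a^j (1 - a q) = 0\<close>. Hence \<open>a (1 - a q)\<close> is nilpotent, and a reduced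
  ring leaves only zero.\<close>

lemma reduced_monic_relation:
  assumes red: "reduced_ring R"
    and K: "K \<subseteq> carrier R" "\<And>r. r \<in> K \<Longrightarrow> r = \<zero> \<or> r \<in> Units R" and a: "a \<in> carrier R"
    and rel: "a [^] (k::nat) \<in> polys K a k"
  shows "\<exists>q\<in>carrier R. a = a \<otimes> a \<otimes> q"
proof -
  obtain j q v where q: "q \<in> carrier R" "v \<in> carrier R"
    and eq: "a [^] (j::nat) \<otimes> (\<one> \<ominus> a \<otimes> q) = (a [^] k \<ominus> a [^] k) \<otimes> v"
    using monic_relation_quotient[OF K a rel] by blast
  have zero: "a [^] j \<otimes> (\<one> \<ominus> a \<otimes> q) = \<zero>"
    unfolding eq using a q by (simp add: a_minus_def r_neg)
  define d where "d = \<one> \<ominus> a \<otimes> q"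
  have d: "d \<in> carrier R" using a q by (simp add: d_def)
  have "(a \<otimes> d) [^] Suc j = (a [^] j \<otimes> d) \<otimes> (d [^] j \<otimes> a)"
    using a d by (simp add: nat_pow_distrib m_ac)
  then have "(a \<otimes> d) [^] Suc j = \<zero>" using zero a d by (simp add: d_def)
  moreover have "a \<otimes> d \<in> carrier R" using a d by simp
  ultimately have "a \<otimes> d = \<zero>" using red unfolding reduced_ring_def by blast
  moreover have "a \<otimes> d = a \<ominus> a \<otimes> a \<otimes> q" unfolding d_def using a q by algebra
  ultimately have "a = a \<otimes> a \<otimes> q" using a q by simp
  then show ?thesis using q by blast
qed

end

text \<open>A chain of ideals of \<open>T\<close> has an image with a maximal member in
  \<open>R\<close>. Comparability in the chain and injectivity of \<open>\<phi>\<close> on ideals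
  turn the preimage of that member into the largest element of the chain. The map
  \<open>\<phi>\<close> used later is evaluation at \<open>x\<close>.\<close>

lemma noetherian_ring_ideal_embedding:
  assumes "noetherian_ring R" and "ring T"
    and ideal: "\<And>J. ideal J T \<Longrightarrow> ideal (\<phi> J) R"
    and reflect: "\<And>I J. ideal I T \<Longrightarrow> ideal J T \<Longrightarrow> \<phi> I = \<phi> J \<Longrightarrow> I = J"
    and mono: "\<And>I J. I \<subseteq> J \<Longrightarrow> \<phi> I \<subseteq> \<phi> J"
  shows "noetherian_ring T"
proof (rule ring.trivial_ideal_chain_imp_noetherian[OF assms(2)])
  fix C assume C: "C \<noteq> {}" "subset.chain {I. ideal I T} C"
  then have id: "\<And>I. I \<in> C \<Longrightarrow> ideal I T" by (auto simp: pred_on.chain_def)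
  obtain I where "I \<in> \<phi> ` C" and max: "\<And>J. J \<in> \<phi> ` C \<Longrightarrow> I \<subseteq> J \<Longrightarrow> J = I"
    by (rule noetherian_ring.maximal_in_ideal_family[OF assms(1), of "\<phi> ` C"])
       (use C id ideal in auto)
  then obtain I' where I': "I' \<in> C" "I = \<phi> I'" by blast
  have "J \<subseteq> I'" if "J \<in> C" for J
  proof -
    have "J \<subseteq> I' \<or> I' \<subseteq> J" using C(2) I' that by (auto simp: pred_on.chain_def)
    moreover have "J = I'" if "I' \<subseteq> J"
      using mono[OF that] max[of "\<phi> J"] I' \<open>J \<in> C\<close> reflect id by blast
    ultimately show ?thesis by blast
  qed
  then have "\<Union>C = I'" using I' by blast
  then show "\<Union>C \<in> C" using I' by simp
qed

section \<open>The endomorphism ring of the maximal ideal\<close>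

locale seminormal_dim_one = reduced_local_dim_one +
  fixes x
  assumes seminormal: "seminormal_ring R"
    and x_m: "x \<in> \<mm>"
    and x_regular: "regular x"
begin

lemma x_carrier [simp, intro]: "x \<in> carrier R"
  using x_m m_carrier by blast

lemma x_cancel: "x \<otimes> a = x \<otimes> b \<Longrightarrow> a \<in> carrier R \<Longrightarrow> b \<in> carrier R \<Longrightarrow> a = b"
  using regular_cancel[OF x_regular] by blast

text \<open>With \<open>d = u - v\<close> the hypotheses give \<open>v v d = 0\<close>, and likewise
  \<open>u u d = 0\<close>. So \<open>v d\<close> and \<open>u d\<close> have square zero and
  vanish, whence \<open>d d = u d - v d = 0\<close>.\<close>

lemma reduced_cancel_powers:
  assumes c: "u \<in> carrier R" "v \<in> carrier R"
    and "u [^] (2::nat) = v [^] (2::nat)" "u [^] (3::nat) = v [^] (3::nat)"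
  shows "u = v"
proof -
  have e: "u \<otimes> u = v \<otimes> v" "u \<otimes> u \<otimes> u = v \<otimes> v \<otimes> v"
    using assms by (auto simp: numeral_2_eq_2 numeral_3_eq_3)
  define d where "d = u \<ominus> v"
  have d: "d \<in> carrier R" using c by (simp add: d_def)
  have "v \<otimes> v \<otimes> u = v \<otimes> v \<otimes> v" using e by simp
  then have vvd: "v \<otimes> v \<otimes> d = \<zero>" unfolding d_def using c by (simp add: a_minus_def r_distr r_minus r_neg)
  have "(v \<otimes> d) \<otimes> (v \<otimes> d) = (v \<otimes> v \<otimes> d) \<otimes> d" using c d by (simp add: m_ac)
  then have vd: "v \<otimes> d = \<zero>" using reduced_square[OF reduced, of "v \<otimes> d"] vvd c d by simp
  have "(u \<otimes> d) \<otimes> (u \<otimes> d) = (u \<otimes> u \<otimes> d) \<otimes> d" using c d by (simp add: m_ac)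
  then have ud: "u \<otimes> d = \<zero>" using reduced_square[OF reduced, of "u \<otimes> d"] vvd e(1) c d by simp
  have "d \<otimes> d = u \<otimes> d \<ominus> v \<otimes> d" unfolding d_def using c by algebra
  then have "d \<otimes> d = \<zero>" unfolding ud vd by simp
  then have "d = \<zero>" using reduced_square[OF reduced d] by simp
  then show ?thesis using c by (simp add: d_def)
qed

text \<open>Seminormality for the fraction \<open>p/w\<close>: here \<open>b\<close> and
  \<open>c\<close> are its square and cube, and \<open>b^3 = c^2\<close> follows by cancelling
  \<open>w^6\<close>. The resulting \<open>a\<close> has the same square and cube as
  \<open>p/w\<close>, so it equals \<open>p/w\<close>.\<close>

lemma seminormal_divides:
  assumes w: "regular w" and p: "p \<in> carrier R"
    and b: "b \<in> carrier R" "p [^] (2::nat) = w [^] (2::nat) \<otimes> b"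
    and c: "c \<in> carrier R" "p [^] (3::nat) = w [^] (3::nat) \<otimes> c"
  shows "\<exists>a\<in>carrier R. p = w \<otimes> a"
proof -
  have wc: "w \<in> carrier R" using w by (simp add: regular_def)
  have "w [^] (6::nat) \<otimes> b [^] (3::nat) = (p [^] (2::nat)) [^] (3::nat)"
    unfolding b using wc b(1) by (simp add: nat_pow_distrib nat_pow_pow)
  also have "\<dots> = (p [^] (3::nat)) [^] (2::nat)" using p by (simp add: nat_pow_pow)
  also have "\<dots> = w [^] (6::nat) \<otimes> c [^] (2::nat)"
    unfolding c using wc c(1) by (simp add: nat_pow_distrib nat_pow_pow)
  finally have "b [^] (3::nat) = c [^] (2::nat)"
    using regular_cancel[OF regular_pow[OF w]] b(1) c(1) by simp
  then obtain a where a: "a \<in> carrier R" "a [^] (2::nat) = b" "a [^] (3::nat) = c"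
    using seminormal b c unfolding seminormal_ring_def by blast
  have "p = w \<otimes> a"
    by (rule reduced_cancel_powers) (use wc a p b(2) c(2) in \<open>simp_all add: nat_pow_distrib\<close>)
  then show ?thesis using a by blast
qed

text \<open>Descending induction on the exponent: for \<open>i \<ge> 1\<close> both
  \<open>2i\<close> and \<open>3i\<close> exceed \<open>i\<close>, so if all higher powers of
  \<open>p/w\<close> lie in \<open>R\<close> then so do the square and the cube of its
  \<open>i\<close>-th power, and the preceding lemma gives that power itself.\<close>

lemma seminormal_divides_of_powers:
  assumes w: "regular w" and p: "p \<in> carrier R"
    and "\<And>i::nat. i \<ge> k \<Longrightarrow> \<exists>b\<in>carrier R. p [^] i = w [^] i \<otimes> b"
  shows "\<exists>b\<in>carrier R. p = w \<otimes> b"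
proof -
  have wc: "w \<in> carrier R" using w by (simp add: regular_def)
  have "i \<ge> 1 \<Longrightarrow> \<exists>b\<in>carrier R. p [^] i = w [^] i \<otimes> b" for i :: nat
  proof (induction "k - i" arbitrary: i rule: less_induct)
    case less
    show ?case
    proof (cases "i \<ge> k")
      case False
      have "\<exists>b\<in>carrier R. (p [^] i) [^] j = (w [^] i) [^] j \<otimes> b" if "j > 1" for j :: nat
      proof -
        have "i < i * j" using that less.prems by simp
        then have "\<exists>b\<in>carrier R. p [^] (i * j) = w [^] (i * j) \<otimes> b"
          using less.hyps[of "i * j"] less.prems False by (simp add: diff_less_mono2)
        then show ?thesis using p wc by (simp add: nat_pow_pow)
      qed
      from this[of 2] this[of 3] show ?thesis
        using seminormal_divides[OF regular_pow[OF w, of i], of "p [^] i"] p by auto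
    qed (rule assms(3))
  qed
  from this[of 1] show ?thesis using p wc by simp
qed

text \<open>The endomorphism ring of \<open>\<mm>\<close>, which is the ring of fractions \<open>\<mm> : \<mm>\<close>.  As \<open>\<mm>\<close>
  contains a regular element, linearity of \<open>s\<close> amounts to \<open>p s(q) = s(p) q\<close>.\<close>

definition E :: "('a \<Rightarrow> 'a) ring"
  where "E = \<lparr>carrier = {s \<in> \<mm> \<rightarrow>\<^sub>E \<mm>. \<forall>p\<in>\<mm>. \<forall>q\<in>\<mm>. p \<otimes> s q = s p \<otimes> q},
    monoid.mult = (\<lambda>s t. \<lambda>p\<in>\<mm>. s (t p)), one = (\<lambda>p\<in>\<mm>. p),
    ring.zero = (\<lambda>p\<in>\<mm>. \<zero>), ring.add = (\<lambda>s t. \<lambda>p\<in>\<mm>. s p \<oplus> t p)\<rparr>"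

lemma E_maps: "s \<in> carrier E \<Longrightarrow> p \<in> \<mm> \<Longrightarrow> s p \<in> \<mm>"
  by (auto simp: E_def)

lemma E_carrier: "s \<in> carrier E \<Longrightarrow> p \<in> \<mm> \<Longrightarrow> s p \<in> carrier R"
  by (rule m_carrier[OF E_maps])

lemma E_sym: "s \<in> carrier E \<Longrightarrow> p \<in> \<mm> \<Longrightarrow> q \<in> \<mm> \<Longrightarrow> p \<otimes> s q = s p \<otimes> q"
  by (auto simp: E_def)

lemma E_apply [simp]:
  "p \<in> \<mm> \<Longrightarrow> (s \<otimes>\<^bsub>E\<^esub> t) p = s (t p)"
  "p \<in> \<mm> \<Longrightarrow> (s \<oplus>\<^bsub>E\<^esub> t) p = s p \<oplus> t p"
  "p \<in> \<mm> \<Longrightarrow> \<one>\<^bsub>E\<^esub> p = p"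
  "p \<in> \<mm> \<Longrightarrow> \<zero>\<^bsub>E\<^esub> p = \<zero>"
  by (auto simp: E_def)

lemma EI:
  assumes "s \<in> extensional \<mm>" "\<And>p. p \<in> \<mm> \<Longrightarrow> s p \<in> \<mm>"
    and "\<And>p q. p \<in> \<mm> \<Longrightarrow> q \<in> \<mm> \<Longrightarrow> p \<otimes> s q = s p \<otimes> q"
  shows "s \<in> carrier E"
  using assms by (auto simp: E_def PiE_def)

text \<open>Symmetry gives \<open>x s(p) = s(x) p\<close>, and \<open>x\<close> cancels. Every
  identity in \<open>E\<close>, including the ring axioms, thereby becomes a computation at the
  single argument \<open>x\<close>.\<close>

lemma E_eqI:
  assumes s: "s \<in> carrier E" and t: "t \<in> carrier E" and "s x = t x"
  shows "s = t"
proof (rule extensionalityI[of _ \<mm>])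
  show "s \<in> extensional \<mm>" "t \<in> extensional \<mm>" using s t by (auto simp: E_def PiE_def)
  fix p assume p: "p \<in> \<mm>"
  have "x \<otimes> s p = x \<otimes> t p" using E_sym[OF s x_m p] E_sym[OF t x_m p] assms(3) by simp
  then show "s p = t p" using E_carrier[OF s p] E_carrier[OF t p] by (rule x_cancel)
qed

lemma E_smult:
  assumes s: "s \<in> carrier E" and p: "p \<in> \<mm>" and r: "r \<in> carrier R"
  shows "s (r \<otimes> p) = r \<otimes> s p"
proof (rule x_cancel)
  note c = m_carrier[OF p] E_carrier[OF s p] E_carrier[OF s x_m]
  have rp: "r \<otimes> p \<in> \<mm>" using p r by (rule max.I_l_closed)
  have "x \<otimes> s (r \<otimes> p) = r \<otimes> (s x \<otimes> p)" using E_sym[OF s x_m rp] c r by (simp add: m_lcomm)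
  also have "\<dots> = x \<otimes> (r \<otimes> s p)" using E_sym[OF s x_m p] c r by (simp add: m_lcomm)
  finally show "x \<otimes> s (r \<otimes> p) = x \<otimes> (r \<otimes> s p)" .
  show "s (r \<otimes> p) \<in> carrier R" using s rp by (rule E_carrier)
  show "r \<otimes> s p \<in> carrier R" using r c by simp
qed

lemma E_smult_right:
  assumes s: "s \<in> carrier E" and p: "p \<in> \<mm>" and r: "r \<in> carrier R"
  shows "s (p \<otimes> r) = s p \<otimes> r"
  using E_smult[OF assms] m_comm[OF m_carrier[OF p] r] m_comm[OF E_carrier[OF s p] r] by simp

lemma E_add:
  assumes s: "s \<in> carrier E" and p: "p \<in> \<mm>" and q: "q \<in> \<mm>"
  shows "s (p \<oplus> q) = s p \<oplus> s q"
proof (rule x_cancel)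
  note c = m_carrier[OF p] m_carrier[OF q] E_carrier[OF s p] E_carrier[OF s q] E_carrier[OF s x_m]
  have pq: "p \<oplus> q \<in> \<mm>" using p q by (rule max.a_closed)
  show "x \<otimes> s (p \<oplus> q) = x \<otimes> (s p \<oplus> s q)"
    using E_sym[OF s x_m pq] E_sym[OF s x_m p] E_sym[OF s x_m q] c by (simp add: r_distr)
  show "s (p \<oplus> q) \<in> carrier R" using s pq by (rule E_carrier)
  show "s p \<oplus> s q \<in> carrier R" using c by simp
qed

lemma E_zero: "s \<in> carrier E \<Longrightarrow> s \<zero> = \<zero>"
  using E_smult[of s x \<zero>] x_m E_carrier[of s x] by simp

lemma E_cring: "cring E"
proof (rule cringI)
  have mult: "s \<otimes>\<^bsub>E\<^esub> t \<in> carrier E" if s: "s \<in> carrier E" and t: "t \<in> carrier E" for s t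
  proof (rule EI)
    note [simp] = E_maps[OF s] E_maps[OF t] E_carrier[OF s] E_carrier[OF t]
    show "s \<otimes>\<^bsub>E\<^esub> t \<in> extensional \<mm>" by (simp add: E_def)
    show "(s \<otimes>\<^bsub>E\<^esub> t) p \<in> \<mm>" if "p \<in> \<mm>" for p using that by simp
    fix p q assume pq: "p \<in> \<mm>" "q \<in> \<mm>"
    have "p \<otimes> s (t q) = s p \<otimes> t q" using E_sym[OF s] pq by simp
    also have "\<dots> = s (p \<otimes> t q)" using E_smult_right[OF s] pq by simp
    also have "\<dots> = s (t p \<otimes> q)" using E_sym[OF t] pq by simp
    also have "\<dots> = s (t p) \<otimes> q" using E_smult_right[OF s] pq m_carrier by simp
    finally show "p \<otimes> (s \<otimes>\<^bsub>E\<^esub> t) q = (s \<otimes>\<^bsub>E\<^esub> t) p \<otimes> q" using pq by simp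
  qed
  have add: "s \<oplus>\<^bsub>E\<^esub> t \<in> carrier E" if s: "s \<in> carrier E" and t: "t \<in> carrier E" for s t
  proof (rule EI)
    note [simp] = E_maps[OF s] E_maps[OF t] E_carrier[OF s] E_carrier[OF t]
    show "s \<oplus>\<^bsub>E\<^esub> t \<in> extensional \<mm>" by (simp add: E_def)
    show "(s \<oplus>\<^bsub>E\<^esub> t) p \<in> \<mm>" if "p \<in> \<mm>" for p using that by simp
    show "p \<otimes> (s \<oplus>\<^bsub>E\<^esub> t) q = (s \<oplus>\<^bsub>E\<^esub> t) p \<otimes> q" if "p \<in> \<mm>" "q \<in> \<mm>" for p q
      using that E_sym[OF s, of p q] E_sym[OF t, of p q] m_carrier by (simp add: l_distr r_distr)
  qed
  have zero: "\<zero>\<^bsub>E\<^esub> \<in> carrier E" and one: "\<one>\<^bsub>E\<^esub> \<in> carrier E"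
    by (rule EI; simp add: E_def m_carrier)+
  have comm: "s \<otimes>\<^bsub>E\<^esub> t = t \<otimes>\<^bsub>E\<^esub> s" if s: "s \<in> carrier E" and t: "t \<in> carrier E" for s t
  proof (rule E_eqI)
    note [simp] = E_maps[OF s] E_maps[OF t] E_carrier[OF s] E_carrier[OF t]
    have a: "x \<otimes> s (t x) = s x \<otimes> t x" using E_sym[OF s x_m] x_m by simp
    have b: "x \<otimes> t (s x) = t x \<otimes> s x" using E_sym[OF t x_m] x_m by simp
    have "x \<otimes> s (t x) = x \<otimes> t (s x)" unfolding a b by (rule m_comm) (use x_m in simp_all)
    then have "s (t x) = t (s x)" by (rule x_cancel) (use x_m in simp_all)
    then show "(s \<otimes>\<^bsub>E\<^esub> t) x = (t \<otimes>\<^bsub>E\<^esub> s) x" using x_m by simp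
  qed (use mult s t in auto)
  show "abelian_group E"
  proof (rule abelian_groupI)
    fix s assume s: "s \<in> carrier E"
    note [simp] = E_maps[OF s] E_carrier[OF s]
    show "\<exists>t\<in>carrier E. t \<oplus>\<^bsub>E\<^esub> s = \<zero>\<^bsub>E\<^esub>"
    proof
      let ?t = "\<lambda>p\<in>\<mm>. \<ominus> s p"
      show t: "?t \<in> carrier E"
      proof (rule EI)
        show "p \<otimes> ?t q = ?t p \<otimes> q" if "p \<in> \<mm>" "q \<in> \<mm>" for p q
          using that E_sym[OF s, of p q] m_carrier by (simp add: l_minus r_minus)
      qed auto
      show "?t \<oplus>\<^bsub>E\<^esub> s = \<zero>\<^bsub>E\<^esub>"
        by (rule E_eqI[OF add[OF t s] zero]) (use x_m in \<open>simp add: l_neg\<close>)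
    qed
    show "\<zero>\<^bsub>E\<^esub> \<oplus>\<^bsub>E\<^esub> s = s"
      by (rule E_eqI[OF add[OF zero s] s]) (use x_m in simp)
    fix t assume t: "t \<in> carrier E"
    note [simp] = E_maps[OF t] E_carrier[OF t]
    show "s \<oplus>\<^bsub>E\<^esub> t = t \<oplus>\<^bsub>E\<^esub> s"
      by (rule E_eqI[OF add[OF s t] add[OF t s]]) (use x_m in \<open>simp add: a_comm\<close>)
    fix u assume u: "u \<in> carrier E"
    note [simp] = E_maps[OF u] E_carrier[OF u]
    show "(s \<oplus>\<^bsub>E\<^esub> t) \<oplus>\<^bsub>E\<^esub> u = s \<oplus>\<^bsub>E\<^esub> (t \<oplus>\<^bsub>E\<^esub> u)"
      by (rule E_eqI[OF add[OF add[OF s t] u] add[OF s add[OF t u]]])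
         (use x_m in \<open>simp add: a_assoc\<close>)
  qed (use add zero in auto)
  show "comm_monoid E"
  proof (rule comm_monoidI)
    fix s assume s: "s \<in> carrier E"
    note [simp] = E_maps[OF s] E_carrier[OF s]
    show "\<one>\<^bsub>E\<^esub> \<otimes>\<^bsub>E\<^esub> s = s"
      by (rule E_eqI[OF mult[OF one s] s]) (use x_m in simp)
    fix t u assume t: "t \<in> carrier E" and u: "u \<in> carrier E"
    note [simp] = E_maps[OF t] E_carrier[OF t] E_maps[OF u] E_carrier[OF u]
    show "(s \<otimes>\<^bsub>E\<^esub> t) \<otimes>\<^bsub>E\<^esub> u = s \<otimes>\<^bsub>E\<^esub> (t \<otimes>\<^bsub>E\<^esub> u)"
      by (rule E_eqI[OF mult[OF mult[OF s t] u] mult[OF s mult[OF t u]]])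
         (use x_m in simp)
  qed (use mult one comm in auto)
  fix s t u assume s: "s \<in> carrier E" and t: "t \<in> carrier E" and u: "u \<in> carrier E"
  note [simp] = E_maps[OF s] E_carrier[OF s] E_maps[OF t] E_carrier[OF t] E_maps[OF u] E_carrier[OF u]
  show "(s \<oplus>\<^bsub>E\<^esub> t) \<otimes>\<^bsub>E\<^esub> u = s \<otimes>\<^bsub>E\<^esub> u \<oplus>\<^bsub>E\<^esub> t \<otimes>\<^bsub>E\<^esub> u"
    by (rule E_eqI[OF mult[OF add[OF s t] u] add[OF mult[OF s u] mult[OF t u]]])
       (use x_m in simp)
qed

sublocale E: cring E
  by (rule E_cring)

lemma E_minus_apply:
  assumes "s \<in> carrier E" "t \<in> carrier E" "p \<in> \<mm>"
  shows "(s \<ominus>\<^bsub>E\<^esub> t) p = s p \<ominus> t p"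
proof -
  have d: "s \<ominus>\<^bsub>E\<^esub> t \<in> carrier E" using assms by simp
  have "(s \<ominus>\<^bsub>E\<^esub> t) \<oplus>\<^bsub>E\<^esub> t = s" using assms(1,2) by algebra
  then have "(s \<ominus>\<^bsub>E\<^esub> t) p \<oplus> t p = s p" using assms(3) E_apply(2) by metis
  moreover have "(s \<ominus>\<^bsub>E\<^esub> t) p \<in> carrier R" using E_carrier[OF d assms(3)] .
  moreover have "t p \<in> carrier R" using E_carrier assms(2,3) by blast
  ultimately show ?thesis by (metis a_minus_def add.inv_solve_right add.m_closed)
qed

section \<open>The embedding of \<open>R\<close> in \<open>E\<close> and the maximal ideal as an
  ideal of \<open>E\<close>\<close>

definition scal :: "'a \<Rightarrow> 'a \<Rightarrow> 'a"
  where "scal r = (\<lambda>p\<in>\<mm>. r \<otimes> p)"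

lemma scal_apply [simp]: "p \<in> \<mm> \<Longrightarrow> scal r p = r \<otimes> p"
  by (simp add: scal_def)

lemma scal_closed [simp]:
  assumes "r \<in> carrier R"
  shows "scal r \<in> carrier E"
proof (rule EI)
  show "scal r \<in> extensional \<mm>" by (simp add: scal_def)
  show "scal r p \<in> \<mm>" if "p \<in> \<mm>" for p using that assms max.I_l_closed by simp
  show "p \<otimes> scal r q = scal r p \<otimes> q" if "p \<in> \<mm>" "q \<in> \<mm>" for p q
    using that assms m_carrier by (simp add: m_ac)
qed

lemma
  assumes "r \<in> carrier R" "s \<in> carrier R"
  shows scal_mult: "scal (r \<otimes> s) = scal r \<otimes>\<^bsub>E\<^esub> scal s"
    and scal_add: "scal (r \<oplus> s) = scal r \<oplus>\<^bsub>E\<^esub> scal s"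
  by (rule E_eqI; use assms x_m max.I_l_closed in \<open>simp add: m_assoc l_distr\<close>)+

lemma scal_one: "scal \<one> = \<one>\<^bsub>E\<^esub>" and scal_zero: "scal \<zero> = \<zero>\<^bsub>E\<^esub>"
  by (rule E_eqI; use x_m in simp)+

lemma scal_inj:
  assumes "scal r = scal s" "r \<in> carrier R" "s \<in> carrier R"
  shows "r = s"
proof (rule x_cancel[OF _ assms(2,3)])
  have "scal r x = scal s x" using assms(1) by simp
  then show "x \<otimes> r = x \<otimes> s" using x_m assms(2,3) m_comm[of x] by simp
qed

text \<open>In terms of fractions, \<open>s\<close> times \<open>p\<close> is \<open>s(p)\<close>,
  which is again in \<open>\<mm>\<close>. This makes \<open>\<mm>\<close> an ideal of
  \<open>E\<close> and not only of \<open>R\<close>.\<close>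

lemma E_scal:
  assumes "s \<in> carrier E" "p \<in> \<mm>"
  shows "s \<otimes>\<^bsub>E\<^esub> scal p = scal (s p)"
proof (rule E_eqI)
  have "s (p \<otimes> x) = s p \<otimes> x" using assms x_carrier by (rule E_smult_right)
  then show "(s \<otimes>\<^bsub>E\<^esub> scal p) x = scal (s p) x" using x_m by simp
qed (use assms m_carrier E_carrier in simp_all)

definition mE :: "('a \<Rightarrow> 'a) set"
  where "mE = scal ` \<mm>"

lemma mE_ideal: "ideal mE E"
proof (rule E.ideal_cringI)
  show "mE \<subseteq> carrier E" using m_carrier by (auto simp: mE_def)
  show "\<zero>\<^bsub>E\<^esub> \<in> mE" using scal_zero max.zero_closed unfolding mE_def by (metis image_eqI)
  show "s \<oplus>\<^bsub>E\<^esub> t \<in> mE" if "s \<in> mE" "t \<in> mE" for s t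
    using that m_carrier by (auto simp: mE_def simp flip: scal_add)
  show "t \<otimes>\<^bsub>E\<^esub> s \<in> mE" if "s \<in> mE" "t \<in> carrier E" for s t
    using that E_scal[OF that(2)] E_maps[OF that(2)] by (auto simp: mE_def)
qed

sublocale mE: ideal mE E
  by (rule mE_ideal)

text \<open>As a fraction \<open>s\<close> is \<open>s(x)/x\<close>, and both sides are
  \<open>s^(n+1) x^(n+1)\<close>. The value of \<open>s^(n+1)\<close> at \<open>x\<close> already
  contains one factor \<open>x\<close>, which leaves the exponent \<open>n\<close>.\<close>

lemma E_pow_Suc_apply:
  assumes s: "s \<in> carrier E"
  shows "(s x) [^] Suc n = x [^] n \<otimes> (s [^]\<^bsub>E\<^esub> Suc n) x"
proof (induction n)
  case 0
  show ?case using s x_m by simp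
next
  case (Suc n)
  obtain t where t: "t = s [^]\<^bsub>E\<^esub> Suc n" "t \<in> carrier E" using s by simp
  have tx: "t x \<in> \<mm>" "t x \<in> carrier R" using E_maps E_carrier t(2) x_m by blast+
  have sx: "s x \<in> carrier R" "s (t x) \<in> carrier R" using E_carrier[OF s] x_m tx by blast+
  have "(s x) [^] Suc (Suc n) = (x [^] n \<otimes> t x) \<otimes> s x" using Suc t by simp
  also have "\<dots> = x [^] n \<otimes> (x \<otimes> s (t x))"
    using E_sym[OF s x_m tx(1)] tx(2) sx m_comm[of "t x" "s x"] by (simp add: m_assoc)
  also have "s (t x) = (t \<otimes>\<^bsub>E\<^esub> s) x" using E.m_comm[of t s] t s x_m by simp
  also have "t \<otimes>\<^bsub>E\<^esub> s = s [^]\<^bsub>E\<^esub> Suc (Suc n)" using t by simp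
  finally have "(s x) [^] Suc (Suc n) = x [^] n \<otimes> (x \<otimes> (s [^]\<^bsub>E\<^esub> Suc (Suc n)) x)" .
  moreover have "(s [^]\<^bsub>E\<^esub> Suc (Suc n)) x \<in> carrier R" using E_carrier[OF E.nat_pow_closed[OF s] x_m] .
  ultimately show ?case by (simp add: m_assoc)
qed

text \<open>This is where seminormality enters. All high powers of the fraction
  \<open>s = s(x)/x\<close> lie in \<open>\<mm>\<close>, hence in \<open>R\<close>, so
  \<open>s\<close> is multiplication by some \<open>b\<close> in \<open>R\<close>. As
  \<open>b^k\<close> lies in \<open>\<mm>\<close>, \<open>b\<close> is not a unit and lies in
  \<open>\<mm>\<close> as well.\<close>

lemma mE_radical:
  assumes s: "s \<in> carrier E" and k: "s [^]\<^bsub>E\<^esub> (k::nat) \<in> mE"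
  shows "s \<in> mE"
proof -
  have later: "s [^]\<^bsub>E\<^esub> i \<in> mE" if "i \<ge> k" for i :: nat
    using mE.I_l_closed[OF k, of "s [^]\<^bsub>E\<^esub> (i - k)"] E.nat_pow_mult[OF s, of "i - k" k] s that by simp
  have "\<exists>b\<in>carrier R. s x = x \<otimes> b"
  \<comment> \<open>The bound is \<open>Suc k\<close> so that each exponent is a successor, as the
    formula for powers of \<open>s x\<close> requires, even when \<open>k = 0\<close>.\<close>
  proof (rule seminormal_divides_of_powers[OF x_regular, of _ "Suc k"])
    fix i assume "i \<ge> Suc k"
    then obtain n where n: "i = Suc n" "n \<ge> k" using Suc_le_D by auto
    obtain p where p: "p \<in> \<mm>" "s [^]\<^bsub>E\<^esub> Suc n = scal p" using later[of "Suc n"] n by (auto simp: mE_def)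
    have "(s x) [^] i = x [^] n \<otimes> (p \<otimes> x)" using E_pow_Suc_apply[OF s, of n] unfolding p(2) n(1) using x_m by simp
    also have "\<dots> = x [^] i \<otimes> p" using n m_carrier[OF p(1)] by (simp add: m_ac)
    finally have "(s x) [^] i = x [^] i \<otimes> p" .
    then show "\<exists>b\<in>carrier R. (s x) [^] i = x [^] i \<otimes> b" using p m_carrier by blast
  qed (use E_carrier[OF s x_m] in simp)
  then obtain b where b: "b \<in> carrier R" "s x = x \<otimes> b" by blast
  have sb: "s = scal b" using b s x_m m_comm[of x b] by (intro E_eqI) simp_all
  have pow: "scal b [^]\<^bsub>E\<^esub> i = scal (b [^] i)" for i :: nat
    by (induction i) (use b scal_mult in \<open>simp_all add: scal_one\<close>)
  obtain p where p: "p \<in> \<mm>" "scal (b [^] k) = scal p" using k sb pow by (auto simp: mE_def)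
  then have "b [^] k \<in> \<mm>" using scal_inj[OF p(2)] b(1) m_carrier[OF p(1)] p(1) by simp
  then have "b \<in> \<mm>"
    using unit_if_notin[OF b(1)] unit_notin_m[OF Units_pow_closed, of b k] by blast
  then show ?thesis unfolding sb mE_def by (rule imageI)
qed

end

section \<open>The quotient of \<open>E\<close> by the maximal ideal of \<open>R\<close>\<close>

context seminormal_dim_one
begin

abbreviation T where "T \<equiv> E Quot mE"

abbreviation proj where "proj \<equiv> (+>\<^bsub>E\<^esub>) mE"

lemma proj_surj:
  assumes "t \<in> carrier T"
  obtains s where "s \<in> carrier E" "t = proj s"
proof -
  have "t \<in> a_rcosets\<^bsub>E\<^esub> mE" using assms by (simp add: FactRing_def)
  then obtain s where "s \<in> carrier E" "t = proj s" by (auto simp: A_RCOSETS_def')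
  then show thesis by (rule that)
qed

lemma T_cring: "cring T"
  by (rule mE.quotient_is_cring[OF E.is_cring])

sublocale T: cring T
  by (rule T_cring)

sublocale proj: ring_hom_ring E T proj
  by (rule mE.rcos_ring_hom_ring)

lemma proj_eq_iff: "s \<in> carrier E \<Longrightarrow> t \<in> carrier E \<Longrightarrow> proj s = proj t \<longleftrightarrow> s \<ominus>\<^bsub>E\<^esub> t \<in> mE"
  by (rule sym[OF E.quotient_eq_iff_same_a_r_cos[OF mE_ideal]])

lemma proj_zero_iff:
  assumes "s \<in> carrier E"
  shows "proj s = \<zero>\<^bsub>T\<^esub> \<longleftrightarrow> s \<in> mE"
proof -
  have "s \<ominus>\<^bsub>E\<^esub> \<zero>\<^bsub>E\<^esub> = s" using assms unfolding a_minus_def by simp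
  then show ?thesis using proj_eq_iff[OF assms E.zero_closed] unfolding proj.hom_zero by metis
qed

lemma proj_minus:
  "s \<in> carrier E \<Longrightarrow> t \<in> carrier E \<Longrightarrow> proj (s \<ominus>\<^bsub>E\<^esub> t) = proj s \<ominus>\<^bsub>T\<^esub> proj t"
  unfolding a_minus_def by (metis E.a_inv_closed proj.hom_a_inv proj.hom_add)

lemma proj_pow: "s \<in> carrier E \<Longrightarrow> proj (s [^]\<^bsub>E\<^esub> (k::nat)) = proj s [^]\<^bsub>T\<^esub> k"
  by (induction k) simp_all

lemma T_reduced: "reduced_ring T"
  unfolding reduced_ring_def
proof (intro ballI allI impI)
  fix t and n :: nat assume t: "t \<in> carrier T" "t [^]\<^bsub>T\<^esub> n = \<zero>\<^bsub>T\<^esub>"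
  obtain s where s: "s \<in> carrier E" "t = proj s" by (rule proj_surj[OF t(1)])
  have "s [^]\<^bsub>E\<^esub> n \<in> mE" using t(2) s proj_pow[of s n] proj_zero_iff[of "s [^]\<^bsub>E\<^esub> n"] by simp
  then have "s \<in> mE" using mE_radical s by blast
  then show "t = \<zero>\<^bsub>T\<^esub>" using proj_zero_iff s by simp
qed

text \<open>The \<open>R\<close>-submodules of \<open>E\<close> become ideals of \<open>R\<close>.
  Evaluation at \<open>x\<close> is injective on \<open>E\<close>, so no information is lost and
  chain conditions transfer from \<open>R\<close>.\<close>

lemma evaluation_ideal:
  assumes "K \<subseteq> carrier E" "\<zero>\<^bsub>E\<^esub> \<in> K"
    and "\<And>s t. s \<in> K \<Longrightarrow> t \<in> K \<Longrightarrow> s \<oplus>\<^bsub>E\<^esub> t \<in> K"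
    and "\<And>r s. r \<in> carrier R \<Longrightarrow> s \<in> K \<Longrightarrow> scal r \<otimes>\<^bsub>E\<^esub> s \<in> K"
  shows "ideal ((\<lambda>s. s x) ` K) R"
proof (rule ideal_cringI)
  show "(\<lambda>s. s x) ` K \<subseteq> carrier R" using assms(1) E_carrier x_m by blast
  show "\<zero> \<in> (\<lambda>s. s x) ` K" using assms(2) E_apply(4)[OF x_m] by (metis image_eqI)
  show "a \<oplus> b \<in> (\<lambda>s. s x) ` K" if "a \<in> (\<lambda>s. s x) ` K" "b \<in> (\<lambda>s. s x) ` K" for a b
    using that assms(3) E_apply(2)[OF x_m] by (metis (no_types, lifting) imageE image_eqI)
  show "r \<otimes> a \<in> (\<lambda>s. s x) ` K" if a: "a \<in> (\<lambda>s. s x) ` K" and r: "r \<in> carrier R" for a r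
  proof -
    obtain s where s: "s \<in> K" "a = s x" using a by blast
    then have "s x \<in> \<mm>" using assms(1) E_maps x_m by blast
    then have "r \<otimes> a = (scal r \<otimes>\<^bsub>E\<^esub> s) x" using s x_m by simp
    then show ?thesis using assms(4)[OF r s(1)] by (metis image_eqI)
  qed
qed

text \<open>An ideal of \<open>T\<close> is recovered from its preimage in \<open>E\<close>, and the
  preimage from its values at \<open>x\<close>.\<close>

lemma T_noetherian: "noetherian_ring T"
proof (rule noetherian_ring_ideal_embedding[where \<phi> = "\<lambda>J. (\<lambda>s. s x) ` {s \<in> carrier E. proj s \<in> J}"])
  show "noetherian_ring R" by (rule noetherian_ring_axioms)
  show "ring T" by (rule T.ring_axioms)
  show "ideal ((\<lambda>s. s x) ` {s \<in> carrier E. proj s \<in> J}) R" if J: "ideal J T" for J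
  proof (rule evaluation_ideal)
    interpret J: ideal J T by fact
    show "\<zero>\<^bsub>E\<^esub> \<in> {s \<in> carrier E. proj s \<in> J}" by simp
    show "s \<oplus>\<^bsub>E\<^esub> t \<in> {s \<in> carrier E. proj s \<in> J}"
      if "s \<in> {s \<in> carrier E. proj s \<in> J}" "t \<in> {s \<in> carrier E. proj s \<in> J}" for s t
      using that by simp
    show "scal r \<otimes>\<^bsub>E\<^esub> s \<in> {s \<in> carrier E. proj s \<in> J}"
      if "r \<in> carrier R" "s \<in> {s \<in> carrier E. proj s \<in> J}" for r s
      using that J.I_l_closed by simp
  qed auto
  show "I = J" if id: "ideal I T" "ideal J T"
    and eq: "(\<lambda>s. s x) ` {s \<in> carrier E. proj s \<in> I} = (\<lambda>s. s x) ` {s \<in> carrier E. proj s \<in> J}" for I J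
  proof -
    have sub: "t \<in> J'" if t: "t \<in> I'" "ideal I' T"
      "(\<lambda>s. s x) ` {s \<in> carrier E. proj s \<in> I'} \<subseteq> (\<lambda>s. s x) ` {s \<in> carrier E. proj s \<in> J'}" for t I' J'
    proof -
      obtain s where s: "s \<in> carrier E" "t = proj s"
        by (rule proj_surj[OF ideal.Icarr[OF t(2,1)]])
      then have "s x \<in> (\<lambda>s. s x) ` {s \<in> carrier E. proj s \<in> J'}" using t by blast
      then obtain s' where "s' \<in> carrier E" "proj s' \<in> J'" "s x = s' x" by auto
      then show ?thesis using E_eqI[of s s'] s by simp
    qed
    show ?thesis using sub[of _ I J] sub[of _ J I] id eq by (intro equalityI subsetI) simp_all
  qed
qed auto

sublocale T: noetherian_cring T
  by (intro noetherian_cring.intro T_noetherian T_cring)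

text \<open>By the chain condition every \<open>s\<close> satisfies a monic equation over the image of \<open>R\<close>,
  and the image of \<open>R\<close> in \<open>T\<close> is a field.\<close>

lemma T_von_neumann_regular:
  assumes "t \<in> carrier T"
  shows "\<exists>q\<in>carrier T. t = t \<otimes>\<^bsub>T\<^esub> t \<otimes>\<^bsub>T\<^esub> q"
proof -
  obtain s where s: "s \<in> carrier E" "t = proj s" by (rule proj_surj[OF assms])
  define K where "K = scal ` carrier R"
  have K: "K \<subseteq> carrier E" "\<zero>\<^bsub>E\<^esub> \<in> K" "\<one>\<^bsub>E\<^esub> \<in> K"
    unfolding K_def using scal_zero scal_one by (auto, metis image_eqI zero_closed, metis image_eqI one_closed)
  have K_add: "a \<oplus>\<^bsub>E\<^esub> b \<in> K" and K_mult: "a \<otimes>\<^bsub>E\<^esub> b \<in> K" if "a \<in> K" "b \<in> K" for a b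
    using that by (auto simp: K_def simp flip: scal_add scal_mult)
  define L where "L = (\<lambda>k. (\<lambda>s. s x) ` E.polys K s k)"
  have pc: "E.polys K s k \<subseteq> carrier E" for k by (rule E.polys_carrier[OF K(1) s(1)])
  have mono: "E.polys K s k \<subseteq> E.polys K s (Suc k)" for k by (rule E.polys_mono[OF s(1) K(2)])
  have zero: "\<zero>\<^bsub>E\<^esub> \<in> E.polys K s k" for k
    by (induction k) (use mono in auto)
  have "ideal (L k) R" for k unfolding L_def
  proof (rule evaluation_ideal[OF pc zero])
    show "a \<oplus>\<^bsub>E\<^esub> b \<in> E.polys K s k" if "a \<in> E.polys K s k" "b \<in> E.polys K s k" for a b
      using E.polys_add[OF K(1) s(1) K_add that] .
    show "scal r \<otimes>\<^bsub>E\<^esub> a \<in> E.polys K s k" if "r \<in> carrier R" "a \<in> E.polys K s k" for r a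
      using E.polys_scale[OF K(1) s(1) _ K_mult that(2)] that(1) by (simp add: K_def)
  qed
  moreover have "L k \<subseteq> L (Suc k)" for k unfolding L_def using mono by (rule image_mono)
  ultimately obtain k where k: "L (Suc k) = L k"
    using ascending_ideals_stabilise[where L = L] by blast
  \<comment> \<open>Since \<open>L\<close> repeats at \<open>k\<close>, the power
    \<open>s^k\<close>, which has degree below \<open>k + 1\<close>, takes at \<open>x\<close> the
    value of an expression of degree below \<open>k\<close>. Equality at \<open>x\<close> is
    equality in \<open>E\<close>, and this is the monic relation.\<close>
  have "s [^]\<^bsub>E\<^esub> k \<in> E.polys K s (Suc k)" by (rule E.pow_in_polys[OF s(1) K(2,3)])
  then have "(s [^]\<^bsub>E\<^esub> k) x \<in> L k" using k unfolding L_def by blast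
  then obtain u where u: "u \<in> E.polys K s k" "(s [^]\<^bsub>E\<^esub> k) x = u x" by (auto simp: L_def)
  then have "s [^]\<^bsub>E\<^esub> k = u" using pc s(1) by (intro E_eqI) auto
  with u have rel: "s [^]\<^bsub>E\<^esub> k \<in> E.polys K s k" by simp
  have proj_polys: "proj v \<in> T.polys (proj ` K) t n" if "v \<in> E.polys K s n" for v n
    using that
  proof (induction n arbitrary: v)
    case 0
    then show ?case by simp
  next
    case (Suc n)
    obtain r w where v: "v = r \<oplus>\<^bsub>E\<^esub> s \<otimes>\<^bsub>E\<^esub> w" "r \<in> K" "w \<in> E.polys K s n" using Suc.prems by auto
    have "r \<in> carrier E" "w \<in> carrier E" using v K(1) pc by blast+
    then have "proj v = proj r \<oplus>\<^bsub>T\<^esub> t \<otimes>\<^bsub>T\<^esub> proj w" using v(1) s by simp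
    then show ?case using Suc.IH[OF v(3)] v(2) by auto
  qed
  have "t [^]\<^bsub>T\<^esub> k \<in> T.polys (proj ` K) t k" using proj_polys[OF rel] proj_pow s by simp
  moreover have "r = \<zero>\<^bsub>T\<^esub> \<or> r \<in> Units T" if r: "r \<in> proj ` K" for r
  proof -
    obtain a where a: "a \<in> carrier R" "r = proj (scal a)" using r unfolding K_def by blast
    show ?thesis
    proof (cases "a \<in> \<mm>")
      case True
      then show ?thesis using a proj_zero_iff by (simp add: mE_def)
    next
      case False
      then have u: "a \<in> Units R" using unit_if_notin a by blast
      have "proj (scal a) \<otimes>\<^bsub>T\<^esub> proj (scal (inv a)) = proj (scal (a \<otimes> inv a))"
        using u a by (simp add: scal_mult del: Units_r_inv)
      also have "\<dots> = \<one>\<^bsub>T\<^esub>" using u by (simp add: scal_one)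
      finally have "r \<otimes>\<^bsub>T\<^esub> proj (scal (inv a)) = \<one>\<^bsub>T\<^esub>" using a by simp
      moreover have "r \<in> carrier T" "proj (scal (inv a)) \<in> carrier T" using a u by simp_all
      ultimately have "r \<in> Units T"
        using T.m_comm[of r "proj (scal (inv a))"] unfolding Units_def by auto
      then show ?thesis ..
    qed
  qed
  moreover have "proj ` K \<subseteq> carrier T" using K(1) by auto
  ultimately show ?thesis
    by (intro T.reduced_monic_relation[OF T_reduced _ _ assms, of "proj ` K" k])
qed

text \<open>The idempotent statement in \<open>T\<close>, pulled back to \<open>E\<close>. Closure
  under \<open>e + (1 - e) b\<close> is demanded only up to \<open>mE\<close>, because the
  combination of functionals that realises it has an error there.\<close>

lemma ex_dominating_idempotent_mod:
  assumes B: "B \<subseteq> carrier E" "B \<noteq> {}"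
    and mult: "\<And>s b. s \<in> carrier E \<Longrightarrow> b \<in> B \<Longrightarrow> s \<otimes>\<^bsub>E\<^esub> b \<in> B"
    and comb: "\<And>e b. e \<in> B \<Longrightarrow> b \<in> B \<Longrightarrow> e \<otimes>\<^bsub>E\<^esub> e \<ominus>\<^bsub>E\<^esub> e \<in> mE \<Longrightarrow>
      \<exists>c\<in>B. c \<ominus>\<^bsub>E\<^esub> (e \<oplus>\<^bsub>E\<^esub> (\<one>\<^bsub>E\<^esub> \<ominus>\<^bsub>E\<^esub> e) \<otimes>\<^bsub>E\<^esub> b) \<in> mE"
  obtains e where "e \<in> B" and "\<And>b. b \<in> B \<Longrightarrow> (\<one>\<^bsub>E\<^esub> \<ominus>\<^bsub>E\<^esub> e) \<otimes>\<^bsub>E\<^esub> b \<in> mE"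
proof -
  have *: "proj ` B \<subseteq> carrier T" "proj ` B \<noteq> {}" using B by auto
  have m: "t \<otimes>\<^bsub>T\<^esub> b \<in> proj ` B" if t: "t \<in> carrier T" and b: "b \<in> proj ` B" for t b
  proof -
    obtain s where s: "s \<in> carrier E" "t = proj s" by (rule proj_surj[OF t])
    obtain c where c: "c \<in> B" "b = proj c" using b by blast
    have "t \<otimes>\<^bsub>T\<^esub> b = proj (s \<otimes>\<^bsub>E\<^esub> c)" using s c B(1) by auto
    then show ?thesis using mult s c by blast
  qed
  have c: "e \<oplus>\<^bsub>T\<^esub> (\<one>\<^bsub>T\<^esub> \<ominus>\<^bsub>T\<^esub> e) \<otimes>\<^bsub>T\<^esub> b \<in> proj ` B"
    if eb: "e \<in> proj ` B" "b \<in> proj ` B" "e \<otimes>\<^bsub>T\<^esub> e = e" for e b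
  proof -
    obtain e' b' where e: "e' \<in> B" "e = proj e'" "b' \<in> B" "b = proj b'" using eb(1,2) by blast
    have ec: "e' \<in> carrier E" "b' \<in> carrier E" using e B by auto
    have "e' \<otimes>\<^bsub>E\<^esub> e' \<ominus>\<^bsub>E\<^esub> e' \<in> mE"
      using eb(3) e ec proj_eq_iff[of "e' \<otimes>\<^bsub>E\<^esub> e'" e'] by simp
    then obtain c where c: "c \<in> B" "c \<ominus>\<^bsub>E\<^esub> (e' \<oplus>\<^bsub>E\<^esub> (\<one>\<^bsub>E\<^esub> \<ominus>\<^bsub>E\<^esub> e') \<otimes>\<^bsub>E\<^esub> b') \<in> mE"
      using comb e by blast
    then have "proj c = proj (e' \<oplus>\<^bsub>E\<^esub> (\<one>\<^bsub>E\<^esub> \<ominus>\<^bsub>E\<^esub> e') \<otimes>\<^bsub>E\<^esub> b')"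
      using proj_eq_iff[of c "e' \<oplus>\<^bsub>E\<^esub> (\<one>\<^bsub>E\<^esub> \<ominus>\<^bsub>E\<^esub> e') \<otimes>\<^bsub>E\<^esub> b'"] B(1) ec by auto
    also have "\<dots> = e \<oplus>\<^bsub>T\<^esub> (\<one>\<^bsub>T\<^esub> \<ominus>\<^bsub>T\<^esub> e) \<otimes>\<^bsub>T\<^esub> b" using e ec by (simp add: proj_minus)
    finally show ?thesis using c(1) by (metis image_eqI)
  qed
  obtain t where t: "t \<in> proj ` B" "\<And>b. b \<in> proj ` B \<Longrightarrow> (\<one>\<^bsub>T\<^esub> \<ominus>\<^bsub>T\<^esub> t) \<otimes>\<^bsub>T\<^esub> b = \<zero>\<^bsub>T\<^esub>"
    using T.ex_dominating_idempotent[OF T_von_neumann_regular * m c] by blast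
  obtain e where e: "e \<in> B" "t = proj e" using t(1) by blast
  have "(\<one>\<^bsub>E\<^esub> \<ominus>\<^bsub>E\<^esub> e) \<otimes>\<^bsub>E\<^esub> b \<in> mE" if b: "b \<in> B" for b
  proof -
    have c: "e \<in> carrier E" "b \<in> carrier E" using e b B by auto
    have "proj ((\<one>\<^bsub>E\<^esub> \<ominus>\<^bsub>E\<^esub> e) \<otimes>\<^bsub>E\<^esub> b) = (\<one>\<^bsub>T\<^esub> \<ominus>\<^bsub>T\<^esub> t) \<otimes>\<^bsub>T\<^esub> proj b"
      using e(2) c by (simp add: proj_minus)
    also have "\<dots> = \<zero>\<^bsub>T\<^esub>" using t(2) b by simp
    finally have z: "proj ((\<one>\<^bsub>E\<^esub> \<ominus>\<^bsub>E\<^esub> e) \<otimes>\<^bsub>E\<^esub> b) = \<zero>\<^bsub>T\<^esub>" .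
    show ?thesis by (rule iffD1[OF proj_zero_iff z]) (use c in simp)
  qed
  then show thesis using that e(1) by blast
qed

end

section \<open>Reflexive modules\<close>

text \<open>Membership in \<open>mod_hom\<close> without extensionality, so that composites and
  pointwise combinations of maps are linear without being restricted to the carrier.\<close>

definition linear_map ::
  "('a, 'r) ring_scheme \<Rightarrow> ('a, 'b) module \<Rightarrow> ('a, 'c) module \<Rightarrow> ('b \<Rightarrow> 'c) \<Rightarrow> bool"
  where "linear_map R M N f \<longleftrightarrow> (\<forall>u\<in>carrier M. f u \<in> carrier N) \<and>
    (\<forall>u\<in>carrier M. \<forall>v\<in>carrier M. f (u \<oplus>\<^bsub>M\<^esub> v) = f u \<oplus>\<^bsub>N\<^esub> f v) \<and>
    (\<forall>a\<in>carrier R. \<forall>u\<in>carrier M. f (a \<odot>\<^bsub>M\<^esub> u) = a \<odot>\<^bsub>N\<^esub> f u)"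

lemma linear_mapI:
  assumes "\<And>u. u \<in> carrier M \<Longrightarrow> f u \<in> carrier N"
    and "\<And>u v. u \<in> carrier M \<Longrightarrow> v \<in> carrier M \<Longrightarrow> f (u \<oplus>\<^bsub>M\<^esub> v) = f u \<oplus>\<^bsub>N\<^esub> f v"
    and "\<And>a u. a \<in> carrier R \<Longrightarrow> u \<in> carrier M \<Longrightarrow> f (a \<odot>\<^bsub>M\<^esub> u) = a \<odot>\<^bsub>N\<^esub> f u"
  shows "linear_map R M N f"
  using assms by (simp add: linear_map_def)

lemma
  assumes "linear_map R M N f"
  shows linear_map_closed: "u \<in> carrier M \<Longrightarrow> f u \<in> carrier N"
    and linear_map_add: "u \<in> carrier M \<Longrightarrow> v \<in> carrier M \<Longrightarrow> f (u \<oplus>\<^bsub>M\<^esub> v) = f u \<oplus>\<^bsub>N\<^esub> f v"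
    and linear_map_smult: "a \<in> carrier R \<Longrightarrow> u \<in> carrier M \<Longrightarrow> f (a \<odot>\<^bsub>M\<^esub> u) = a \<odot>\<^bsub>N\<^esub> f u"
  using assms by (auto simp: linear_map_def)

lemma linear_map_comp:
  assumes f: "linear_map R M N f" and g: "linear_map R N P g"
  shows "linear_map R M P (\<lambda>u. g (f u))"
  by (rule linear_mapI)
     (simp_all add: linear_map_closed[OF f] linear_map_closed[OF g] linear_map_add[OF f]
        linear_map_add[OF g] linear_map_smult[OF f] linear_map_smult[OF g])

lemma mod_hom_iff: "f \<in> mod_hom R M N \<longleftrightarrow> f \<in> extensional (carrier M) \<and> linear_map R M N f"
  by (auto simp: mod_hom_def linear_map_def PiE_def)

lemma restrict_mod_hom:
  assumes "module R M" and f: "linear_map R M N f"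
  shows "restrict f (carrier M) \<in> mod_hom R M N"
proof -
  interpret M: module R M by fact
  show ?thesis
    unfolding mod_hom_iff
    by (auto intro!: linear_mapI
        simp: linear_map_closed[OF f] linear_map_add[OF f] linear_map_smult[OF f])
qed

lemma mod_iso_nonempty:
  assumes "module R M" "linear_map R M N f" "bij_betw f (carrier M) (carrier N)"
  shows "mod_iso R M N \<noteq> {}"
proof -
  have "bij_betw (restrict f (carrier M)) (carrier M) (carrier N)"
    using assms(3) bij_betw_cong[of "carrier M" "restrict f (carrier M)" f] by simp
  then show ?thesis
    using restrict_mod_hom[OF assms(1,2)] unfolding mod_iso_def by blast
qed

lemma linear_map_zero:
  assumes "module R M" "module R N" and f: "linear_map R M N f"
  shows "f \<zero>\<^bsub>M\<^esub> = \<zero>\<^bsub>N\<^esub>"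
proof -
  interpret M: module R M by fact
  interpret N: module R N by fact
  have "f \<zero>\<^bsub>M\<^esub> = f (\<zero>\<^bsub>R\<^esub> \<odot>\<^bsub>M\<^esub> \<zero>\<^bsub>M\<^esub>)" by simp
  also have "\<dots> = \<zero>\<^bsub>R\<^esub> \<odot>\<^bsub>N\<^esub> f \<zero>\<^bsub>M\<^esub>" by (rule linear_map_smult[OF f]) simp_all
  also have "\<dots> = \<zero>\<^bsub>N\<^esub>" using linear_map_closed[OF f M.zero_closed] by simp
  finally show ?thesis .
qed

lemma linear_map_a_inv:
  assumes "module R M" "module R N" and f: "linear_map R M N f" and u: "u \<in> carrier M"
  shows "f (\<ominus>\<^bsub>M\<^esub> u) = \<ominus>\<^bsub>N\<^esub> f u"
proof -
  interpret M: module R M by fact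
  interpret N: module R N by fact
  have fu: "f u \<in> carrier N" by (rule linear_map_closed[OF f u])
  have "\<ominus>\<^bsub>M\<^esub> u = (\<ominus>\<^bsub>R\<^esub> \<one>\<^bsub>R\<^esub>) \<odot>\<^bsub>M\<^esub> u" using M.smult_l_minus[of "\<one>\<^bsub>R\<^esub>" u] u by simp
  then have "f (\<ominus>\<^bsub>M\<^esub> u) = (\<ominus>\<^bsub>R\<^esub> \<one>\<^bsub>R\<^esub>) \<odot>\<^bsub>N\<^esub> f u" using linear_map_smult[OF f _ u, of "\<ominus>\<^bsub>R\<^esub> \<one>\<^bsub>R\<^esub>"] by simp
  then show ?thesis using N.smult_l_minus[of "\<one>\<^bsub>R\<^esub>" "f u"] fu by simp
qed

section \<open>Functionals, biduals and retracts\<close>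

lemma regular_module_simps [simp]:
  "carrier (regular_module R) = carrier R"
  "\<zero>\<^bsub>regular_module R\<^esub> = \<zero>\<^bsub>R\<^esub>"
  "a \<oplus>\<^bsub>regular_module R\<^esub> b = a \<oplus>\<^bsub>R\<^esub> b"
  "r \<odot>\<^bsub>regular_module R\<^esub> a = r \<otimes>\<^bsub>R\<^esub> a"
  by (auto simp: regular_module_def)

lemma dual_module_simps [simp]:
  "f \<oplus>\<^bsub>dual_module R M\<^esub> g = (\<lambda>u\<in>carrier M. f u \<oplus>\<^bsub>R\<^esub> g u)"
  "r \<odot>\<^bsub>dual_module R M\<^esub> f = (\<lambda>u\<in>carrier M. r \<otimes>\<^bsub>R\<^esub> f u)"
  by (auto simp: dual_module_def Hom_module_def)

lemma carrier_dual_module: "carrier (dual_module R M) = mod_hom R M (regular_module R)"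
  by (simp add: dual_module_def Hom_module_def)

abbreviation functional :: "('a, 'r) ring_scheme \<Rightarrow> ('a, 'b) module \<Rightarrow> ('b \<Rightarrow> 'a) \<Rightarrow> bool"
  where "functional R M f \<equiv> linear_map R M (regular_module R) f"

lemma (in cring) regular_module_module: "module R (regular_module R)"
proof (rule moduleI[OF is_cring])
  show "abelian_group (regular_module R)"
    by (rule abelian_groupI) (auto simp: a_ac intro: bexI[of _ "\<ominus> _"] l_neg)
qed (auto simp: l_distr r_distr m_assoc)

context cring
begin

lemma functional_add:
  assumes f: "functional R M f" and g: "functional R M g"
  shows "functional R M (\<lambda>u. f u \<oplus> g u)"
  by (rule linear_mapI)
     (simp_all add: linear_map_closed[OF f, simplified] linear_map_closed[OF g, simplified]
       linear_map_add[OF f] linear_map_add[OF g] linear_map_smult[OF f]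
       linear_map_smult[OF g] r_distr a_ac)

lemma functional_smult:
  assumes a: "a \<in> carrier R" and f: "functional R M f"
  shows "functional R M (\<lambda>u. a \<otimes> f u)"
  by (rule linear_mapI)
     (simp_all add: a linear_map_closed[OF f, simplified]
       linear_map_add[OF f] linear_map_smult[OF f] r_distr m_lcomm)

end

text \<open>The two conditions are injectivity and surjectivity of \<open>bidual_map\<close>; its
  linearity and its values in the bidual are automatic.\<close>

lemma reflexive_moduleI:
  assumes M: "module R M"
    and sep: "\<And>u v. u \<in> carrier M \<Longrightarrow> v \<in> carrier M \<Longrightarrow> (\<And>f. functional R M f \<Longrightarrow> f u = f v) \<Longrightarrow> u = v"
    and repr: "\<And>\<phi>. functional R (dual_module R M) \<phi> \<Longrightarrow>
      \<exists>v\<in>carrier M. \<forall>f\<in>carrier (dual_module R M). \<phi> f = f v"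
  shows "reflexive_module R M"
proof -
  interpret M: module R M by fact
  let ?D = "dual_module R M"
  have ev: "bidual_map R M u \<in> carrier (dual_module R ?D)" if u: "u \<in> carrier M" for u
  proof -
    have "functional R ?D (bidual_map R M u)"
    proof (rule linear_mapI)
      fix f g assume "f \<in> carrier ?D" "g \<in> carrier ?D"
      then have f: "functional R M f" and g: "functional R M g" and fg: "f \<in> carrier ?D" "g \<in> carrier ?D"
        by (auto simp: carrier_dual_module mod_hom_iff)
      show "bidual_map R M u f \<in> carrier (regular_module R)"
        using fg u linear_map_closed[OF f u] by (simp add: bidual_map_def)
      have "functional R M (\<lambda>u. f u \<oplus>\<^bsub>R\<^esub> g u)" by (rule M.R.functional_add[OF f g])
      then have "(\<lambda>u\<in>carrier M. f u \<oplus>\<^bsub>R\<^esub> g u) \<in> carrier ?D"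
        using restrict_mod_hom[OF M] by (simp add: carrier_dual_module)
      then show "bidual_map R M u (f \<oplus>\<^bsub>?D\<^esub> g) =
          bidual_map R M u f \<oplus>\<^bsub>regular_module R\<^esub> bidual_map R M u g"
        using u fg by (simp add: bidual_map_def)
    next
      fix a f assume a: "a \<in> carrier R" and fD: "f \<in> carrier ?D"
      then have f: "functional R M f" by (auto simp: carrier_dual_module mod_hom_iff)
      have "functional R M (\<lambda>u. a \<otimes>\<^bsub>R\<^esub> f u)" by (rule M.R.functional_smult[OF a f])
      then have "(\<lambda>u\<in>carrier M. a \<otimes>\<^bsub>R\<^esub> f u) \<in> carrier ?D"
        using restrict_mod_hom[OF M] by (simp add: carrier_dual_module)
      then show "bidual_map R M u (a \<odot>\<^bsub>?D\<^esub> f) = a \<odot>\<^bsub>regular_module R\<^esub> bidual_map R M u f"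
        using u fD by (simp add: bidual_map_def)
    qed
    then show ?thesis
      using u unfolding carrier_dual_module[of R ?D] mod_hom_iff by (simp add: bidual_map_def)
  qed
  let ?DD = "dual_module R ?D"
  have ap: "bidual_map R M u f = f u" if "u \<in> carrier M" "f \<in> carrier ?D" for u f
    using that by (simp add: bidual_map_def)
  have "linear_map R M ?DD (bidual_map R M)"
  proof (rule linear_mapI)
    fix u v assume uv: "u \<in> carrier M" "v \<in> carrier M"
    show "bidual_map R M (u \<oplus>\<^bsub>M\<^esub> v) = bidual_map R M u \<oplus>\<^bsub>?DD\<^esub> bidual_map R M v"
      using uv by (auto simp: bidual_map_def carrier_dual_module mod_hom_iff linear_map_add
          intro!: restrict_ext)
  next
    fix a u assume au: "a \<in> carrier R" "u \<in> carrier M"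
    show "bidual_map R M (a \<odot>\<^bsub>M\<^esub> u) = a \<odot>\<^bsub>?DD\<^esub> bidual_map R M u"
      using au by (auto simp: bidual_map_def carrier_dual_module mod_hom_iff linear_map_smult
          intro!: restrict_ext)
  qed (rule ev)
  moreover have "bidual_map R M \<in> extensional (carrier M)" by (simp add: bidual_map_def)
  moreover have "bij_betw (bidual_map R M) (carrier M) (carrier ?DD)"
  proof (rule bij_betwI')
    fix u v assume uv: "u \<in> carrier M" "v \<in> carrier M"
    show "(bidual_map R M u = bidual_map R M v) = (u = v)"
    proof
      assume eq: "bidual_map R M u = bidual_map R M v"
      show "u = v"
      proof (rule sep[OF uv])
        fix f assume "functional R M f"
        then have "restrict f (carrier M) \<in> carrier ?D"
          using restrict_mod_hom[OF M] by (simp add: carrier_dual_module)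
        then have "restrict f (carrier M) u = restrict f (carrier M) v"
          using ap uv eq by metis
        then show "f u = f v" using uv by simp
      qed
    qed simp
  next
    fix \<phi> assume \<phi>: "\<phi> \<in> carrier ?DD"
    then have "functional R ?D \<phi>" "\<phi> \<in> extensional (carrier ?D)"
      by (auto simp: carrier_dual_module[of R ?D] mod_hom_iff)
    with repr obtain v where v: "v \<in> carrier M" "\<forall>f\<in>carrier ?D. \<phi> f = f v" by blast
    have "\<phi> = bidual_map R M v"
      by (rule extensionalityI[of _ "carrier ?D"])
         (use v \<open>\<phi> \<in> extensional (carrier ?D)\<close> in \<open>auto simp: bidual_map_def\<close>)
    then show "\<exists>v\<in>carrier M. \<phi> = bidual_map R M v" using v by blast
  qed (rule ev)
  ultimately show ?thesis
    unfolding reflexive_module_def mod_iso_def mod_hom_iff by blast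
qed

lemma reflexive_separates:
  assumes "module R M" and refl: "reflexive_module R M"
    and uv: "u \<in> carrier M" "v \<in> carrier M"
    and eq: "\<And>f. functional R M f \<Longrightarrow> f u = f v"
  shows "u = v"
proof -
  have "inj_on (bidual_map R M) (carrier M)"
    using refl unfolding reflexive_module_def mod_iso_def bij_betw_def by blast
  moreover have "bidual_map R M u = bidual_map R M v"
    using uv eq by (auto simp: bidual_map_def carrier_dual_module mod_hom_iff intro!: restrict_ext)
  ultimately show ?thesis using uv by (simp add: inj_on_eq_iff)
qed

text \<open>The functional \<open>\<phi>\<close> on the dual need not be extensional and is only required to be
  compatible with functions that agree on the carrier.\<close>

lemma reflexive_represents:
  assumes M: "module R M" and refl: "reflexive_module R M"
    and closed: "\<And>f. functional R M f \<Longrightarrow> \<phi> f \<in> carrier R"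
    and cong: "\<And>f g. functional R M f \<Longrightarrow> functional R M g \<Longrightarrow> (\<And>u. u \<in> carrier M \<Longrightarrow> f u = g u) \<Longrightarrow> \<phi> f = \<phi> g"
    and add: "\<And>f g. functional R M f \<Longrightarrow> functional R M g \<Longrightarrow> \<phi> (\<lambda>u. f u \<oplus>\<^bsub>R\<^esub> g u) = \<phi> f \<oplus>\<^bsub>R\<^esub> \<phi> g"
    and smult: "\<And>a f. a \<in> carrier R \<Longrightarrow> functional R M f \<Longrightarrow> \<phi> (\<lambda>u. a \<otimes>\<^bsub>R\<^esub> f u) = a \<otimes>\<^bsub>R\<^esub> \<phi> f"
  shows "\<exists>v\<in>carrier M. \<forall>f. functional R M f \<longrightarrow> f v = \<phi> f"
proof -
  interpret M: module R M by fact
  let ?D = "dual_module R M"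
  have D: "functional R M f" if "f \<in> carrier ?D" for f
    using that by (simp add: carrier_dual_module mod_hom_iff)
  note add_fun = M.R.functional_add and smult_fun = M.R.functional_smult
  have res: "functional R M (restrict f (carrier M))" if "functional R M f" for f
    using restrict_mod_hom[OF M that] by (simp add: mod_hom_iff)
  have \<phi>_res: "\<phi> (restrict f (carrier M)) = \<phi> f" if "functional R M f" for f
    by (rule cong[OF res[OF that] that]) simp
  have lin: "functional R ?D \<phi>"
  proof (rule linear_mapI)
    show "\<phi> f \<in> carrier (regular_module R)" if "f \<in> carrier ?D" for f
      using closed[OF D[OF that]] by simp
    show "\<phi> (f \<oplus>\<^bsub>?D\<^esub> g) = \<phi> f \<oplus>\<^bsub>regular_module R\<^esub> \<phi> g" if "f \<in> carrier ?D" "g \<in> carrier ?D" for f g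
      using \<phi>_res[OF add_fun[OF D[OF that(1)] D[OF that(2)]]] add[OF D[OF that(1)] D[OF that(2)]] by simp
    show "\<phi> (a \<odot>\<^bsub>?D\<^esub> f) = a \<odot>\<^bsub>regular_module R\<^esub> \<phi> f" if "a \<in> carrier R" "f \<in> carrier ?D" for a f
      using \<phi>_res[OF smult_fun[OF that(1) D[OF that(2)]]] smult[OF that(1) D[OF that(2)]] by simp
  qed
  have "restrict \<phi> (carrier ?D) \<in> carrier (dual_module R ?D)"
    unfolding carrier_dual_module[of R ?D] mod_hom_iff
  proof
    show "functional R ?D (restrict \<phi> (carrier ?D))"
    proof (rule linear_mapI)
      show "restrict \<phi> (carrier ?D) f \<in> carrier (regular_module R)" if "f \<in> carrier ?D" for f
        using linear_map_closed[OF lin that] that by simp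
      show "restrict \<phi> (carrier ?D) (f \<oplus>\<^bsub>?D\<^esub> g) =
          restrict \<phi> (carrier ?D) f \<oplus>\<^bsub>regular_module R\<^esub> restrict \<phi> (carrier ?D) g"
        if fg: "f \<in> carrier ?D" "g \<in> carrier ?D" for f g
      proof -
        have "f \<oplus>\<^bsub>?D\<^esub> g \<in> carrier ?D"
          using restrict_mod_hom[OF M add_fun[OF D[OF fg(1)] D[OF fg(2)]]]
          by (simp add: carrier_dual_module)
        then show ?thesis using linear_map_add[OF lin fg] fg by (simp del: dual_module_simps)
      qed
      show "restrict \<phi> (carrier ?D) (a \<odot>\<^bsub>?D\<^esub> f) = a \<odot>\<^bsub>regular_module R\<^esub> restrict \<phi> (carrier ?D) f"
        if af: "a \<in> carrier R" "f \<in> carrier ?D" for a f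
      proof -
        have "a \<odot>\<^bsub>?D\<^esub> f \<in> carrier ?D"
          using restrict_mod_hom[OF M smult_fun[OF af(1) D[OF af(2)]]]
          by (simp add: carrier_dual_module)
        then show ?thesis using linear_map_smult[OF lin af] af by (simp del: dual_module_simps)
      qed
    qed
  qed simp
  then have "restrict \<phi> (carrier ?D) \<in> bidual_map R M ` carrier M"
    using refl unfolding reflexive_module_def mod_iso_def bij_betw_def by blast
  then obtain v where v: "v \<in> carrier M" "restrict \<phi> (carrier ?D) = bidual_map R M v" by blast
  have "f v = \<phi> f" if f: "functional R M f" for f
  proof -
    have "restrict f (carrier M) \<in> carrier ?D"
      using restrict_mod_hom[OF M f] by (simp add: carrier_dual_module)
    then have "\<phi> (restrict f (carrier M)) = bidual_map R M v (restrict f (carrier M))"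
      using v(2) by (metis restrict_apply')
    also have "\<dots> = f v" using \<open>restrict f (carrier M) \<in> carrier ?D\<close> v(1) by (simp add: bidual_map_def)
    finally show ?thesis using \<phi>_res[OF f] by simp
  qed
  then show ?thesis using v(1) by blast
qed

text \<open>Isomorphic copies and direct summands are both special cases of retracts.\<close>

lemma Ref_obj_retract:
  fixes R :: "('a, 'r) ring_scheme" and M :: "('a, 'b) module" and N :: "('a, 'c) module"
  assumes M: "Ref_obj R M" and N: "module R N"
    and i: "linear_map R N M i" and \<pi>: "linear_map R M N \<pi>"
    and ret: "\<And>u. u \<in> carrier N \<Longrightarrow> \<pi> (i u) = u"
  shows "Ref_obj R N"
proof -
  have mM: "module R M" and refl: "reflexive_module R M" using M by (auto simp: Ref_obj_def)
  interpret M: module R M by fact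
  interpret N: module R N by fact
  have "fin_gen_module R N"
  proof -
    obtain A where A: "A \<subseteq> carrier M" "finite A"
      and gen: "\<And>H. submodule H R M \<Longrightarrow> A \<subseteq> H \<Longrightarrow> H = carrier M"
      using M unfolding Ref_obj_def fin_gen_module_def by blast
    have "H = carrier N" if H: "submodule H R N" "\<pi> ` A \<subseteq> H" for H
    proof -
      \<comment> \<open>The preimage of \<open>H\<close> contains the generators \<open>A\<close>,
        so it is all of \<open>M\<close>. Applied to \<open>i u\<close> this puts \<open>u\<close>
        into \<open>H\<close>.\<close>
      let ?P = "{u \<in> carrier M. \<pi> u \<in> H}"
      note HE = N.submoduleE[OF H(1)]
      have "\<zero>\<^bsub>N\<^esub> \<in> H" using subgroup.one_closed[OF submodule.axioms(1)[OF H(1)]] by simp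
      then have "submodule ?P R M"
        by (intro M.submoduleI)
           (auto simp: linear_map_zero[OF mM N \<pi>] linear_map_a_inv[OF mM N \<pi>]
             linear_map_add[OF \<pi>] linear_map_smult[OF \<pi>] HE)
      then have P: "carrier M = ?P" by (rule gen[symmetric]) (use A H(2) in blast)
      have "u \<in> H" if u: "u \<in> carrier N" for u
      proof -
        have "i u \<in> ?P" using linear_map_closed[OF i u] unfolding P[symmetric] .
        then show ?thesis using ret[OF u] by simp
      qed
      then show ?thesis using HE(1) by blast
    qed
    moreover have "\<pi> ` A \<subseteq> carrier N" using A linear_map_closed[OF \<pi>] by blast
    ultimately show ?thesis unfolding fin_gen_module_def using A(2) by (intro exI[of _ "\<pi> ` A"]) blast
  qed
  moreover have "reflexive_module R N"
  proof (rule reflexive_moduleI[OF N])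
    fix u v assume uv: "u \<in> carrier N" "v \<in> carrier N" and eq: "\<And>f. functional R N f \<Longrightarrow> f u = f v"
    have "i u = i v"
    proof (rule reflexive_separates[OF mM refl])
      show "i u \<in> carrier M" "i v \<in> carrier M" using uv linear_map_closed[OF i] by auto
      show "f (i u) = f (i v)" if "functional R M f" for f
        using eq[OF linear_map_comp[OF i that]] .
    qed
    then show "u = v" using ret uv by metis
  next
    fix \<phi> assume \<phi>: "functional R (dual_module R N) \<phi>"
    let ?D = "dual_module R N"
    define r where "r = (\<lambda>f :: 'b \<Rightarrow> 'a. restrict (\<lambda>u. f (i u)) (carrier N))"
    have rD: "r f \<in> carrier ?D" if "functional R M f" for f
      using restrict_mod_hom[OF N linear_map_comp[OF i that]] by (simp add: r_def carrier_dual_module)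
    \<comment> \<open>Precomposing \<open>\<phi>\<close> with the restriction of functionals along
      \<open>i\<close> gives an element of the bidual of \<open>M\<close>, represented by some
      \<open>v\<close>. Then \<open>\<pi> v\<close> represents \<open>\<phi>\<close>, since
      \<open>g \<circ> \<pi>\<close> restricts to \<open>g\<close>.\<close>
    have "\<exists>v\<in>carrier M. \<forall>f. functional R M f \<longrightarrow> f v = \<phi> (r f)"
    proof (rule reflexive_represents[OF mM refl, of "\<lambda>f. \<phi> (r f)"])
      show "\<phi> (r f) \<in> carrier R" if "functional R M f" for f
        using linear_map_closed[OF \<phi> rD[OF that]] by simp
      show "\<phi> (r f) = \<phi> (r g)" if "\<And>u. u \<in> carrier M \<Longrightarrow> f u = g u" for f g
      proof -
        have "r f = r g" using that linear_map_closed[OF i] by (auto simp: r_def intro!: restrict_ext)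
        then show ?thesis by simp
      qed
      show "\<phi> (r (\<lambda>u. f u \<oplus>\<^bsub>R\<^esub> g u)) = \<phi> (r f) \<oplus>\<^bsub>R\<^esub> \<phi> (r g)" if "functional R M f" "functional R M g" for f g
      proof -
        have "r (\<lambda>u. f u \<oplus>\<^bsub>R\<^esub> g u) = r f \<oplus>\<^bsub>?D\<^esub> r g" by (auto simp: r_def intro!: restrict_ext)
        then show ?thesis using linear_map_add[OF \<phi> rD[OF that(1)] rD[OF that(2)]] by simp
      qed
      show "\<phi> (r (\<lambda>u. a \<otimes>\<^bsub>R\<^esub> f u)) = a \<otimes>\<^bsub>R\<^esub> \<phi> (r f)" if "a \<in> carrier R" "functional R M f" for a f
      proof -
        have "r (\<lambda>u. a \<otimes>\<^bsub>R\<^esub> f u) = a \<odot>\<^bsub>?D\<^esub> r f" by (auto simp: r_def intro!: restrict_ext)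
        then show ?thesis using linear_map_smult[OF \<phi> that(1) rD[OF that(2)]] by simp
      qed
    qed
    then obtain v where v: "v \<in> carrier M" "\<And>f. functional R M f \<Longrightarrow> f v = \<phi> (r f)" by blast
    have "\<phi> g = g (\<pi> v)" if g: "g \<in> carrier ?D" for g
    proof -
      have gf: "functional R N g" "g \<in> extensional (carrier N)" using g by (auto simp: carrier_dual_module mod_hom_iff)
      have "r (\<lambda>u. g (\<pi> u)) = g"
        by (rule extensionalityI[of _ "carrier N"]) (use gf ret in \<open>auto simp: r_def\<close>)
      then show ?thesis using v(2)[OF linear_map_comp[OF \<pi> gf(1)]] by simp
    qed
    then show "\<exists>v\<in>carrier N. \<forall>f\<in>carrier ?D. \<phi> f = f v"
      using linear_map_closed[OF \<pi> v(1)] by blast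
  qed
  ultimately show ?thesis using N by (simp add: Ref_obj_def)
qed

lemma linear_map_inv_into:
  assumes "module R M" and f: "linear_map R M N f" and bij: "bij_betw f (carrier M) (carrier N)"
  shows "linear_map R N M (inv_into (carrier M) f)"
proof (rule linear_mapI)
  interpret M: module R M by fact
  let ?g = "inv_into (carrier M) f"
  have g: "?g u \<in> carrier M" "f (?g u) = u" if "u \<in> carrier N" for u
    using bij that by (auto simp: bij_betw_def inv_into_into f_inv_into_f)
  have gf: "?g (f u) = u" if "u \<in> carrier M" for u
    using bij that by (simp add: bij_betw_def)
  show "?g u \<in> carrier M" if "u \<in> carrier N" for u using g that by blast
  show "?g (u \<oplus>\<^bsub>N\<^esub> v) = ?g u \<oplus>\<^bsub>M\<^esub> ?g v" if "u \<in> carrier N" "v \<in> carrier N" for u v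
    using gf[of "?g u \<oplus>\<^bsub>M\<^esub> ?g v"] linear_map_add[OF f g(1)[OF that(1)] g(1)[OF that(2)]] g[OF that(1)] g[OF that(2)] by simp
  show "?g (a \<odot>\<^bsub>N\<^esub> u) = a \<odot>\<^bsub>M\<^esub> ?g u" if "a \<in> carrier R" "u \<in> carrier N" for a u
    using gf[of "a \<odot>\<^bsub>M\<^esub> ?g u"] linear_map_smult[OF f that(1) g(1)[OF that(2)]] g[OF that(2)] that(1) by simp
qed

lemma Ref_indecomposableD:
  assumes "Ref_indecomposable R M" "submodule H R M" "submodule K R M"
    and "Ref_obj R (M\<lparr>carrier := H\<rparr>)" "Ref_obj R (M\<lparr>carrier := K\<rparr>)"
    and "H \<inter> K = {\<zero>\<^bsub>M\<^esub>}" "H <+>\<^bsub>M\<^esub> K = carrier M"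
  shows "H = {\<zero>\<^bsub>M\<^esub>} \<or> K = {\<zero>\<^bsub>M\<^esub>}"
  using assms unfolding Ref_indecomposable_def by blast

text \<open>The representatives must be indecomposable themselves, in a type other than that of
  \<open>M\<close>. A decomposition of \<open>N\<close> pulls back along \<open>f\<close>, and the
  pulled-back summands are objects because they are retracts of the given ones.\<close>

lemma Ref_indecomposable_iso:
  assumes ind: "Ref_indecomposable R M" and N: "module R N"
    and f: "linear_map R M N f" and bij: "bij_betw f (carrier M) (carrier N)"
  shows "Ref_indecomposable R N"
proof -
  let ?g = "inv_into (carrier M) f"
  have refM: "Ref_obj R M" and M: "module R M" and nz: "carrier M \<noteq> {\<zero>\<^bsub>M\<^esub>}"
    using ind by (auto simp: Ref_indecomposable_def Ref_obj_def)
  interpret M: module R M by fact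
  interpret N: module R N by fact
  have g: "linear_map R N M ?g" by (rule linear_map_inv_into[OF M f bij])
  have gc: "?g u \<in> carrier M" and fg: "f (?g u) = u" if "u \<in> carrier N" for u
    using bij that by (auto simp: bij_betw_def inv_into_into f_inv_into_f)
  have gf: "?g (f u) = u" if "u \<in> carrier M" for u
    using bij that by (simp add: bij_betw_def)
  note fc = linear_map_closed[OF f] and f0 = linear_map_zero[OF M N f]
  have refN: "Ref_obj R N" by (rule Ref_obj_retract[OF refM N g f fg])
  have nzN: "carrier N \<noteq> {\<zero>\<^bsub>N\<^esub>}"
  proof
    assume "carrier N = {\<zero>\<^bsub>N\<^esub>}"
    then have "f u = f \<zero>\<^bsub>M\<^esub>" if "u \<in> carrier M" for u using fc[OF that] f0 by simp
    then have "u = \<zero>\<^bsub>M\<^esub>" if "u \<in> carrier M" for u using gf that M.zero_closed by metis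
    then show False using nz M.zero_closed by blast
  qed
  have sub: "submodule {u \<in> carrier M. f u \<in> H} R M"
    and ref: "Ref_obj R (M\<lparr>carrier := {u \<in> carrier M. f u \<in> H}\<rparr>)"
    if H: "submodule H R N" "Ref_obj R (N\<lparr>carrier := H\<rparr>)" for H
  proof -
    note HE = N.submoduleE[OF H(1)]
    have "\<zero>\<^bsub>N\<^esub> \<in> H" using subgroup.one_closed[OF submodule.axioms(1)[OF H(1)]] by simp
    then show s: "submodule {u \<in> carrier M. f u \<in> H} R M"
      by (intro M.submoduleI)
         (auto simp: f0 linear_map_a_inv[OF M N f] linear_map_add[OF f] linear_map_smult[OF f] HE)
    show "Ref_obj R (M\<lparr>carrier := {u \<in> carrier M. f u \<in> H}\<rparr>)"
    proof (rule Ref_obj_retract[OF H(2) submodule.submodule_is_module[OF s M]])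
      show "linear_map R (M\<lparr>carrier := {u \<in> carrier M. f u \<in> H}\<rparr>) (N\<lparr>carrier := H\<rparr>) f"
        by (rule linear_mapI) (simp_all add: linear_map_add[OF f] linear_map_smult[OF f])
      show "linear_map R (N\<lparr>carrier := H\<rparr>) (M\<lparr>carrier := {u \<in> carrier M. f u \<in> H}\<rparr>) ?g"
        by (rule linear_mapI)
           (use HE(1) gc fg in \<open>auto simp: linear_map_add[OF g] linear_map_smult[OF g] subset_iff\<close>)
    qed (simp add: gf)
  qed
  show ?thesis
    unfolding Ref_indecomposable_def
  proof (intro conjI allI impI refN nzN)
    fix H K assume HK: "submodule H R N \<and> submodule K R N \<and>
      Ref_obj R (N\<lparr>carrier := H\<rparr>) \<and> Ref_obj R (N\<lparr>carrier := K\<rparr>) \<and>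
      H \<inter> K = {\<zero>\<^bsub>N\<^esub>} \<and> H <+>\<^bsub>N\<^esub> K = carrier N"
    let ?H = "{u \<in> carrier M. f u \<in> H}" and ?K = "{u \<in> carrier M. f u \<in> K}"
    note HE = N.submoduleE(1)[OF conjunct1[OF HK]] N.submoduleE(1)[OF conjunct1[OF conjunct2[OF HK]]]
    have 0: "\<zero>\<^bsub>N\<^esub> \<in> H" "\<zero>\<^bsub>N\<^esub> \<in> K" using HK by blast+
    have "u = \<zero>\<^bsub>M\<^esub>" if "u \<in> ?H \<inter> ?K" for u
    proof -
      have "f u = f \<zero>\<^bsub>M\<^esub>" using that HK f0 by auto
      then show ?thesis using gf that M.zero_closed by (metis (no_types, lifting) IntD1 mem_Collect_eq)
    qed
    then have "?H \<inter> ?K = {\<zero>\<^bsub>M\<^esub>}" using 0 f0 by auto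
    moreover have "?H <+>\<^bsub>M\<^esub> ?K = carrier M"
    proof
      show "?H <+>\<^bsub>M\<^esub> ?K \<subseteq> carrier M" by (auto simp: set_add_def')
      show "carrier M \<subseteq> ?H <+>\<^bsub>M\<^esub> ?K"
      proof
        fix u assume u: "u \<in> carrier M"
        then have "f u \<in> H <+>\<^bsub>N\<^esub> K" using HK fc by simp
        then obtain h k where hk: "h \<in> H" "k \<in> K" "f u = h \<oplus>\<^bsub>N\<^esub> k" by (auto simp: set_add_def')
        then have c: "h \<in> carrier N" "k \<in> carrier N" using HE by auto
        then have "u = ?g h \<oplus>\<^bsub>M\<^esub> ?g k" using linear_map_add[OF g c] gf[OF u] hk(3) by simp
        moreover have "?g h \<in> ?H" "?g k \<in> ?K" using hk c gc fg by auto
        ultimately show "u \<in> ?H <+>\<^bsub>M\<^esub> ?K" unfolding set_add_def' by blast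
      qed
    qed
    ultimately have "?H = {\<zero>\<^bsub>M\<^esub>} \<or> ?K = {\<zero>\<^bsub>M\<^esub>}"
      using HK by (intro Ref_indecomposableD[OF ind] sub ref) simp_all
    moreover have "H' = {\<zero>\<^bsub>N\<^esub>}" if "{u \<in> carrier M. f u \<in> H'} = {\<zero>\<^bsub>M\<^esub>}" "H' \<subseteq> carrier N" "\<zero>\<^bsub>N\<^esub> \<in> H'" for H'
    proof -
      have "h = \<zero>\<^bsub>N\<^esub>" if h: "h \<in> H'" for h
      proof -
        have c: "h \<in> carrier N" using h \<open>H' \<subseteq> carrier N\<close> by blast
        then have "?g h \<in> {u \<in> carrier M. f u \<in> H'}" using h gc fg by simp
        then have "?g h = \<zero>\<^bsub>M\<^esub>" using \<open>{u \<in> carrier M. f u \<in> H'} = {\<zero>\<^bsub>M\<^esub>}\<close> by blast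
        then show ?thesis using fg[OF c] f0 by simp
      qed
      then show ?thesis using \<open>\<zero>\<^bsub>N\<^esub> \<in> H'\<close> by blast
    qed
    ultimately show "H = {\<zero>\<^bsub>N\<^esub>} \<or> K = {\<zero>\<^bsub>N\<^esub>}" using HE 0 by blast
  qed
qed

text \<open>If \<open>f(H) = f(M)\<close> and \<open>H \<inter> ker f = 0\<close> then \<open>M = H \<oplus> ker f\<close>, so \<open>ker f = 0\<close>.\<close>

lemma Ref_indecomposable_inj:
  assumes ind: "Ref_indecomposable R M" and f: "functional R M f"
    and H: "submodule H R M" and img: "\<And>u. u \<in> carrier M \<Longrightarrow> \<exists>h\<in>H. f h = f u"
    and ker: "\<And>h. h \<in> H \<Longrightarrow> f h = \<zero>\<^bsub>R\<^esub> \<Longrightarrow> h = \<zero>\<^bsub>M\<^esub>"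
    and nz: "\<exists>u\<in>carrier M. f u \<noteq> \<zero>\<^bsub>R\<^esub>"
  shows "inj_on f (carrier M)"
proof -
  have refM: "Ref_obj R M" and M: "module R M"
    using ind by (auto simp: Ref_indecomposable_def Ref_obj_def)
  interpret M: module R M by fact
  note Reg = M.R.regular_module_module
  note HE = M.submoduleE[OF H]
  have H0: "\<zero>\<^bsub>M\<^esub> \<in> H" using subgroup.one_closed[OF submodule.axioms(1)[OF H]] by simp
  note fc = linear_map_closed[OF f, simplified] and f_add = linear_map_add[OF f, simplified]
    and f_smult = linear_map_smult[OF f, simplified]
  have diff_add: "(u \<ominus>\<^bsub>M\<^esub> v) \<oplus>\<^bsub>M\<^esub> v = u" if "u \<in> carrier M" "v \<in> carrier M" for u v
    using that by (simp add: a_minus_def M.a_assoc M.l_neg)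
  have f_diff: "f (u \<ominus>\<^bsub>M\<^esub> v) = \<zero>\<^bsub>R\<^esub> \<longleftrightarrow> f u = f v" if "u \<in> carrier M" "v \<in> carrier M" for u v
  proof -
    have "f (u \<ominus>\<^bsub>M\<^esub> v) \<oplus>\<^bsub>R\<^esub> f v = f ((u \<ominus>\<^bsub>M\<^esub> v) \<oplus>\<^bsub>M\<^esub> v)" using f_add that by simp
    also have "(u \<ominus>\<^bsub>M\<^esub> v) \<oplus>\<^bsub>M\<^esub> v = u" using that by (rule diff_add)
    finally have e: "f (u \<ominus>\<^bsub>M\<^esub> v) \<oplus>\<^bsub>R\<^esub> f v = f u" .
    show ?thesis
    proof
      assume "f (u \<ominus>\<^bsub>M\<^esub> v) = \<zero>\<^bsub>R\<^esub>"
      then show "f u = f v" using e fc that by simp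
    next
      assume "f u = f v"
      then have "f (u \<ominus>\<^bsub>M\<^esub> v) \<oplus>\<^bsub>R\<^esub> f v = \<zero>\<^bsub>R\<^esub> \<oplus>\<^bsub>R\<^esub> f v" using e fc[OF that(2)] by simp
      then show "f (u \<ominus>\<^bsub>M\<^esub> v) = \<zero>\<^bsub>R\<^esub>"
        using M.R.add.right_cancel[of "f v" "f (u \<ominus>\<^bsub>M\<^esub> v)" "\<zero>\<^bsub>R\<^esub>"] fc that M.minus_closed by simp
    qed
  qed
  define K where "K = {u \<in> carrier M. f u = \<zero>\<^bsub>R\<^esub>}"
  have f0: "f \<zero>\<^bsub>M\<^esub> = \<zero>\<^bsub>R\<^esub>" using linear_map_zero[OF M Reg f] by simp
  have K: "submodule K R M"
  proof (rule M.submoduleI)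
    show "\<ominus>\<^bsub>M\<^esub> u \<in> K" if "u \<in> K" for u
    proof -
      have "\<ominus>\<^bsub>M\<^esub> u = (\<ominus>\<^bsub>R\<^esub> \<one>\<^bsub>R\<^esub>) \<odot>\<^bsub>M\<^esub> u" using M.smult_l_minus[of "\<one>\<^bsub>R\<^esub>" u] that by (simp add: K_def)
      then show ?thesis using that f_smult[of "\<ominus>\<^bsub>R\<^esub> \<one>\<^bsub>R\<^esub>" u] by (simp add: K_def)
    qed
  qed (auto simp: K_def f0 f_add f_smult)
  have uniq: "h = h'" if "h \<in> H" "h' \<in> H" "f h = f h'" for h h'
  proof -
    have c: "h \<in> carrier M" "h' \<in> carrier M" using that HE(1) by auto
    have "h \<ominus>\<^bsub>M\<^esub> h' \<in> H" unfolding a_minus_def using that HE by blast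
    moreover have "f (h \<ominus>\<^bsub>M\<^esub> h') = \<zero>\<^bsub>R\<^esub>" using f_diff[OF c] that(3) by simp
    ultimately have "h \<ominus>\<^bsub>M\<^esub> h' = \<zero>\<^bsub>M\<^esub>" by (rule ker)
    then show ?thesis using diff_add[OF c] c by simp
  qed
  \<comment> \<open>The projection onto \<open>H\<close> along the kernel of \<open>f\<close>. An
    element of \<open>H\<close> is determined by its value under \<open>f\<close>, so the choice is
    linear; \<open>u - \<pi> u\<close> is the projection onto the kernel.\<close>
  define \<pi> where "\<pi> = (\<lambda>u. SOME h. h \<in> H \<and> f h = f u)"
  have \<pi>: "\<pi> u \<in> H" "f (\<pi> u) = f u" if "u \<in> carrier M" for u
    using someI_ex[of "\<lambda>h. h \<in> H \<and> f h = f u"] img[OF that] by (auto simp: \<pi>_def)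
  have \<pi>c: "\<pi> u \<in> carrier M" if "u \<in> carrier M" for u using \<pi>(1)[OF that] HE(1) by blast
  have \<pi>_add: "\<pi> (u \<oplus>\<^bsub>M\<^esub> v) = \<pi> u \<oplus>\<^bsub>M\<^esub> \<pi> v" if "u \<in> carrier M" "v \<in> carrier M" for u v
    by (rule uniq) (use that HE(5) in \<open>simp_all add: \<pi> \<pi>c f_add\<close>)
  have \<pi>_smult: "\<pi> (a \<odot>\<^bsub>M\<^esub> u) = a \<odot>\<^bsub>M\<^esub> \<pi> u" if "a \<in> carrier R" "u \<in> carrier M" for a u
    by (rule uniq) (use that HE(4) in \<open>simp_all add: \<pi> \<pi>c f_smult\<close>)
  have "Ref_obj R (M\<lparr>carrier := H\<rparr>)"
  proof (rule Ref_obj_retract[OF refM submodule.submodule_is_module[OF H M], of "\<lambda>u. u" \<pi>])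
    show "linear_map R (M\<lparr>carrier := H\<rparr>) M (\<lambda>u. u)"
      by (rule linear_mapI) (use HE(1) in auto)
    show "linear_map R M (M\<lparr>carrier := H\<rparr>) \<pi>"
      by (rule linear_mapI) (simp_all add: \<pi> \<pi>_add \<pi>_smult)
    show "\<pi> u = u" if "u \<in> carrier (M\<lparr>carrier := H\<rparr>)" for u
      by (rule uniq) (use that HE(1) in \<open>auto simp: \<pi> subset_iff\<close>)
  qed
  moreover have "Ref_obj R (M\<lparr>carrier := K\<rparr>)"
  proof (rule Ref_obj_retract[OF refM submodule.submodule_is_module[OF K M], of "\<lambda>u. u" "\<lambda>u. u \<ominus>\<^bsub>M\<^esub> \<pi> u"])
    show "linear_map R (M\<lparr>carrier := K\<rparr>) M (\<lambda>u. u)"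
      by (rule linear_mapI) (auto simp: K_def)
    show "linear_map R M (M\<lparr>carrier := K\<rparr>) (\<lambda>u. u \<ominus>\<^bsub>M\<^esub> \<pi> u)"
    proof (rule linear_mapI)
      show "u \<ominus>\<^bsub>M\<^esub> \<pi> u \<in> carrier (M\<lparr>carrier := K\<rparr>)" if "u \<in> carrier M" for u
        using that \<pi>c[OF that] f_diff[OF that \<pi>c[OF that]] \<pi>(2)[OF that] by (simp add: K_def)
      show "(u \<oplus>\<^bsub>M\<^esub> v) \<ominus>\<^bsub>M\<^esub> \<pi> (u \<oplus>\<^bsub>M\<^esub> v) = (u \<ominus>\<^bsub>M\<^esub> \<pi> u) \<oplus>\<^bsub>M\<lparr>carrier := K\<rparr>\<^esub> (v \<ominus>\<^bsub>M\<^esub> \<pi> v)"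
        if "u \<in> carrier M" "v \<in> carrier M" for u v
        using that \<pi>c by (simp add: \<pi>_add a_minus_def M.minus_add M.a_ac)
      show "(a \<odot>\<^bsub>M\<^esub> u) \<ominus>\<^bsub>M\<^esub> \<pi> (a \<odot>\<^bsub>M\<^esub> u) = a \<odot>\<^bsub>M\<lparr>carrier := K\<rparr>\<^esub> (u \<ominus>\<^bsub>M\<^esub> \<pi> u)"
        if "a \<in> carrier R" "u \<in> carrier M" for a u
        using that \<pi>c by (simp add: \<pi>_smult a_minus_def M.smult_r_distr M.smult_r_minus)
    qed
    show "u \<ominus>\<^bsub>M\<^esub> \<pi> u = u" if "u \<in> carrier (M\<lparr>carrier := K\<rparr>)" for u
    proof -
      have u: "u \<in> carrier M" "f u = \<zero>\<^bsub>R\<^esub>" using that by (auto simp: K_def)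
      then have "\<pi> u = \<zero>\<^bsub>M\<^esub>" using ker \<pi> by simp
      then show ?thesis using u by (simp add: a_minus_def)
    qed
  qed
  moreover have "H \<inter> K = {\<zero>\<^bsub>M\<^esub>}"
  proof (intro equalityI subsetI)
    show "h \<in> {\<zero>\<^bsub>M\<^esub>}" if "h \<in> H \<inter> K" for h using ker[of h] that by (simp add: K_def)
    show "h \<in> H \<inter> K" if "h \<in> {\<zero>\<^bsub>M\<^esub>}" for h using that H0 f0 by (simp add: K_def)
  qed
  moreover have "H <+>\<^bsub>M\<^esub> K = carrier M"
  proof
    have "h \<oplus>\<^bsub>M\<^esub> k \<in> carrier M" if "h \<in> H" "k \<in> K" for h k
      using that HE(1) by (intro M.a_closed) (auto simp: K_def)
    then show "H <+>\<^bsub>M\<^esub> K \<subseteq> carrier M" unfolding set_add_def' by blast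
    show "carrier M \<subseteq> H <+>\<^bsub>M\<^esub> K"
    proof
      fix u assume u: "u \<in> carrier M"
      have "u \<ominus>\<^bsub>M\<^esub> \<pi> u \<in> K" using u \<pi>c[OF u] f_diff[OF u \<pi>c[OF u]] \<pi>(2)[OF u] by (simp add: K_def)
      moreover have "u = \<pi> u \<oplus>\<^bsub>M\<^esub> (u \<ominus>\<^bsub>M\<^esub> \<pi> u)"
        using u \<pi>c[OF u] by (simp add: a_minus_def M.a_lcomm M.r_neg)
      ultimately show "u \<in> H <+>\<^bsub>M\<^esub> K" using \<pi>(1)[OF u] unfolding set_add_def' by blast
    qed
  qed
  ultimately have "H = {\<zero>\<^bsub>M\<^esub>} \<or> K = {\<zero>\<^bsub>M\<^esub>}"
    by (rule Ref_indecomposableD[OF ind H K])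
  moreover have "H \<noteq> {\<zero>\<^bsub>M\<^esub>}"
  proof
    assume H: "H = {\<zero>\<^bsub>M\<^esub>}"
    obtain u where "u \<in> carrier M" "f u \<noteq> \<zero>\<^bsub>R\<^esub>" using nz by blast
    then show False using img[of u] f0 H by simp
  qed
  ultimately have K0: "K = {\<zero>\<^bsub>M\<^esub>}" by blast
  show ?thesis
  proof (rule inj_onI)
    fix u v assume uv: "u \<in> carrier M" "v \<in> carrier M" "f u = f v"
    then have "u \<ominus>\<^bsub>M\<^esub> v \<in> K" using f_diff by (simp add: K_def)
    then show "u = v" using diff_add[OF uv(1,2)] K0 uv by simp
  qed
qed

text \<open>A copy of an ideal in the type of the representatives, embedded by \<open>a \<mapsto> {\<lambda>_. a}\<close>.\<close>

definition ideal_copy :: "('a, 'r) ring_scheme \<Rightarrow> 'a set \<Rightarrow> ('a, (nat \<Rightarrow> 'a) set) module"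
  where "ideal_copy R J = \<lparr>carrier = (\<lambda>a. {\<lambda>_. a}) ` J, monoid.mult = undefined, one = undefined,
    ring.zero = {\<lambda>_. \<zero>\<^bsub>R\<^esub>},
    ring.add = (\<lambda>A B. {\<lambda>_. the_elem A 0 \<oplus>\<^bsub>R\<^esub> the_elem B 0}),
    smult = (\<lambda>r A. {\<lambda>_. r \<otimes>\<^bsub>R\<^esub> the_elem A 0})\<rparr>"

lemma (in cring) ideal_copy_module:
  assumes "ideal J R"
  shows "module R (ideal_copy R J)"
proof -
  interpret J: ideal J R by fact
  note c = J.Icarr
  show ?thesis
  proof (rule moduleI[OF is_cring])
    show "abelian_group (ideal_copy R J)"
    proof (rule abelian_groupI)
      fix A assume "A \<in> carrier (ideal_copy R J)"
      then obtain a where a: "a \<in> J" "A = {\<lambda>_. a}" by (auto simp: ideal_copy_def)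
      have "{\<lambda>_. \<ominus> a} \<in> carrier (ideal_copy R J)" using a by (auto simp: ideal_copy_def)
      moreover have "{\<lambda>_. \<ominus> a} \<oplus>\<^bsub>ideal_copy R J\<^esub> A = \<zero>\<^bsub>ideal_copy R J\<^esub>"
        using a c by (simp add: ideal_copy_def l_neg)
      ultimately show "\<exists>B\<in>carrier (ideal_copy R J). B \<oplus>\<^bsub>ideal_copy R J\<^esub> A = \<zero>\<^bsub>ideal_copy R J\<^esub>" by blast
    qed (auto simp: ideal_copy_def c a_ac)
  qed (auto simp: ideal_copy_def c l_distr r_distr m_assoc J.I_l_closed)
qed

lemma linear_map_ideal_copy:
  assumes "functional R M f" "f ` carrier M = J" "inj_on f (carrier M)"
  shows "linear_map R M (ideal_copy R J) (\<lambda>u. {\<lambda>_. f u})"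
    and "bij_betw (\<lambda>u. {\<lambda>_. f u}) (carrier M) (carrier (ideal_copy R J))"
proof -
  show "linear_map R M (ideal_copy R J) (\<lambda>u. {\<lambda>_. f u})"
    using assms(2) linear_map_add[OF assms(1)] linear_map_smult[OF assms(1)]
    by (intro linear_mapI) (auto simp: ideal_copy_def)
  show "bij_betw (\<lambda>u. {\<lambda>_. f u}) (carrier M) (carrier (ideal_copy R J))"
    using assms(2,3) by (auto simp: bij_betw_def inj_on_def ideal_copy_def fun_eq_iff)
qed

section \<open>Indecomposable reflexive modules\<close>

text \<open>Generators of \<open>M\<close> modulo \<open>N\<close> are discarded one at a time. If
  \<open>a = n + p w\<close> and \<open>w = h + r a\<close> with \<open>n\<close> and
  \<open>h\<close> in \<open>H\<close>, then \<open>(1 - p r) a\<close> lies in \<open>H\<close>,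
  and \<open>1 - p r\<close> is a unit because \<open>p\<close> is in \<open>\<mm>\<close>.\<close>

lemma (in reduced_local_dim_one) nakayama:
  assumes M: "module R M" and fg: "fin_gen_module R M" and N: "submodule N R M" and p: "p \<in> \<mm>"
    and cover: "\<And>v. v \<in> carrier M \<Longrightarrow> \<exists>n\<in>N. \<exists>w\<in>carrier M. v = n \<oplus>\<^bsub>M\<^esub> p \<odot>\<^bsub>M\<^esub> w"
  shows "N = carrier M"
proof -
  interpret M: module R M by fact
  note pc = m_carrier[OF p]
  obtain A where A: "A \<subseteq> carrier M" "finite A"
    and gen: "\<And>H. submodule H R M \<Longrightarrow> A \<subseteq> H \<Longrightarrow> H = carrier M"
    using fg unfolding fin_gen_module_def by blast
  have "(\<forall>H. submodule H R M \<and> N \<subseteq> H \<and> A \<subseteq> H \<longrightarrow> H = carrier M) \<Longrightarrow>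
      (\<forall>H. submodule H R M \<and> N \<subseteq> H \<longrightarrow> H = carrier M)"
    using A(2,1)
  proof (induction A)
    case (insert a B)
    then have a: "a \<in> carrier M" by blast
    have "H = carrier M" if H: "submodule H R M" "N \<subseteq> H" "B \<subseteq> H" for H
    proof -
      note HE = M.submoduleE[OF H(1)]
      have H0: "\<zero>\<^bsub>M\<^esub> \<in> H" using subgroup.one_closed[OF submodule.axioms(1)[OF H(1)]] by simp
      \<comment> \<open>This is \<open>H + Ra\<close>. It contains \<open>N\<close>,
        \<open>B\<close> and \<open>a\<close>, so by assumption it is all of \<open>M\<close>, which
        supplies the expression for \<open>w\<close>.\<close>
      let ?H' = "{v \<in> carrier M. \<exists>h\<in>H. \<exists>r\<in>carrier R. v = h \<oplus>\<^bsub>M\<^esub> r \<odot>\<^bsub>M\<^esub> a}"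
      have mem: "h \<oplus>\<^bsub>M\<^esub> r \<odot>\<^bsub>M\<^esub> a \<in> ?H'" if "h \<in> H" "r \<in> carrier R" for h r
        using that HE(1) a by auto
      have "submodule ?H' R M"
      proof (rule M.submoduleI)
        show "\<zero>\<^bsub>M\<^esub> \<in> ?H'" using mem[OF H0, of \<zero>] a by simp
        fix v assume "v \<in> ?H'"
        then obtain h r where v: "v = h \<oplus>\<^bsub>M\<^esub> r \<odot>\<^bsub>M\<^esub> a" and hr: "h \<in> H" "r \<in> carrier R" by auto
        then have hc: "h \<in> carrier M" using HE(1) by blast
        show sm: "b \<odot>\<^bsub>M\<^esub> v \<in> ?H'" if b: "b \<in> carrier R" for b
        proof -
          have "b \<odot>\<^bsub>M\<^esub> v = (b \<odot>\<^bsub>M\<^esub> h) \<oplus>\<^bsub>M\<^esub> (b \<otimes> r) \<odot>\<^bsub>M\<^esub> a"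
            unfolding v using b hr hc a by (simp add: M.smult_r_distr M.smult_assoc1)
          then show ?thesis using mem[of "b \<odot>\<^bsub>M\<^esub> h" "b \<otimes> r"] HE(4) b hr by simp
        qed
        have "v \<in> carrier M" unfolding v using hc hr a by simp
        then have "\<ominus>\<^bsub>M\<^esub> v = (\<ominus> \<one>) \<odot>\<^bsub>M\<^esub> v" using M.smult_l_minus[of \<one> v] by simp
        then show "\<ominus>\<^bsub>M\<^esub> v \<in> ?H'" using sm[of "\<ominus> \<one>"] by simp
        fix w assume "w \<in> ?H'"
        then obtain h' r' where w: "w = h' \<oplus>\<^bsub>M\<^esub> r' \<odot>\<^bsub>M\<^esub> a" and hr': "h' \<in> H" "r' \<in> carrier R" by auto
        then have hc': "h' \<in> carrier M" using HE(1) by blast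
        have "v \<oplus>\<^bsub>M\<^esub> w = (h \<oplus>\<^bsub>M\<^esub> h') \<oplus>\<^bsub>M\<^esub> (r \<oplus> r') \<odot>\<^bsub>M\<^esub> a"
          unfolding v w using hr hr' hc hc' a by (simp add: M.smult_l_distr M.a_ac)
        then show "v \<oplus>\<^bsub>M\<^esub> w \<in> ?H'" using mem[of "h \<oplus>\<^bsub>M\<^esub> h'" "r \<oplus> r'"] HE(5) hr hr' by simp
      qed auto
      moreover have "H \<subseteq> ?H'"
      proof
        fix h assume "h \<in> H"
        then show "h \<in> ?H'" using mem[of h \<zero>] a HE(1) by (auto simp: subset_iff)
      qed
      moreover have "a \<in> ?H'" using mem[OF H0, of \<one>] a by simp
      ultimately have H': "?H' = carrier M" using insert.prems(1) H by blast
      obtain n w where nw: "n \<in> N" "w \<in> carrier M" "a = n \<oplus>\<^bsub>M\<^esub> p \<odot>\<^bsub>M\<^esub> w" using cover[OF a] by blast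
      obtain h r where hr: "h \<in> H" "r \<in> carrier R" "w = h \<oplus>\<^bsub>M\<^esub> r \<odot>\<^bsub>M\<^esub> a" using H' nw(2) by blast
      have c: "n \<in> carrier M" "h \<in> carrier M" "n \<in> H" using nw(1) hr(1) H(2) HE(1) by auto
      define y where "y = n \<oplus>\<^bsub>M\<^esub> p \<odot>\<^bsub>M\<^esub> h"
      have y: "y \<in> H" "y \<in> carrier M" unfolding y_def using c hr HE pc by auto
      have ay: "a = y \<oplus>\<^bsub>M\<^esub> (p \<otimes> r) \<odot>\<^bsub>M\<^esub> a"
        using nw(3) hr c a pc by (simp add: y_def M.smult_r_distr M.smult_assoc1 M.a_assoc)
      have "(\<one> \<ominus> p \<otimes> r) \<odot>\<^bsub>M\<^esub> a = a \<oplus>\<^bsub>M\<^esub> \<ominus>\<^bsub>M\<^esub> ((p \<otimes> r) \<odot>\<^bsub>M\<^esub> a)"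
        using hr a pc by (simp add: a_minus_def M.smult_l_distr M.smult_l_minus)
      also have "\<dots> = y"
      proof -
        define z where "z = (p \<otimes> r) \<odot>\<^bsub>M\<^esub> a"
        have zc: "z \<in> carrier M" using hr a pc by (simp add: z_def)
        have "a \<oplus>\<^bsub>M\<^esub> \<ominus>\<^bsub>M\<^esub> z = (y \<oplus>\<^bsub>M\<^esub> z) \<oplus>\<^bsub>M\<^esub> \<ominus>\<^bsub>M\<^esub> z" using ay by (simp add: z_def)
        then show ?thesis using y(2) zc by (simp add: M.a_assoc M.r_neg z_def)
      qed
      finally have e: "(\<one> \<ominus> p \<otimes> r) \<odot>\<^bsub>M\<^esub> a = y" .
      have u: "\<one> \<ominus> p \<otimes> r \<in> Units R" using one_minus_unit max.I_r_closed p hr(2) by blast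
      have "a = (inv (\<one> \<ominus> p \<otimes> r) \<otimes> (\<one> \<ominus> p \<otimes> r)) \<odot>\<^bsub>M\<^esub> a" using u a by simp
      also have "\<dots> = inv (\<one> \<ominus> p \<otimes> r) \<odot>\<^bsub>M\<^esub> y"
        unfolding e[symmetric] by (rule M.smult_assoc1) (use u a pc hr in simp_all)
      finally have "a \<in> H" using HE(4)[OF Units_inv_closed[OF u] y(1)] by simp
      then show ?thesis using insert.prems(1) H by blast
    qed
    then show ?case using insert.IH insert.prems(2) by blast
  qed blast
  then show ?thesis using gen N by blast
qed

text \<open>For \<open>M\<close> without free summand all functionals take values in \<open>\<mm>\<close>, hence the dual of \<open>M\<close>, and
  by reflexivity \<open>M\<close> itself, is a module over \<open>E\<close>.\<close>

locale m_valued_module = seminormal_dim_one +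
  fixes M
  assumes module: "module R M"
    and reflexive: "reflexive_module R M"
    and finitely_generated: "fin_gen_module R M"
    and m_valued: "\<And>f u. functional R M f \<Longrightarrow> u \<in> carrier M \<Longrightarrow> f u \<in> \<mm>"
begin

sublocale M: module R M
  by (rule module)

abbreviation F where "F f \<equiv> functional R M f"

lemma F_carrier: "F f \<Longrightarrow> u \<in> carrier M \<Longrightarrow> f u \<in> carrier R"
  using m_valued m_carrier by blast

lemma F_add: "F f \<Longrightarrow> u \<in> carrier M \<Longrightarrow> v \<in> carrier M \<Longrightarrow> f (u \<oplus>\<^bsub>M\<^esub> v) = f u \<oplus> f v"
  using linear_map_add[of R M "regular_module R" f] by simp

lemma F_smult: "F f \<Longrightarrow> a \<in> carrier R \<Longrightarrow> u \<in> carrier M \<Longrightarrow> f (a \<odot>\<^bsub>M\<^esub> u) = a \<otimes> f u"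
  using linear_map_smult[of R M "regular_module R" f] by simp

lemma F_zero: "F f \<Longrightarrow> f \<zero>\<^bsub>M\<^esub> = \<zero>"
  using linear_map_zero[OF module regular_module_module, of f] by simp

lemma M_eqI:
  assumes "u \<in> carrier M" "v \<in> carrier M" "\<And>f. F f \<Longrightarrow> f u = f v"
  shows "u = v"
  using reflexive_separates[OF module reflexive] assms by blast

lemma torsion_free:
  assumes "u \<in> carrier M" "v \<in> carrier M" "x \<odot>\<^bsub>M\<^esub> u = x \<odot>\<^bsub>M\<^esub> v"
  shows "u = v"
proof (rule M_eqI[OF assms(1,2)])
  fix f assume f: "F f"
  have "x \<otimes> f u = x \<otimes> f v"
    using F_smult[OF f x_carrier assms(1)] F_smult[OF f x_carrier assms(2)] assms(3) by simp
  then show "f u = f v" using F_carrier[OF f assms(1)] F_carrier[OF f assms(2)] by (rule x_cancel)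
qed

text \<open>Division by \<open>x\<close> is detected on functionals:
  \<open>f \<mapsto> f(u)/x\<close> is a well-defined linear map on the dual because
  \<open>x\<close> is a nonzerodivisor, and reflexivity represents it by an element of
  \<open>M\<close>.\<close>

lemma ex_quotient:
  assumes u: "u \<in> carrier M" and dvd: "\<And>f. F f \<Longrightarrow> \<exists>r\<in>carrier R. f u = x \<otimes> r"
  shows "\<exists>w\<in>carrier M. u = x \<odot>\<^bsub>M\<^esub> w"
proof -
  define \<phi> where "\<phi> = (\<lambda>f. SOME r. r \<in> carrier R \<and> f u = x \<otimes> r)"
  have \<phi>: "\<phi> f \<in> carrier R" "f u = x \<otimes> \<phi> f" if "F f" for f
    using someI_ex[of "\<lambda>r. r \<in> carrier R \<and> f u = x \<otimes> r"] dvd[OF that] by (auto simp: \<phi>_def)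
  have "\<exists>v\<in>carrier M. \<forall>f. F f \<longrightarrow> f v = \<phi> f"
  proof (rule reflexive_represents[OF module reflexive])
    show "\<phi> f \<in> carrier R" if "F f" for f using \<phi> that by blast
    show "\<phi> f = \<phi> g" if "\<And>v. v \<in> carrier M \<Longrightarrow> f v = g v" for f g
      using that[OF u] by (simp add: \<phi>_def)
    show "\<phi> (\<lambda>u. f u \<oplus> g u) = \<phi> f \<oplus> \<phi> g" if f: "F f" and g: "F g" for f g
    proof (rule x_cancel)
      show "x \<otimes> \<phi> (\<lambda>u. f u \<oplus> g u) = x \<otimes> (\<phi> f \<oplus> \<phi> g)"
        using \<phi>(1)[OF f] \<phi>(1)[OF g]
        by (simp add: r_distr flip: \<phi>(2)[OF f] \<phi>(2)[OF g] \<phi>(2)[OF functional_add[OF f g]])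
    qed (use \<phi>(1) f g functional_add[OF f g] in simp_all)
    show "\<phi> (\<lambda>u. a \<otimes> f u) = a \<otimes> \<phi> f" if a: "a \<in> carrier R" and f: "F f" for a f
    proof (rule x_cancel)
      show "x \<otimes> \<phi> (\<lambda>u. a \<otimes> f u) = x \<otimes> (a \<otimes> \<phi> f)"
        using \<phi>(1)[OF f] a
        by (simp add: m_lcomm[of x a] flip: \<phi>(2)[OF f] \<phi>(2)[OF functional_smult[OF a f]])
    qed (use \<phi>(1) a f functional_smult[OF a f] in simp_all)
  qed
  then obtain w where w: "w \<in> carrier M" "\<And>f. F f \<Longrightarrow> f w = \<phi> f" by blast
  have "u = x \<odot>\<^bsub>M\<^esub> w"
    by (rule M_eqI) (use u w(1) in \<open>simp_all add: F_smult w(2) \<phi>(2)\<close>)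
  then show ?thesis using w by blast
qed

lemma F_E:
  assumes s: "s \<in> carrier E" and f: "F f"
  shows "F (\<lambda>u. s (f u))"
  by (rule linear_mapI)
     (simp_all add: E_carrier[OF s] m_valued[OF f] F_add[OF f] F_smult[OF f] E_add[OF s] E_smult[OF s])

text \<open>The action of \<open>E\<close> on the bidual carried back to \<open>M\<close>.
  Functionals separate points of \<open>M\<close>, so the chosen element is unique and identities
  for \<open>act\<close> are checked after applying a functional.\<close>

definition act :: "('a \<Rightarrow> 'a) \<Rightarrow> 'c \<Rightarrow> 'c"
  where "act s u = (SOME w. w \<in> carrier M \<and> (\<forall>f. F f \<longrightarrow> f w = s (f u)))"

lemma
  assumes s: "s \<in> carrier E" and u: "u \<in> carrier M"
  shows act_closed: "act s u \<in> carrier M" and act_apply: "F f \<Longrightarrow> f (act s u) = s (f u)"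
proof -
  have "\<exists>w\<in>carrier M. \<forall>f. F f \<longrightarrow> f w = s (f u)"
    by (rule reflexive_represents[OF module reflexive])
       (use u in \<open>simp_all add: E_carrier[OF s] m_valued E_add[OF s] E_smult[OF s]\<close>)
  then have "act s u \<in> carrier M \<and> (\<forall>f. F f \<longrightarrow> f (act s u) = s (f u))"
    unfolding act_def by (intro someI_ex[where P = "\<lambda>w. w \<in> carrier M \<and> (\<forall>f. F f \<longrightarrow> f w = s (f u))"]) blast
  then show "act s u \<in> carrier M" "F f \<Longrightarrow> f (act s u) = s (f u)" by blast+
qed

lemma act_add:
  assumes s: "s \<in> carrier E" and u: "u \<in> carrier M" and v: "v \<in> carrier M"
  shows "act s (u \<oplus>\<^bsub>M\<^esub> v) = act s u \<oplus>\<^bsub>M\<^esub> act s v"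
  by (rule M_eqI)
     (simp_all add: u v act_closed[OF s] act_apply[OF s] F_add E_add[OF s] m_valued)

lemma act_smult:
  assumes s: "s \<in> carrier E" and a: "a \<in> carrier R" and u: "u \<in> carrier M"
  shows "act s (a \<odot>\<^bsub>M\<^esub> u) = a \<odot>\<^bsub>M\<^esub> act s u"
  by (rule M_eqI)
     (simp_all add: a u act_closed[OF s] act_apply[OF s] F_smult E_smult[OF s] m_valued)

lemma act_split:
  assumes s: "s \<in> carrier E" and u: "u \<in> carrier M"
  shows "u = act s u \<oplus>\<^bsub>M\<^esub> act (\<one>\<^bsub>E\<^esub> \<ominus>\<^bsub>E\<^esub> s) u"
proof (rule M_eqI[OF u])
  have t: "\<one>\<^bsub>E\<^esub> \<ominus>\<^bsub>E\<^esub> s \<in> carrier E" using s by simp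
  show "act s u \<oplus>\<^bsub>M\<^esub> act (\<one>\<^bsub>E\<^esub> \<ominus>\<^bsub>E\<^esub> s) u \<in> carrier M" using act_closed[OF s u] act_closed[OF t u] by simp
  fix f assume f: "F f"
  have m: "f u \<in> \<mm>" by (rule m_valued[OF f u])
  have "s (f u) \<oplus> (f u \<ominus> s (f u)) = f u" using E_carrier[OF s m] m_carrier[OF m] by algebra
  then show "f u = f (act s u \<oplus>\<^bsub>M\<^esub> act (\<one>\<^bsub>E\<^esub> \<ominus>\<^bsub>E\<^esub> s) u)"
    using F_add[OF f act_closed[OF s u] act_closed[OF t u]] act_apply[OF s u f] act_apply[OF t u f]
      E_minus_apply[OF E.one_closed s m] m by simp
qed

text \<open>\<open>C\<close> is \<open>x\<close> times the module \<open>M : \<mm>\<close>.  A functional maps \<open>M : \<mm>\<close> into \<open>E\<close>; the values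
  form the set \<open>B\<close>.\<close>

definition C :: "'c set"
  where "C = {v \<in> carrier M. \<forall>p\<in>\<mm>. \<exists>w\<in>carrier M. p \<odot>\<^bsub>M\<^esub> v = x \<odot>\<^bsub>M\<^esub> w}"

definition B :: "('a \<Rightarrow> 'a) set"
  where "B = {s \<in> carrier E. \<exists>f. F f \<and> (\<exists>v\<in>C. s x = f v)}"

lemma C_carrier: "v \<in> C \<Longrightarrow> v \<in> carrier M"
  by (simp add: C_def)

lemma C_add:
  assumes u: "u \<in> C" and v: "v \<in> C"
  shows "u \<oplus>\<^bsub>M\<^esub> v \<in> C"
proof -
  have "\<exists>w\<in>carrier M. p \<odot>\<^bsub>M\<^esub> (u \<oplus>\<^bsub>M\<^esub> v) = x \<odot>\<^bsub>M\<^esub> w" if p: "p \<in> \<mm>" for p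
  proof -
    obtain w w' where w: "w \<in> carrier M" "p \<odot>\<^bsub>M\<^esub> u = x \<odot>\<^bsub>M\<^esub> w"
      "w' \<in> carrier M" "p \<odot>\<^bsub>M\<^esub> v = x \<odot>\<^bsub>M\<^esub> w'" using u v p unfolding C_def by blast
    then have "p \<odot>\<^bsub>M\<^esub> (u \<oplus>\<^bsub>M\<^esub> v) = x \<odot>\<^bsub>M\<^esub> (w \<oplus>\<^bsub>M\<^esub> w')"
      using u v m_carrier[OF p] by (simp add: C_carrier M.smult_r_distr)
    then show ?thesis using w by blast
  qed
  then show ?thesis using u v by (simp add: C_def)
qed

lemma C_act:
  assumes s: "s \<in> carrier E" and v: "v \<in> C"
  shows "act s v \<in> C"
proof -
  note vc = C_carrier[OF v]
  have "\<exists>w\<in>carrier M. p \<odot>\<^bsub>M\<^esub> act s v = x \<odot>\<^bsub>M\<^esub> w" if p: "p \<in> \<mm>" for p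
  proof -
    obtain w where w: "w \<in> carrier M" "p \<odot>\<^bsub>M\<^esub> v = x \<odot>\<^bsub>M\<^esub> w" using v p unfolding C_def by blast
    have "p \<odot>\<^bsub>M\<^esub> act s v = x \<odot>\<^bsub>M\<^esub> act s w"
      using act_smult[OF s m_carrier[OF p] vc] act_smult[OF s x_carrier w(1)] w(2) by simp
    then show ?thesis using act_closed[OF s w(1)] by blast
  qed
  then show ?thesis using act_closed[OF s vc] by (simp add: C_def)
qed

text \<open>Think of \<open>v\<close> as \<open>x c\<close> with \<open>c\<close> in
  \<open>M : \<mm>\<close>. The required \<open>s\<close> is \<open>p \<mapsto> f(pc)\<close>, where
  \<open>pc\<close> is the element \<open>g p\<close> with \<open>x (g p) = p v\<close>. It maps
  into \<open>\<mm>\<close> because every functional on \<open>M\<close> does.\<close>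

lemma C_value:
  assumes f: "F f" and v: "v \<in> C"
  obtains s where "s \<in> carrier E" "s x = f v"
proof -
  note vc = C_carrier[OF v]
  define g where "g = (\<lambda>p. SOME w. w \<in> carrier M \<and> p \<odot>\<^bsub>M\<^esub> v = x \<odot>\<^bsub>M\<^esub> w)"
  have g: "g p \<in> carrier M" "p \<odot>\<^bsub>M\<^esub> v = x \<odot>\<^bsub>M\<^esub> g p" if "p \<in> \<mm>" for p
    using someI_ex[of "\<lambda>w. w \<in> carrier M \<and> p \<odot>\<^bsub>M\<^esub> v = x \<odot>\<^bsub>M\<^esub> w"] v that
    unfolding C_def g_def by blast+
  have xg: "x \<otimes> f (g p) = p \<otimes> f v" if p: "p \<in> \<mm>" for p
    using F_smult[OF f x_carrier g(1)[OF p]] F_smult[OF f m_carrier[OF p] vc] g(2)[OF p] by simp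
  define s where "s = (\<lambda>p\<in>\<mm>. f (g p))"
  note fv = F_carrier[OF f vc]
  have fg: "f (g p) \<in> carrier R" if "p \<in> \<mm>" for p using F_carrier[OF f g(1)[OF that]] .
  have "s \<in> carrier E"
  proof (rule EI)
    show "s \<in> extensional \<mm>" by (simp add: s_def)
    show "s p \<in> \<mm>" if "p \<in> \<mm>" for p using m_valued[OF f g(1)[OF that]] that by (simp add: s_def)
    fix p q assume p: "p \<in> \<mm>" and q: "q \<in> \<mm>"
    note c = m_carrier[OF p] m_carrier[OF q] fg[OF p] fg[OF q] fv
    have "x \<otimes> (p \<otimes> f (g q)) = p \<otimes> (x \<otimes> f (g q))" using c by (simp add: m_lcomm)
    also have "\<dots> = (p \<otimes> f v) \<otimes> q" unfolding xg[OF q] using c by (simp add: m_ac)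
    also have "\<dots> = x \<otimes> (f (g p) \<otimes> q)" unfolding xg[OF p, symmetric] using c by (simp add: m_assoc)
    finally have "p \<otimes> f (g q) = f (g p) \<otimes> q" by (rule x_cancel) (use c in simp_all)
    then show "p \<otimes> s q = s p \<otimes> q" using p q by (simp add: s_def)
  qed
  moreover have "f (g x) = f v" by (rule x_cancel[OF xg[OF x_m] fg[OF x_m] fv])
  then have "s x = f v" using x_m by (simp add: s_def)
  ultimately show thesis by (rule that)
qed

lemma BI: "s \<in> carrier E \<Longrightarrow> F f \<Longrightarrow> v \<in> C \<Longrightarrow> s x = f v \<Longrightarrow> s \<in> B"
  by (auto simp: B_def)

text \<open>The point is that values are closed under \<open>e + (1 - e) b\<close> modulo
  \<open>\<mm>\<close>. With \<open>t = 1 - e\<close>, the functional \<open>e h + t h'\<close> at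
  \<open>e c + t c'\<close> has the value \<open>e (e e + t a) + t (e a' + t b)\<close>, where
  \<open>a\<close> and \<open>a'\<close> are the cross values \<open>h(c')\<close> and
  \<open>h'(c)\<close>. These drop out modulo \<open>\<mm>\<close> because \<open>e t\<close>
  does.\<close>

lemma ex_dominating_value: "\<exists>e\<in>B. \<forall>b\<in>B. (\<one>\<^bsub>E\<^esub> \<ominus>\<^bsub>E\<^esub> e) \<otimes>\<^bsub>E\<^esub> b \<in> mE"
proof (rule ex_dominating_idempotent_mod[of B])
  show "B \<subseteq> carrier E" by (auto simp: B_def)
  show "B \<noteq> {}"
  proof -
    have "F (\<lambda>_. \<zero>)" by (rule linear_mapI) simp_all
    moreover have "\<zero>\<^bsub>M\<^esub> \<in> C" using m_carrier by (auto simp: C_def intro!: bexI[of _ "\<zero>\<^bsub>M\<^esub>"])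
    ultimately have "\<zero>\<^bsub>E\<^esub> \<in> B" using x_m by (intro BI) simp_all
    then show ?thesis by blast
  qed
  show "s \<otimes>\<^bsub>E\<^esub> b \<in> B" if s: "s \<in> carrier E" and b: "b \<in> B" for s b
  proof -
    obtain f v where fv: "b \<in> carrier E" "F f" "v \<in> C" "b x = f v" using b by (auto simp: B_def)
    then show ?thesis using s x_m by (intro BI[OF _ F_E[OF s fv(2)] fv(3)]) simp_all
  qed
  show "\<exists>d\<in>B. d \<ominus>\<^bsub>E\<^esub> (e \<oplus>\<^bsub>E\<^esub> (\<one>\<^bsub>E\<^esub> \<ominus>\<^bsub>E\<^esub> e) \<otimes>\<^bsub>E\<^esub> b) \<in> mE"
    if e: "e \<in> B" and b: "b \<in> B" and idem: "e \<otimes>\<^bsub>E\<^esub> e \<ominus>\<^bsub>E\<^esub> e \<in> mE" for e b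
  proof -
    obtain h c where hc: "e \<in> carrier E" "F h" "c \<in> C" "e x = h c" using e by (auto simp: B_def)
    obtain h' c' where hc': "b \<in> carrier E" "F h'" "c' \<in> C" "b x = h' c'" using b by (auto simp: B_def)
    obtain a where a: "a \<in> carrier E" "a x = h c'" by (rule C_value[OF hc(2) hc'(3)])
    obtain a' where a': "a' \<in> carrier E" "a' x = h' c" by (rule C_value[OF hc'(2) hc(3)])
    define t where "t = \<one>\<^bsub>E\<^esub> \<ominus>\<^bsub>E\<^esub> e"
    have t: "t \<in> carrier E" using hc by (simp add: t_def)
    define f where "f = (\<lambda>u. e (h u) \<oplus> t (h' u))"
    have f: "F f" unfolding f_def by (rule functional_add[OF F_E[OF hc(1,2)] F_E[OF t hc'(2)]])
    define v where "v = act e c \<oplus>\<^bsub>M\<^esub> act t c'"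
    have v: "v \<in> C" unfolding v_def by (rule C_add[OF C_act[OF hc(1,3)] C_act[OF t hc'(3)]])
    note cc = C_carrier[OF hc(3)] C_carrier[OF hc'(3)]
    note ac = act_closed[OF hc(1) cc(1)] act_closed[OF t cc(2)]
    have gv: "g v = e (g c) \<oplus> t (g c')" if g: "F g" for g
      unfolding v_def using F_add[OF g ac] act_apply[OF hc(1) cc(1) g] act_apply[OF t cc(2) g] by simp
    define d where "d = e \<otimes>\<^bsub>E\<^esub> (e \<otimes>\<^bsub>E\<^esub> e \<oplus>\<^bsub>E\<^esub> t \<otimes>\<^bsub>E\<^esub> a) \<oplus>\<^bsub>E\<^esub> t \<otimes>\<^bsub>E\<^esub> (e \<otimes>\<^bsub>E\<^esub> a' \<oplus>\<^bsub>E\<^esub> t \<otimes>\<^bsub>E\<^esub> b)"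
    have d: "d \<in> carrier E" unfolding d_def using hc(1) hc'(1) a(1) a'(1) t by simp
    have "d x = f v"
      unfolding f_def gv[OF hc(2)] gv[OF hc'(2)] d_def
      using x_m by (simp add: hc(4) hc'(4) a(2) a'(2))
    then have "d \<in> B" by (rule BI[OF d f v])
    moreover have "d \<ominus>\<^bsub>E\<^esub> (e \<oplus>\<^bsub>E\<^esub> t \<otimes>\<^bsub>E\<^esub> b) \<in> mE"
    proof -
      \<comment> \<open>The defect of idempotence. The products \<open>e e\<close>,
        \<open>e t\<close> and \<open>t t\<close> equal \<open>e + n\<close>, \<open>- n\<close> and
        \<open>t + n\<close>, so \<open>d\<close> differs from \<open>e + t b\<close> by an explicit
        multiple of \<open>n\<close>.\<close>
      define n where "n = e \<otimes>\<^bsub>E\<^esub> e \<ominus>\<^bsub>E\<^esub> e"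
      note [simp] = hc(1) hc'(1) a(1) a'(1) t
      have n: "n \<in> carrier E" "n \<in> mE" using idem by (simp_all add: n_def)
      note c = hc(1) hc'(1) a(1) a'(1) t n(1)
      have et: "e \<otimes>\<^bsub>E\<^esub> t = \<ominus>\<^bsub>E\<^esub> n" unfolding t_def n_def using hc(1) by algebra
      have "t \<otimes>\<^bsub>E\<^esub> t = t \<ominus>\<^bsub>E\<^esub> e \<otimes>\<^bsub>E\<^esub> t" unfolding t_def using hc(1) by algebra
      then have tt: "t \<otimes>\<^bsub>E\<^esub> t = t \<oplus>\<^bsub>E\<^esub> n" unfolding et using c by (simp add: a_minus_def)
      have ee: "e \<otimes>\<^bsub>E\<^esub> e = e \<oplus>\<^bsub>E\<^esub> n" unfolding n_def using hc(1) by algebra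
      have "d = e \<otimes>\<^bsub>E\<^esub> (e \<oplus>\<^bsub>E\<^esub> n) \<oplus>\<^bsub>E\<^esub> (e \<otimes>\<^bsub>E\<^esub> t) \<otimes>\<^bsub>E\<^esub> (a \<oplus>\<^bsub>E\<^esub> a') \<oplus>\<^bsub>E\<^esub> (t \<otimes>\<^bsub>E\<^esub> t) \<otimes>\<^bsub>E\<^esub> b"
        unfolding d_def ee using c by (simp add: E.r_distr E.l_distr E.m_ac E.a_ac)
      also have "\<dots> = e \<oplus>\<^bsub>E\<^esub> t \<otimes>\<^bsub>E\<^esub> b \<oplus>\<^bsub>E\<^esub> n \<otimes>\<^bsub>E\<^esub> (\<one>\<^bsub>E\<^esub> \<oplus>\<^bsub>E\<^esub> e \<ominus>\<^bsub>E\<^esub> (a \<oplus>\<^bsub>E\<^esub> a') \<oplus>\<^bsub>E\<^esub> b)"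
        unfolding et tt E.r_distr[OF hc(1) n(1) hc(1)] ee using c
        by (simp add: E.r_distr E.l_distr E.l_minus E.r_minus E.m_ac E.a_ac a_minus_def E.minus_add)
      finally have "d = (e \<oplus>\<^bsub>E\<^esub> t \<otimes>\<^bsub>E\<^esub> b) \<oplus>\<^bsub>E\<^esub> n \<otimes>\<^bsub>E\<^esub> (\<one>\<^bsub>E\<^esub> \<oplus>\<^bsub>E\<^esub> e \<ominus>\<^bsub>E\<^esub> (a \<oplus>\<^bsub>E\<^esub> a') \<oplus>\<^bsub>E\<^esub> b)" .
      moreover have "(p \<oplus>\<^bsub>E\<^esub> q) \<ominus>\<^bsub>E\<^esub> p = q" if "p \<in> carrier E" "q \<in> carrier E" for p q
        using that by algebra
      ultimately have "d \<ominus>\<^bsub>E\<^esub> (e \<oplus>\<^bsub>E\<^esub> t \<otimes>\<^bsub>E\<^esub> b) = n \<otimes>\<^bsub>E\<^esub> (\<one>\<^bsub>E\<^esub> \<oplus>\<^bsub>E\<^esub> e \<ominus>\<^bsub>E\<^esub> (a \<oplus>\<^bsub>E\<^esub> a') \<oplus>\<^bsub>E\<^esub> b)"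
        using c by simp
      then show ?thesis using mE.I_r_closed[OF n(2)] c by simp
    qed
    ultimately show ?thesis unfolding t_def by blast
  qed
qed blast

end

context m_valued_module
begin

text \<open>With \<open>e = h(c)\<close> dominating all values, \<open>1 - e\<close> maps \<open>C\<close> into \<open>xM\<close> by reflexivity.  As some
  power of \<open>\<mm>\<close> lies in \<open>xR\<close>, a power of \<open>1 - e\<close> maps \<open>M\<close> into \<open>xM\<close>, so \<open>M = eM\<close> by Nakayama.
  Then \<open>M = \<mm>c \<oplus> ker h\<close> and \<open>h(M) = e\<mm>\<close>.\<close>

lemma indecomposable_embedding:
  assumes ind: "Ref_indecomposable R M"
  obtains e h where "e \<in> carrier E" and "F h" and "inj_on h (carrier M)" and "h ` carrier M = e ` \<mm>"
proof -
  obtain e where eB: "e \<in> B" and dom: "\<And>b. b \<in> B \<Longrightarrow> (\<one>\<^bsub>E\<^esub> \<ominus>\<^bsub>E\<^esub> e) \<otimes>\<^bsub>E\<^esub> b \<in> mE"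
    using ex_dominating_value by blast
  obtain h c where e: "e \<in> carrier E" and h: "F h" and c: "c \<in> C" and hc: "e x = h c"
    using eB by (auto simp: B_def)
  note cc = C_carrier[OF c]
  define t where "t = \<one>\<^bsub>E\<^esub> \<ominus>\<^bsub>E\<^esub> e"
  have t: "t \<in> carrier E" using e by (simp add: t_def)
  note tc = act_closed[OF t]
  \<comment> \<open>A functional sends \<open>t v\<close> to \<open>(t b)(x)\<close> for some value
    \<open>b\<close>. As \<open>t b\<close> lies in \<open>\<mm>\<close>, this is divisible by
    \<open>x\<close>, for every functional.\<close>
  have t_C: "\<exists>w\<in>carrier M. act t v = x \<odot>\<^bsub>M\<^esub> w" if v: "v \<in> C" for v
  proof (rule ex_quotient)
    note vc = C_carrier[OF v]
    show "act t v \<in> carrier M" by (rule tc[OF vc])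
    fix f assume f: "F f"
    obtain b where b: "b \<in> carrier E" "b x = f v" by (rule C_value[OF f v])
    then have "t \<otimes>\<^bsub>E\<^esub> b \<in> mE" using dom[OF BI[OF b(1) f v b(2)]] by (simp add: t_def)
    then obtain p where p: "p \<in> \<mm>" "t \<otimes>\<^bsub>E\<^esub> b = scal p" by (auto simp: mE_def)
    have "f (act t v) = (t \<otimes>\<^bsub>E\<^esub> b) x" using act_apply[OF t vc f] b(2) x_m by simp
    also have "\<dots> = x \<otimes> p" unfolding p(2) using x_m m_comm[OF x_carrier m_carrier[OF p(1)]] by simp
    finally show "\<exists>r\<in>carrier R. f (act t v) = x \<otimes> r" using m_carrier[OF p(1)] by blast
  qed
  have pow_closed: "(act t ^^ j) v \<in> carrier M" if "v \<in> carrier M" for j v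
    by (induction j) (use that tc in simp_all)
  have pow_smult: "(act t ^^ j) (r \<odot>\<^bsub>M\<^esub> v) = r \<odot>\<^bsub>M\<^esub> (act t ^^ j) v"
    if "r \<in> carrier R" "v \<in> carrier M" for j r v
    by (induction j) (use that act_smult[OF t] pow_closed in simp_all)
  \<comment> \<open>The \<open>j\<close>-th power of \<open>t\<close> carries
    \<open>(xR : \<mm>^j) M\<close> into \<open>xM\<close>. For \<open>r\<close> in the next colon
    ideal, multiplying \<open>t^j (r v)\<close> by any \<open>p\<close> in \<open>\<mm>\<close>
    lands in \<open>xM\<close> by induction; so it belongs to \<open>C\<close>, and one more
    \<open>t\<close> brings it into \<open>xM\<close>.\<close>
  have pow_dvd: "\<exists>w\<in>carrier M. (act t ^^ j) (r \<odot>\<^bsub>M\<^esub> v) = x \<odot>\<^bsub>M\<^esub> w"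
    if "r \<in> carrier R" "r \<in> colon_chain x j" "v \<in> carrier M" for j r v
    using that
  proof (induction j arbitrary: r v)
    case 0
    then obtain r' where r': "r' \<in> carrier R" "r = x \<otimes> r'" by auto
    then have "r \<odot>\<^bsub>M\<^esub> v = x \<odot>\<^bsub>M\<^esub> (r' \<odot>\<^bsub>M\<^esub> v)" using 0 by (simp add: M.smult_assoc1)
    then show ?case using r' 0 by auto
  next
    case (Suc j)
    let ?u = "(act t ^^ j) (r \<odot>\<^bsub>M\<^esub> v)"
    have rv: "r \<odot>\<^bsub>M\<^esub> v \<in> carrier M" using Suc.prems by simp
    have "?u \<in> C"
      unfolding C_def
    proof (intro CollectI conjI ballI)
      show "?u \<in> carrier M" by (rule pow_closed[OF rv])
      fix p assume p: "p \<in> \<mm>"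
      note pc = m_carrier[OF p]
      have "p \<otimes> r \<in> colon_chain x j" using Suc.prems(2) p by simp
      then obtain w where w: "w \<in> carrier M" "(act t ^^ j) ((p \<otimes> r) \<odot>\<^bsub>M\<^esub> v) = x \<odot>\<^bsub>M\<^esub> w"
        using Suc.IH[of "p \<otimes> r" v] Suc.prems pc by auto
      have "p \<odot>\<^bsub>M\<^esub> ?u = (act t ^^ j) ((p \<otimes> r) \<odot>\<^bsub>M\<^esub> v)"
        using pow_smult[OF pc rv] Suc.prems pc by (simp add: M.smult_assoc1)
      then show "\<exists>w\<in>carrier M. p \<odot>\<^bsub>M\<^esub> ?u = x \<odot>\<^bsub>M\<^esub> w" using w by auto
    qed
    then show ?case using t_C by simp
  qed
  \<comment> \<open>With \<open>r = \<one>\<close> the previous claim says that \<open>t^n\<close>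
    maps all of \<open>M\<close> into \<open>xM\<close>.\<close>
  obtain n where n: "\<one> \<in> colon_chain x n" by (rule colon_chain_exhausts[OF x_regular])
  define N where "N = act e ` carrier M"
  have N: "submodule N R M"
  proof (rule M.submoduleI)
    have act0: "act e \<zero>\<^bsub>M\<^esub> = \<zero>\<^bsub>M\<^esub>" using act_smult[OF e zero_closed M.zero_closed] act_closed[OF e M.zero_closed] by simp
    then show "\<zero>\<^bsub>M\<^esub> \<in> N" unfolding N_def by (metis M.zero_closed image_eqI)
    show sm: "a \<odot>\<^bsub>M\<^esub> u \<in> N" if "a \<in> carrier R" "u \<in> N" for a u
      using that act_smult[OF e] by (auto simp: N_def simp flip: act_smult[OF e])
    show sub: "N \<subseteq> carrier M" using act_closed[OF e] by (auto simp: N_def)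
    show "u \<oplus>\<^bsub>M\<^esub> v \<in> N" if "u \<in> N" "v \<in> N" for u v
      using that by (auto simp: N_def simp flip: act_add[OF e])
    show "\<ominus>\<^bsub>M\<^esub> u \<in> N" if "u \<in> N" for u
    proof -
      have "\<ominus>\<^bsub>M\<^esub> u = (\<ominus> \<one>) \<odot>\<^bsub>M\<^esub> u" using M.smult_l_minus[of \<one> u] that sub by auto
      then show ?thesis using sm[of "\<ominus> \<one>" u] that by simp
    qed
  qed
  have decomp: "\<exists>u\<in>carrier M. v = act e u \<oplus>\<^bsub>M\<^esub> (act t ^^ j) v" if v: "v \<in> carrier M" for j v
  proof (induction j)
    case 0
    have "act e \<zero>\<^bsub>M\<^esub> = \<zero>\<^bsub>M\<^esub>" using act_smult[OF e zero_closed M.zero_closed] act_closed[OF e M.zero_closed] by simp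
    then show ?case using v by (intro bexI[of _ "\<zero>\<^bsub>M\<^esub>"]) simp_all
  next
    case (Suc j)
    then obtain u where u: "u \<in> carrier M" "v = act e u \<oplus>\<^bsub>M\<^esub> (act t ^^ j) v" by blast
    define w where "w = (act t ^^ j) v"
    have w: "w \<in> carrier M" unfolding w_def by (rule pow_closed[OF v])
    have "v = act e u \<oplus>\<^bsub>M\<^esub> (act e w \<oplus>\<^bsub>M\<^esub> act t w)"
      using u(2) act_split[OF e w] by (simp add: w_def t_def)
    also have "\<dots> = act e (u \<oplus>\<^bsub>M\<^esub> w) \<oplus>\<^bsub>M\<^esub> act t w"
      using act_add[OF e u(1) w] act_closed[OF e u(1)] act_closed[OF e w] tc[OF w] by (simp add: M.a_assoc)
    finally show ?case using u(1) w by (intro bexI[of _ "u \<oplus>\<^bsub>M\<^esub> w"]) (simp_all add: w_def)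
  qed
  have "N = carrier M"
  proof (rule nakayama[OF module finitely_generated N x_m])
    fix v assume v: "v \<in> carrier M"
    obtain u where u: "u \<in> carrier M" "v = act e u \<oplus>\<^bsub>M\<^esub> (act t ^^ n) v" using decomp[OF v] by blast
    obtain w where w: "w \<in> carrier M" "(act t ^^ n) v = x \<odot>\<^bsub>M\<^esub> w"
      using pow_dvd[OF _ n v] v by auto
    then have "v = act e u \<oplus>\<^bsub>M\<^esub> x \<odot>\<^bsub>M\<^esub> w" using u(2) by simp
    then show "\<exists>n\<in>N. \<exists>w\<in>carrier M. v = n \<oplus>\<^bsub>M\<^esub> x \<odot>\<^bsub>M\<^esub> w" using u(1) w(1) unfolding N_def by blast
  qed
  then have surj: "\<exists>u'\<in>carrier M. u = act e u'" if "u \<in> carrier M" for u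
    using that unfolding N_def by blast
  \<comment> \<open>Since \<open>c\<close> is \<open>x\<close> times an element of
    \<open>M : \<mm>\<close>, this is \<open>\<mm>\<close> times that element: the first summand in
    the splitting of \<open>M\<close>.\<close>
  define H where "H = {w \<in> carrier M. \<exists>p\<in>\<mm>. x \<odot>\<^bsub>M\<^esub> w = p \<odot>\<^bsub>M\<^esub> c}"
  have h_value: "h w = e p" if "w \<in> carrier M" "p \<in> \<mm>" "x \<odot>\<^bsub>M\<^esub> w = p \<odot>\<^bsub>M\<^esub> c" for w p
  proof (rule x_cancel)
    have "x \<otimes> h w = p \<otimes> e x"
      using F_smult[OF h x_carrier that(1)] F_smult[OF h m_carrier[OF that(2)] cc] that(3) hc by simp
    then show "x \<otimes> h w = x \<otimes> e p"
      using E_sym[OF e that(2) x_m] E_sym[OF e x_m that(2)] E_carrier[OF e that(2)] E_carrier[OF e x_m]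
        m_comm[of p "e x"] m_carrier[OF that(2)] by simp
  qed (use F_carrier[OF h that(1)] E_carrier[OF e that(2)] in simp_all)
  have lift: "\<exists>w\<in>H. h w = e p" if p: "p \<in> \<mm>" for p
  proof -
    obtain w where w: "w \<in> carrier M" "p \<odot>\<^bsub>M\<^esub> c = x \<odot>\<^bsub>M\<^esub> w" using c p unfolding C_def by blast
    then have "w \<in> H" using p unfolding H_def by (intro CollectI conjI bexI[of _ p]) simp_all
    then show ?thesis using h_value[OF w(1) p w(2)[symmetric]] by blast
  qed
  have image: "\<exists>p\<in>\<mm>. h u = e p" if u: "u \<in> carrier M" for u
  proof -
    obtain u' where u': "u' \<in> carrier M" "u = act e u'" using surj[OF u] by blast
    then show ?thesis using act_apply[OF e u'(1) h] m_valued[OF h u'(1)] by blast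
  qed
  have "inj_on h (carrier M)"
  proof (rule Ref_indecomposable_inj[OF ind h, of H])
    show "submodule H R M"
    proof (rule M.submoduleI)
      show "\<zero>\<^bsub>M\<^esub> \<in> H" using cc by (auto simp: H_def intro!: bexI[of _ \<zero>])
      show sm: "a \<odot>\<^bsub>M\<^esub> w \<in> H" if a: "a \<in> carrier R" and w: "w \<in> H" for a w
      proof -
        obtain p where p: "p \<in> \<mm>" "x \<odot>\<^bsub>M\<^esub> w = p \<odot>\<^bsub>M\<^esub> c" and wc: "w \<in> carrier M" using w by (auto simp: H_def)
        have "x \<odot>\<^bsub>M\<^esub> (a \<odot>\<^bsub>M\<^esub> w) = (a \<otimes> x) \<odot>\<^bsub>M\<^esub> w"
          using a wc m_comm[of x a] by (simp flip: M.smult_assoc1)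
        also have "\<dots> = (a \<otimes> p) \<odot>\<^bsub>M\<^esub> c" using a wc p(2) m_carrier[OF p(1)] cc by (simp add: M.smult_assoc1)
        finally show ?thesis using a wc max.I_l_closed[OF p(1) a] by (auto simp: H_def)
      qed
      show sub: "H \<subseteq> carrier M" by (auto simp: H_def)
      show "v \<oplus>\<^bsub>M\<^esub> w \<in> H" if v: "v \<in> H" and w: "w \<in> H" for v w
      proof -
        obtain p where p: "p \<in> \<mm>" "x \<odot>\<^bsub>M\<^esub> v = p \<odot>\<^bsub>M\<^esub> c" and vc: "v \<in> carrier M" using v by (auto simp: H_def)
        obtain q where q: "q \<in> \<mm>" "x \<odot>\<^bsub>M\<^esub> w = q \<odot>\<^bsub>M\<^esub> c" and wc: "w \<in> carrier M" using w by (auto simp: H_def)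
        have "x \<odot>\<^bsub>M\<^esub> (v \<oplus>\<^bsub>M\<^esub> w) = (p \<oplus> q) \<odot>\<^bsub>M\<^esub> c"
          using p(2) q(2) vc wc cc m_carrier[OF p(1)] m_carrier[OF q(1)]
          by (simp add: M.smult_r_distr M.smult_l_distr)
        then show ?thesis using vc wc max.a_closed[OF p(1) q(1)] by (auto simp: H_def)
      qed
      show "\<ominus>\<^bsub>M\<^esub> w \<in> H" if w: "w \<in> H" for w
      proof -
        have "\<ominus>\<^bsub>M\<^esub> w = (\<ominus> \<one>) \<odot>\<^bsub>M\<^esub> w" using M.smult_l_minus[of \<one> w] w sub by auto
        then show ?thesis using sm[of "\<ominus> \<one>" w] w by simp
      qed
    qed
    show "\<exists>w\<in>H. h w = h u" if u: "u \<in> carrier M" for u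
      using image[OF u] lift by auto
    show "w = \<zero>\<^bsub>M\<^esub>" if w: "w \<in> H" and zero: "h w = \<zero>" for w
    proof (rule torsion_free)
      obtain p where p: "p \<in> \<mm>" "x \<odot>\<^bsub>M\<^esub> w = p \<odot>\<^bsub>M\<^esub> c" using w by (auto simp: H_def)
      show wc: "w \<in> carrier M" using w by (simp add: H_def)
      have ep: "e p = \<zero>" using h_value[OF wc p] zero by simp
      \<comment> \<open>Here \<open>M = eM\<close> is used: with \<open>c = e c'\<close>, each
        functional gives \<open>f(p c) = p e(f c') = e(p) f(c') = 0\<close>, so \<open>h\<close> is
        injective on \<open>H\<close>.\<close>
      obtain c' where c': "c' \<in> carrier M" "c = act e c'" using surj[OF cc] by blast
      have "p \<odot>\<^bsub>M\<^esub> c = \<zero>\<^bsub>M\<^esub>"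
      proof (rule M_eqI)
        fix f assume f: "F f"
        have "f (p \<odot>\<^bsub>M\<^esub> c) = p \<otimes> e (f c')"
          using F_smult[OF f m_carrier[OF p(1)] cc] act_apply[OF e c'(1) f] c'(2) by simp
        also have "\<dots> = e p \<otimes> f c'" by (rule E_sym[OF e p(1) m_valued[OF f c'(1)]])
        finally show "f (p \<odot>\<^bsub>M\<^esub> c) = f \<zero>\<^bsub>M\<^esub>" using ep F_zero[OF f] F_carrier[OF f c'(1)] by simp
      qed (use m_carrier[OF p(1)] cc in simp_all)
      then show "x \<odot>\<^bsub>M\<^esub> w = x \<odot>\<^bsub>M\<^esub> \<zero>\<^bsub>M\<^esub>" using p(2) by simp
    qed simp
    show "\<exists>u\<in>carrier M. h u \<noteq> \<zero>"
    proof (rule ccontr)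
      assume "\<not> ?thesis"
      \<comment> \<open>If \<open>h\<close> vanished, then so would \<open>e\<close>, and
        \<open>M = eM\<close> would be zero.\<close>
      then have "e x = \<zero>" using hc cc by simp
      then have e0: "e = \<zero>\<^bsub>E\<^esub>" by (intro E_eqI[OF e E.zero_closed]) (simp add: x_m)
      have "u = \<zero>\<^bsub>M\<^esub>" if u: "u \<in> carrier M" for u
      proof -
        obtain u' where u': "u' \<in> carrier M" "u = act e u'" using surj[OF u] by blast
        show ?thesis
        proof (rule M_eqI[OF u M.zero_closed])
          fix f assume f: "F f"
          show "f u = f \<zero>\<^bsub>M\<^esub>"
            using act_apply[OF e u'(1) f] u'(2) e0 m_valued[OF f u'(1)] F_zero[OF f] by simp
        qed
      qed
      then have "carrier M = {\<zero>\<^bsub>M\<^esub>}" using M.zero_closed by blast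
      then show False using ind by (simp add: Ref_indecomposable_def)
    qed
  qed
  moreover have "h ` carrier M = e ` \<mm>"
  proof (intro equalityI subsetI)
    show "y \<in> e ` \<mm>" if "y \<in> h ` carrier M" for y using that image by blast
    show "y \<in> h ` carrier M" if y: "y \<in> e ` \<mm>" for y
    proof -
      obtain p where "p \<in> \<mm>" "y = e p" using y by blast
      then obtain w where "w \<in> H" "y = h w" using lift by metis
      then show ?thesis by (auto simp: H_def)
    qed
  qed
  ultimately show thesis by (rule that[OF e h])
qed

end

text \<open>After rescaling, some \<open>v\<close> has \<open>f v = 1\<close>. Then
  \<open>Rv\<close> is a nonzero free summand complementary to the kernel of \<open>f\<close>, and
  indecomposability kills the kernel.\<close>

lemma (in reduced_local_dim_one) free_if_unit_value:
  assumes ind: "Ref_indecomposable R M" and f: "functional R M f"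
    and u: "u \<in> carrier M" "f u \<notin> \<mm>"
  shows "inj_on f (carrier M)" and "f ` carrier M = carrier R"
proof -
  have M: "module R M" using ind by (simp add: Ref_indecomposable_def Ref_obj_def)
  interpret M: module R M by (rule M)
  note fc = linear_map_closed[OF f, simplified] and f_smult = linear_map_smult[OF f, simplified]
  have unit: "f u \<in> Units R" using unit_if_notin fc u by blast
  define v where "v = inv (f u) \<odot>\<^bsub>M\<^esub> u"
  have v: "v \<in> carrier M" "f v = \<one>" unfolding v_def using unit u f_smult by simp_all
  have fv: "f (a \<odot>\<^bsub>M\<^esub> v) = a" if "a \<in> carrier R" for a using f_smult[OF that v(1)] v(2) that by simp
  define H where "H = (\<lambda>a. a \<odot>\<^bsub>M\<^esub> v) ` carrier R"
  show "inj_on f (carrier M)"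
  proof (rule Ref_indecomposable_inj[OF ind f, of H])
    show "submodule H R M"
    proof (rule M.submoduleI)
      show "H \<subseteq> carrier M" using v by (auto simp: H_def)
      show "\<zero>\<^bsub>M\<^esub> \<in> H" unfolding H_def by (rule image_eqI[of _ _ \<zero>]) (use v in simp_all)
      show "\<ominus>\<^bsub>M\<^esub> w \<in> H" if "w \<in> H" for w
        using that v by (auto simp: H_def simp flip: M.smult_l_minus)
      show "w \<oplus>\<^bsub>M\<^esub> w' \<in> H" if "w \<in> H" "w' \<in> H" for w w'
        using that v by (auto simp: H_def simp flip: M.smult_l_distr)
      show "a \<odot>\<^bsub>M\<^esub> w \<in> H" if "a \<in> carrier R" "w \<in> H" for a w
        using that v by (auto simp: H_def simp flip: M.smult_assoc1)
    qed
    show "\<exists>w\<in>H. f w = f u'" if "u' \<in> carrier M" for u' using fv fc[OF that] by (auto simp: H_def)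
    show "w = \<zero>\<^bsub>M\<^esub>" if "w \<in> H" "f w = \<zero>" for w using that fv v by (auto simp: H_def)
    have "f u \<noteq> \<zero>" using u(2) max.zero_closed by metis
    then show "\<exists>u\<in>carrier M. f u \<noteq> \<zero>" using u(1) by blast
  qed
  show "f ` carrier M = carrier R"
  proof (intro equalityI subsetI)
    show "a \<in> f ` carrier M" if "a \<in> carrier R" for a
      by (rule image_eqI[of _ _ "a \<odot>\<^bsub>M\<^esub> v"]) (use fv that v in simp_all)
  qed (use fc in auto)
qed

section \<open>The finite list of ideals\<close>

context seminormal_dim_one
begin

lemma E_image_ideal:
  assumes e: "e \<in> carrier E"
  shows "ideal (e ` \<mm>) R"
proof (rule ideal_cringI)
  show "e ` \<mm> \<subseteq> carrier R" using E_carrier[OF e] by blast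
  show "\<zero> \<in> e ` \<mm>" using E_zero[OF e] max.zero_closed by (metis image_eqI)
  show "a \<oplus> b \<in> e ` \<mm>" if "a \<in> e ` \<mm>" "b \<in> e ` \<mm>" for a b
    using that by (auto simp flip: E_add[OF e])
  show "r \<otimes> a \<in> e ` \<mm>" if "a \<in> e ` \<mm>" "r \<in> carrier R" for a r
    using that max.I_l_closed by (auto simp flip: E_smult[OF e])
qed

text \<open>\<open>e\<mm>\<close> is isomorphic to \<open>\<mm> / (\<mm> \<inter> ann e(x))\<close>.\<close>

lemma E_image_transfer:
  assumes e: "e \<in> carrier E" and e': "e' \<in> carrier E"
    and ann: "annihilator (e x) = annihilator (e' x)"
    and M: "module R M" and f: "functional R M f"
    and inj: "inj_on f (carrier M)" and img: "f ` carrier M = e ` \<mm>"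
  shows "\<exists>g. functional R M g \<and> inj_on g (carrier M) \<and> g ` carrier M = e' ` \<mm>"
proof -
  \<comment> \<open>From \<open>x d(p) = p d(x)\<close> and regularity of \<open>x\<close>, the
    kernel of \<open>d\<close> on \<open>\<mm>\<close> is the part of the annihilator of
    \<open>d x\<close> inside \<open>\<mm>\<close>. Equal annihilators therefore give
    \<open>e\<close> and \<open>e'\<close> the same kernel.\<close>
  have zero_iff: "d p = \<zero> \<longleftrightarrow> p \<in> annihilator (d x)" if d: "d \<in> carrier E" and p: "p \<in> \<mm>" for d p
  proof -
    note c = m_carrier[OF p] E_carrier[OF d p] E_carrier[OF d x_m]
    have s: "x \<otimes> d p = p \<otimes> d x" using E_sym[OF d x_m p] m_comm[of "d x" p] c by simp
    have "d p = \<zero> \<longleftrightarrow> x \<otimes> d p = \<zero>" using x_cancel[of "d p" \<zero>] c by auto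
    then show ?thesis unfolding s using c by (simp add: annihilator_def)
  qed
  have eq_iff: "d p = d q \<longleftrightarrow> p \<ominus> q \<in> annihilator (d x)"
    if d: "d \<in> carrier E" and p: "p \<in> \<mm>" and q: "q \<in> \<mm>" for d p q
  proof -
    have pq: "p \<ominus> q \<in> \<mm>" unfolding a_minus_def using p q by simp
    have "(p \<ominus> q) \<oplus> q = p" using m_carrier[OF p] m_carrier[OF q] by algebra
    then have "d p = d (p \<ominus> q) \<oplus> d q" using E_add[OF d pq q] by simp
    then have "d p = d q \<longleftrightarrow> d (p \<ominus> q) = \<zero>"
      using E_carrier[OF d pq] E_carrier[OF d q] by (simp add: add.l_cancel_one')
    then show ?thesis using zero_iff[OF d pq] by simp
  qed
  have transfer: "e p = e q \<longleftrightarrow> e' p = e' q" if "p \<in> \<mm>" "q \<in> \<mm>" for p q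
    using eq_iff[OF e that] eq_iff[OF e' that] ann by simp
  \<comment> \<open>A preimage of \<open>f u\<close> under \<open>e\<close>. It is not linear in
    \<open>u\<close>, but \<open>e' (s u)\<close> does not depend on the choice, since
    \<open>e\<close> and \<open>e'\<close> identify the same elements of
    \<open>\<mm>\<close>.\<close>
  define s where "s = (\<lambda>u. SOME p. p \<in> \<mm> \<and> f u = e p)"
  have s: "s u \<in> \<mm>" "f u = e (s u)" if "u \<in> carrier M" for u
  proof -
    have "\<exists>p. p \<in> \<mm> \<and> f u = e p" using img that by blast
    then have "s u \<in> \<mm> \<and> f u = e (s u)" unfolding s_def by (rule someI_ex)
    then show "s u \<in> \<mm>" "f u = e (s u)" by blast+
  qed
  have key: "e' (s u) = e' p" if "u \<in> carrier M" "p \<in> \<mm>" "f u = e p" for u p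
    using transfer[OF s(1)[OF that(1)] that(2)] s(2)[OF that(1)] that(3) by simp
  note f_add = linear_map_add[OF f, simplified] and f_smult = linear_map_smult[OF f, simplified]
  have "functional R M (\<lambda>u. e' (s u))"
  proof (rule linear_mapI)
    interpret M: module R M by (rule M)
    show "e' (s u) \<in> carrier (regular_module R)" if "u \<in> carrier M" for u
      using E_carrier[OF e' s(1)[OF that]] by simp
    show "e' (s (u \<oplus>\<^bsub>M\<^esub> v)) = e' (s u) \<oplus>\<^bsub>regular_module R\<^esub> e' (s v)"
      if u: "u \<in> carrier M" and v: "v \<in> carrier M" for u v
      using key[OF M.a_closed[OF u v], of "s u \<oplus> s v"] s[OF u] s[OF v] f_add[OF u v]
        E_add[OF e s(1)[OF u] s(1)[OF v]] E_add[OF e' s(1)[OF u] s(1)[OF v]] by simp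
    show "e' (s (a \<odot>\<^bsub>M\<^esub> u)) = a \<odot>\<^bsub>regular_module R\<^esub> e' (s u)"
      if a: "a \<in> carrier R" and u: "u \<in> carrier M" for a u
      using key[OF M.smult_closed[OF a u], of "a \<otimes> s u"] s[OF u] f_smult[OF a u]
        E_smult[OF e s(1)[OF u] a] E_smult[OF e' s(1)[OF u] a] max.I_l_closed[OF s(1)[OF u] a] by simp
  qed
  moreover have "inj_on (\<lambda>u. e' (s u)) (carrier M)"
  proof (rule inj_onI)
    fix u v assume uv: "u \<in> carrier M" "v \<in> carrier M" "e' (s u) = e' (s v)"
    then have "e (s u) = e (s v)" using transfer[OF s(1) s(1)] by blast
    then have "f u = f v" using s(2) uv by simp
    then show "u = v" using inj uv by (simp add: inj_on_eq_iff)
  qed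
  moreover have "(\<lambda>u. e' (s u)) ` carrier M = e' ` \<mm>"
  proof (intro equalityI subsetI)
    show "y \<in> e' ` \<mm>" if "y \<in> (\<lambda>u. e' (s u)) ` carrier M" for y using that s(1) by blast
    show "y \<in> (\<lambda>u. e' (s u)) ` carrier M" if y: "y \<in> e' ` \<mm>" for y
    proof -
      obtain p where p: "p \<in> \<mm>" "y = e' p" using y by blast
      then have "e p \<in> f ` carrier M" using img by blast
      then obtain u where "u \<in> carrier M" "f u = e p" by (metis imageE)
      then show ?thesis using key p by (metis image_eqI)
    qed
  qed
  ultimately show ?thesis by blast
qed

text \<open>The list consists of \<open>R\<close>, for modules with a free summand, and one ideal
  \<open>e \<mm>\<close> for each annihilator of a value \<open>e x\<close>. It is chosen before
  \<open>M\<close>.\<close>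

lemma finitely_many_ideals:
  "\<exists>\<J>. finite \<J> \<and> (\<forall>J\<in>\<J>. ideal J R) \<and>
    (\<forall>M :: ('a, 'c) module. Ref_indecomposable R M \<longrightarrow>
      (\<exists>f. functional R M f \<and> inj_on f (carrier M) \<and> f ` carrier M \<in> \<J>))"
proof -
  define \<A> where "\<A> = (\<lambda>e. annihilator (e x)) ` carrier E"
  define r where "r = (\<lambda>A. SOME e. e \<in> carrier E \<and> annihilator (e x) = A)"
  have r: "r A \<in> carrier E" "annihilator (r A x) = A" if "A \<in> \<A>" for A
  proof -
    have "\<exists>e. e \<in> carrier E \<and> annihilator (e x) = A" using that by (auto simp: \<A>_def)
    then have "r A \<in> carrier E \<and> annihilator (r A x) = A" unfolding r_def by (rule someI_ex)
    then show "r A \<in> carrier E" "annihilator (r A x) = A" by blast+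
  qed
  define \<J> where "\<J> = insert (carrier R) ((\<lambda>A. r A ` \<mm>) ` \<A>)"
  have "\<A> \<subseteq> annihilator ` carrier R" using E_carrier x_m by (auto simp: \<A>_def)
  then have "finite \<A>" using finite_annihilators[OF reduced] by (rule finite_subset)
  then have "finite \<J>" by (simp add: \<J>_def)
  moreover have "ideal J R" if "J \<in> \<J>" for J
    using that oneideal E_image_ideal r(1) by (auto simp: \<J>_def)
  moreover have "\<exists>f. functional R M f \<and> inj_on f (carrier M) \<and> f ` carrier M \<in> \<J>"
    if ind: "Ref_indecomposable R M" for M :: "('a, 'c) module"
  proof (cases "\<forall>f u. functional R M f \<longrightarrow> u \<in> carrier M \<longrightarrow> f u \<in> \<mm>")
    case False
    then obtain f u where "functional R M f" "u \<in> carrier M" "f u \<notin> \<mm>" by blast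
    then show ?thesis using free_if_unit_value[OF ind] unfolding \<J>_def by blast
  next
    case True
    have M: "module R M" "reflexive_module R M" "fin_gen_module R M"
      using ind by (auto simp: Ref_indecomposable_def Ref_obj_def)
    interpret M: m_valued_module R \<mm> x M
      by (intro m_valued_module.intro m_valued_module_axioms.intro seminormal_dim_one_axioms M
          True[rule_format])
    obtain e h where e: "e \<in> carrier E" and h: "functional R M h" "inj_on h (carrier M)" "h ` carrier M = e ` \<mm>"
      by (rule M.indecomposable_embedding[OF ind])
    have A: "annihilator (e x) \<in> \<A>" using e by (simp add: \<A>_def)
    have "\<exists>g. functional R M g \<and> inj_on g (carrier M) \<and> g ` carrier M = r (annihilator (e x)) ` \<mm>"
      by (rule E_image_transfer[OF e r(1)[OF A] r(2)[OF A, symmetric] M(1) h])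
    moreover have "r (annihilator (e x)) ` \<mm> \<in> \<J>" using A by (simp add: \<J>_def)
    ultimately show ?thesis by metis
  qed
  ultimately show ?thesis by (intro exI[of _ \<J>] conjI ballI allI impI)
qed

end

theorem corollary6p14:
  fixes R :: "('a, 'r) ring_scheme" and \<mm> :: "'a set"
  assumes "cring R" and "noetherian_ring R"
    and "local_ring_with R \<mm>"
    and "adically_complete R \<mm>"
    and "reduced_ring R"
    and "krull_dim R = 1"
    and "seminormal_ring R"
  shows "Ref_finite_type TYPE('b) R"
proof -
  interpret R: noetherian_cring R using assms(1,2) by (simp add: noetherian_cring_def)
  interpret R: reduced_local_dim_one R \<mm>
    using assms(3,5,6) by unfold_locales auto
  obtain x where x: "x \<in> \<mm>" "R.regular x" by (rule R.ex_regular)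
  interpret R: seminormal_dim_one R \<mm> x
    using assms(7) x by unfold_locales auto
  obtain \<J> where fin: "finite \<J>" and ideal: "\<And>J. J \<in> \<J> \<Longrightarrow> ideal J R"
    and cover: "\<And>M :: ('a, 'b) module. Ref_indecomposable R M \<Longrightarrow>
      \<exists>f. functional R M f \<and> inj_on f (carrier M) \<and> f ` carrier M \<in> \<J>"
    using R.finitely_many_ideals[where 'c = 'b] by metis
  \<comment> \<open>An ideal of the list need not be an indecomposable object, so its copies are
    filtered. Those that represent some \<open>M\<close> survive, because indecomposability passes
    along the isomorphism.\<close>
  define S where "S = {N \<in> ideal_copy R ` \<J>. Ref_indecomposable R N}"
  have "\<exists>N\<in>S. mod_iso R M N \<noteq> {}" if ind: "Ref_indecomposable R M" for M :: "('a, 'b) module"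
  proof -
    have M: "module R M" using ind by (simp add: Ref_indecomposable_def Ref_obj_def)
    obtain f where f: "functional R M f" "inj_on f (carrier M)" "f ` carrier M \<in> \<J>"
      using cover[OF ind] by blast
    define N where "N = ideal_copy R (f ` carrier M)"
    have N: "module R N" unfolding N_def by (rule R.ideal_copy_module[OF ideal[OF f(3)]])
    note iso = linear_map_ideal_copy[OF f(1) refl f(2), folded N_def]
    have "N \<in> S" using f(3) Ref_indecomposable_iso[OF ind N iso] by (simp add: S_def N_def)
    moreover have "mod_iso R M N \<noteq> {}" by (rule mod_iso_nonempty[OF M iso])
    ultimately show ?thesis by blast
  qed
  moreover have "finite S" using fin by (simp add: S_def)
  moreover have "\<forall>N\<in>S. Ref_indecomposable R N" by (simp add: S_def)
  ultimately show ?thesis unfolding Ref_finite_type_def by blast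
qed

end
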